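(* Fix integers $a\ge2$, $d\ge2$ and $k\ge1$. If $d$ is odd, then for some $c>0$, as $t\downarrow0$, $$W_{a,d}(e^{-t/a},k)=\frac{\sin(\pi/a)}{d\sin(\pi(a-1)/(ad))}+O(e^{-c/\sqrt t}).$$ If $d$ is even, then $$W_{a,d}(e^{-t/a},k)=\frac{\sin(\pi/a)}d\left\{\cot\frac{\pi(a-1)}{ad}-\tan(\Theta(t)-\phi)\right\}+O(\sqrt t/\delta^2)$$ uniformly for $0<\delta\le1$ on the set of $t>0$ with $|\cos(\Theta(t)-\phi)|\ge\delta$, provided $\sqrt t\le c\delta$ for a sufficiently small constant $c=c(a,d,k)>0$. The constant in the $O$ term is independent of $\delta$.
   Context: $\Phi(q)=\prod_{n\ge1}(1-q^n)$. For $0<|q|<1$, $$W_{a,d}(q,k)=\frac1d\sum_{z^d=1}\frac{\sum_{m\ge0}z^mq^{am+1}\Phi(q^{am+1})^k}{\sum_{m\ge0}z^mq^{a(m+1)}\Phi(q^{a(m+1)})^k},$$ a meromorphic function of $q$ on $0<|q|<1$. For $t>0$, $$\Theta(t)=\pi^{3/2}\sqrt{\frac{k}{3t}},\qquad \phi=\frac{(k-3)\pi}{8}.$$ Implied constants may depend on $a,d,k$. *)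

theory Defs
  imports "HOL-Complex_Analysis.Complex_Analysis" "HOL-Library.Landau_Symbols"
begin

definition Phi :: "complex \<Rightarrow> complex" where
  "Phi q = (\<Prod>n. 1 - q ^ Suc n)"

definition W_num :: "nat \<Rightarrow> nat \<Rightarrow> complex \<Rightarrow> complex \<Rightarrow> complex" where
  "W_num a k z q = (\<Sum>m. z ^ m * q ^ (a * m + 1) * Phi (q ^ (a * m + 1)) ^ k)"

definition W_den :: "nat \<Rightarrow> nat \<Rightarrow> complex \<Rightarrow> complex \<Rightarrow> complex" where
  "W_den a k z q = (\<Sum>m. z ^ m * q ^ (a * (m + 1)) * Phi (q ^ (a * (m + 1))) ^ k)"

(* The right-hand side of the displayed formula is a meromorphic function of q on 0 < |q| < 1,
   but evaluated pointwise it picks up spurious values x / 0 = 0 at zeros of a denominator.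
   The constant remove_sings replaces them by the limit wherever the singularity is removable,
   and by 0 at genuine poles; the latter have to be excluded separately with is_pole. *)
definition W :: "nat \<Rightarrow> nat \<Rightarrow> complex \<Rightarrow> nat \<Rightarrow> complex" where
  "W a d q k =
     remove_sings (\<lambda>q. 1 / of_nat d * (\<Sum>z | z ^ d = 1. W_num a k z q / W_den a k z q)) q"

definition Theta :: "nat \<Rightarrow> real \<Rightarrow> real" where
  "Theta k t = pi powr (3 / 2) * sqrt (real k / (3 * t))"

definition phi :: "nat \<Rightarrow> real" where
  "phi k = (real k - 3) * pi / 8"

end

theory Submission
  imports Defs "HOL-Probability.Probability" "HOL-Real_Asymp.Real_Asymp"
begin

text \<open>
  Put \<open>F x = exp (- x) * Phi (exp (- x)) ^ k\<close>. At \<open>q = exp (- t / a)\<close> the numerator and the denominator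
  belonging to the root of unity \<open>z = cis \<theta>\<close> are the sums of \<open>cis (m * \<theta>) * F (t * (m + \<alpha>))\<close> with
  \<open>\<alpha> = 1 / a\<close> and \<open>\<alpha> = 1\<close>. In the sector \<open>\<bar>Im x\<bar> \<le> Re x\<close> one has
  \<open>F x = \<kappa> * x powr (- k / 2) * exp (- A / x) * (1 + O(x))\<close> with \<open>A = k * pi^2 / 6\<close>; the modular
  transformation of \<open>Phi\<close> is not needed for this, because the derivative of the logarithm of the quotient
  is bounded. As \<open>F\<close> is flat at \<open>0\<close>, the residue theorem turns each sum into two integrals over the rays
  \<open>arg x = \<plusminus> pi / 4\<close>, with frequencies \<open>\<theta> / t\<close> and \<open>(2 * pi - \<theta>) / t\<close>. These rays pass through the saddle
  points, so the integrals have size \<open>exp (- sqrt (2 * A * \<theta> / t))\<close> and \<open>exp (- sqrt (2 * A * (2 * pi - \<theta>) / t))\<close>.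
  For \<open>\<theta> < pi\<close> the first one dominates exponentially and \<open>\<alpha>\<close> enters it only through \<open>cis (- \<theta> * \<alpha>)\<close>, so the
  quotient tends to \<open>cis (\<theta> * (1 - 1 / a))\<close>. For \<open>\<theta> = pi\<close> the two are complex conjugate and the quotient is
  one of cosines, with phase \<open>Theta k t - phi k\<close> and relative error \<open>O(sqrt t)\<close> from the saddle point.
  The contributions of \<open>\<theta> \<noteq> pi\<close> add up to a Dirichlet kernel.
\<close>

section \<open>The logarithm of the Euler product\<close>

text \<open>The angle pi / 4 makes the saddle point elementary: for
  \<open>x = r * cis (pi / 4)\<close> both \<open>- A / x\<close> and
  \<open>\<i> * \<theta> * x\<close> are negative multiples of the same number
  \<open>cis (- (pi / 4))\<close>. One fixed pair of rays therefore serves every frequency, and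
  after recentring the exponent is a real multiple of \<open>cosh v\<close> times that number. Its
  real and imaginary parts have equal size, so the same square root governs both the decay and the
  phase. The constant \<open>- phi k\<close> is \<open>(1 - k / 2) * pi / 4\<close>, from the power
  of \<open>x\<close> and the Jacobian of the ray, plus \<open>pi / 8\<close>, from the complex
  Gaussian. The obstacle is the division: every denominator must be bounded below by the exact
  exponential order of its numerator. Frequency 0 has no saddle and is settled by positivity;
  strictly between 0 and pi a single saddle decides; at pi two contributions of equal size
  interfere, their cosine can vanish, and this is the source of \<open>\<delta>\<close>. The same
  lower bounds exclude poles, since \<open>W\<close> is a quotient with its removable singularities
  repaired.\<close>

definition Ulog :: "complex \<Rightarrow> complex" where
  "Ulog x = (\<Sum>m. 1 / (of_nat (Suc m) * (exp (of_nat (Suc m) * x) - 1)))"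

lemma norm_exp_minus_one_ge: "norm (exp y - 1) \<ge> exp (Re y) - 1" for y :: complex
  using norm_triangle_ineq2[of "exp y" 1] by simp

lemma norm_exp_minus_one_ge_Re: "norm (exp y - 1) \<ge> Re y" for y :: complex
  using norm_exp_minus_one_ge[of y] exp_ge_add_one_self[of "Re y"] by linarith

lemma exp_minus_one_nonzero: "Re y > 0 \<Longrightarrow> exp y - 1 \<noteq> (0 :: complex)"
  using norm_exp_minus_one_ge_Re[of y] by auto

lemma norm_inverse_exp_minus_one_le: "Re y > 0 \<Longrightarrow> norm (1 / (exp y - 1)) \<le> 1 / Re y"
  for y :: complex
  using norm_exp_minus_one_ge_Re[of y]
  by (auto simp: norm_divide intro!: divide_left_mono mult_pos_pos simp: exp_minus_one_nonzero)

lemma exp_minus_one_ge_square: "r > 0 \<Longrightarrow> exp r - 1 \<ge> r\<^sup>2 / 2" for r :: real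
  using exp_lower_Taylor_quadratic[of r] by linarith

text \<open>With \<open>B = 1 / (exp y - 1)\<close> the quotient is \<open>B + B^2\<close>. The
  linear term is estimated through \<open>exp r - 1 >= r^2 / 2\<close>, so that both terms are of
  order \<open>1 / (Re y)^2\<close>; this makes the termwise derivatives at \<open>m * x\<close>
  summable in \<open>m\<close>.\<close>

lemma norm_exp_over_square_le:
  fixes y :: complex
  assumes "Re y > 0"
  shows "norm (exp y / (exp y - 1)\<^sup>2) \<le> 3 / (Re y)\<^sup>2"
proof -
  define B where "B = 1 / (exp y - 1)"
  have ne: "exp y - 1 \<noteq> 0" using assms by (rule exp_minus_one_nonzero)
  have "exp y / (exp y - 1)\<^sup>2 = ((exp y - 1) + 1) / (exp y - 1)\<^sup>2" by simp
  also have "\<dots> = B + B\<^sup>2"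
    unfolding B_def using ne by (simp only: add_divide_distrib power_one_over) (simp add: power2_eq_square)
  finally have "exp y / (exp y - 1)\<^sup>2 = B + B\<^sup>2" .
  moreover have "norm B \<le> 2 / (Re y)\<^sup>2"
  proof -
    have "norm (exp y - 1) \<ge> (Re y)\<^sup>2 / 2"
      using norm_exp_minus_one_ge[of y] exp_minus_one_ge_square[OF assms] by linarith
    then have "1 / norm (exp y - 1) \<le> 1 / ((Re y)\<^sup>2 / 2)"
      using assms ne by (intro divide_left_mono) auto
    then show ?thesis by (simp add: B_def norm_divide)
  qed
  moreover have "norm (B\<^sup>2) \<le> 1 / (Re y)\<^sup>2"
  proof -
    have "norm B \<le> 1 / Re y" unfolding B_def by (rule norm_inverse_exp_minus_one_le[OF assms])
    then have "(norm B)\<^sup>2 \<le> (1 / Re y)\<^sup>2" by (intro power_mono) auto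
    then show ?thesis by (simp add: norm_power power_divide)
  qed
  ultimately show ?thesis using norm_triangle_ineq[of B "B\<^sup>2"] by (simp add: add_divide_distrib)
qed

lemma summable_inverse_squares_Suc: "summable (\<lambda>m. 1 / (real (Suc m))\<^sup>2)"
  using inverse_squares_sums by (simp add: sums_iff)

lemma norm_Ulog_term_le:
  assumes "Re x > 0"
  shows "norm (1 / (of_nat (Suc m) * (exp (of_nat (Suc m) * x) - 1))) \<le> 1 / (real (Suc m))\<^sup>2 * (1 / Re x)"
proof -
  have "norm (1 / (exp (of_nat (Suc m) * x) - 1)) \<le> 1 / Re (of_nat (Suc m) * x)"
    by (rule norm_inverse_exp_minus_one_le) (use assms in simp)
  then have "norm (1 / (exp (of_nat (Suc m) * x) - 1)) / real (Suc m) \<le> 1 / Re (of_nat (Suc m) * x) / real (Suc m)"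
    by (intro divide_right_mono) auto
  moreover have "norm (1 / (of_nat (Suc m) * (exp (of_nat (Suc m) * x) - 1))) = norm (1 / (exp (of_nat (Suc m) * x) - 1)) / real (Suc m)"
    by (simp add: norm_divide norm_mult del: of_nat_Suc)
  moreover have "1 / Re (of_nat (Suc m) * x) / real (Suc m) = 1 / (real (Suc m))\<^sup>2 * (1 / Re x)"
    by (simp add: power2_eq_square del: of_nat_Suc)
  ultimately show ?thesis by metis
qed

lemma summable_Ulog:
  assumes "Re x > 0"
  shows "summable (\<lambda>m. norm (1 / (of_nat (Suc m) * (exp (of_nat (Suc m) * x) - 1))))"
  by (rule summable_comparison_test'[OF summable_mult2[OF summable_inverse_squares_Suc, of "1 / Re x"]])
     (use norm_Ulog_term_le[OF assms] in simp)

lemma norm_Ulog_le: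
  assumes "Re x > 0"
  shows "norm (Ulog x) \<le> pi\<^sup>2 / (6 * Re x)"
proof -
  have "norm (Ulog x) \<le> (\<Sum>m. norm (1 / (of_nat (Suc m) * (exp (of_nat (Suc m) * x) - 1))))"
    unfolding Ulog_def by (rule summable_norm[OF summable_Ulog[OF assms]])
  also have "\<dots> \<le> (\<Sum>m. 1 / (real (Suc m))\<^sup>2 * (1 / Re x))"
    by (rule suminf_le[OF norm_Ulog_term_le[OF assms] summable_Ulog[OF assms]])
       (rule summable_mult2[OF summable_inverse_squares_Suc])
  also have "\<dots> = pi\<^sup>2 / (6 * Re x)"
    using sums_mult2[OF inverse_squares_sums, of "1 / Re x"] by (simp add: sums_iff)
  finally show ?thesis .
qed

lemma cnj_suminf: "cnj (\<Sum>n. f n) = (\<Sum>n. cnj (f n))" if "summable f"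
  using that by (simp add: bounded_linear.suminf[OF bounded_linear_cnj])

lemma Ulog_cnj: "Re x > 0 \<Longrightarrow> Ulog (cnj x) = cnj (Ulog x)"
  unfolding Ulog_def using summable_norm_cancel[OF summable_Ulog[of x]]
  by (subst cnj_suminf) (auto simp: exp_cnj)

lemma has_field_derivative_Ulog:
  assumes "Re x > 0"
  shows "(Ulog has_field_derivative (\<Sum>m. - exp (of_nat (Suc m) * x) / (exp (of_nat (Suc m) * x) - 1)\<^sup>2)) (at x)"
    and "summable (\<lambda>m. norm (- exp (of_nat (Suc m) * x) / (exp (of_nat (Suc m) * x) - 1)\<^sup>2))"
proof -
  \<comment> \<open>Half of \<open>Re x\<close> leaves an open convex half-plane around
    \<open>x\<close> on which one multiple of the inverse squares majorises all termwise
    derivatives.\<close>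
  define \<rho> where "\<rho> = Re x / 2"
  have \<rho>: "\<rho> > 0" using assms by (simp add: \<rho>_def)
  define S where "S = {z. Re z > \<rho>}"
  have bd: "norm (- exp (of_nat (Suc m) * z) / (exp (of_nat (Suc m) * z) - 1)\<^sup>2) \<le> 1 / (real (Suc m))\<^sup>2 * (3 / \<rho>\<^sup>2)"
    if "z \<in> S" for m z
  proof -
    have z: "Re z > \<rho>" "Re (of_nat (Suc m) * z) > 0" using that \<rho> by (auto simp: S_def)
    have "norm (- exp (of_nat (Suc m) * z) / (exp (of_nat (Suc m) * z) - 1)\<^sup>2) \<le> 3 / (Re (of_nat (Suc m) * z))\<^sup>2"
      using norm_exp_over_square_le[OF z(2)] by (simp add: norm_divide del: of_nat_Suc)
    also have "\<dots> \<le> 3 / (real (Suc m) * \<rho>)\<^sup>2"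
      using z \<rho> by (intro divide_left_mono power_mono) (auto simp del: of_nat_Suc)
    also have "\<dots> = 1 / (real (Suc m))\<^sup>2 * (3 / \<rho>\<^sup>2)" by (simp add: power_mult_distrib)
    finally show ?thesis .
  qed
  have xS: "x \<in> S" "x \<in> interior S"
  proof -
    show "x \<in> S" using assms by (simp add: S_def \<rho>_def)
    moreover have "open S" unfolding S_def by (rule open_halfspace_Re_gt)
    ultimately show "x \<in> interior S" by (simp add: interior_open)
  qed
  show "(Ulog has_field_derivative (\<Sum>m. - exp (of_nat (Suc m) * x) / (exp (of_nat (Suc m) * x) - 1)\<^sup>2)) (at x)"
    unfolding Ulog_def
  proof (rule has_field_derivative_series'(2)[of S _ _ x])
    show "convex S" unfolding S_def by (rule convex_halfspace_Re_gt)
    show "uniformly_convergent_on S (\<lambda>n x. \<Sum>i<n. - exp (of_nat (Suc i) * x) / (exp (of_nat (Suc i) * x) - 1)\<^sup>2)"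
      by (rule Weierstrass_m_test'[OF bd summable_mult2[OF summable_inverse_squares_Suc]])
    fix n z assume "z \<in> S"
    then have "Re (of_nat (Suc n) * z) > 0" using \<rho> by (auto simp: S_def)
    then have "exp (of_nat (Suc n) * z) - 1 \<noteq> 0" by (rule exp_minus_one_nonzero)
    then show "((\<lambda>z. 1 / (of_nat (Suc n) * (exp (of_nat (Suc n) * z) - 1))) has_field_derivative
        - exp (of_nat (Suc n) * z) / (exp (of_nat (Suc n) * z) - 1)\<^sup>2) (at z within S)"
      by (auto intro!: derivative_eq_intros simp: power2_eq_square simp del: of_nat_Suc)
  qed (use xS summable_norm_cancel[OF summable_Ulog[OF assms]] in auto)
  show "summable (\<lambda>m. norm (- exp (of_nat (Suc m) * x) / (exp (of_nat (Suc m) * x) - 1)\<^sup>2))"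
    by (rule summable_comparison_test'[OF summable_mult2[OF summable_inverse_squares_Suc, of "3 / \<rho>\<^sup>2"]])
       (use bd[OF xS(1)] in simp)
qed

lemma holomorphic_Ulog: "Ulog holomorphic_on {x. Re x > 0}"
  using has_field_derivative_Ulog(1)
  by (auto simp: holomorphic_on_open[OF open_halfspace_Re_gt])

section \<open>The Euler product as the exponential of a Lambert series\<close>

lemma summable_on_geometric_product:
  assumes "0 \<le> r" "r < (1::real)"
  shows "(\<lambda>(n, m). r ^ n * r ^ m) summable_on ((UNIV :: nat set) \<times> (UNIV :: nat set))"
proof (rule summable_on_SigmaI)
  have g: "((\<lambda>m. r ^ m) has_sum (1 / (1 - r))) (UNIV :: nat set)"
    using assms by (intro norm_summable_imp_has_sum geometric_sums) (auto simp: summable_geometric)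
  show "((\<lambda>m. case (n, m) of (n, m) \<Rightarrow> r ^ n * r ^ m) has_sum (r ^ n * (1 / (1 - r)))) UNIV" for n
    using has_sum_cmult_right[OF g] by simp
  show "(\<lambda>n. r ^ n * (1 / (1 - r))) summable_on UNIV"
    using has_sum_cmult_left[OF g] by (rule has_sum_imp_summable)
qed (use assms in auto)

text \<open>Expand each \<open>- Ln (1 - q ^ n)\<close> in powers of \<open>q ^ n\<close> and
  interchange the summations: for fixed \<open>m\<close> the sum over \<open>n\<close> is geometric
  and produces the term \<open>1 / (m * (exp (m * x) - 1))\<close> of \<open>Ulog\<close>.\<close>

lemma Phi_exp_minus:
  assumes x: "Re x > 0"
  shows "Phi (exp (- x)) = exp (- Ulog x)"
proof -
  define q where "q = exp (- x)"
  define r where "r = norm q"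
  have r: "0 \<le> r" "r < 1" using x by (auto simp: r_def q_def)
  define f :: "nat \<Rightarrow> nat \<Rightarrow> complex" where "f = (\<lambda>n m. q ^ (Suc n * Suc m) / of_nat (Suc m))"
  have qn: "norm (q ^ Suc n) < 1" for n
    using r power_Suc_less_one[of r n] by (cases "r = 0") (auto simp: norm_power norm_mult r_def simp del: power_Suc)
  have fb: "norm (f n m) \<le> r ^ n * r ^ m" for n m
  proof -
    have "norm (f n m) \<le> r ^ (Suc n * Suc m)"
    proof -
      have "r ^ (Suc n * Suc m) / real (Suc m) \<le> r ^ (Suc n * Suc m) / 1"
        using r by (intro divide_left_mono) auto
      then show ?thesis by (simp add: f_def norm_divide norm_power r_def del: of_nat_Suc power_Suc mult_Suc)
    qed
    \<comment> \<open>\<open>(n + 1) * (m + 1)\<close> exceeds \<open>n + m\<close>, so a product of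
      two geometric series dominates the double series.\<close>
    also have "\<dots> \<le> r ^ (n + m)" using r by (intro power_decreasing) auto
    finally show ?thesis by (simp add: power_add)
  qed
  have fs: "(\<lambda>(n, m). f n m) summable_on (UNIV \<times> UNIV)"
  proof (rule abs_summable_summable, rule Infinite_Sum.abs_summable_on_comparison_test'[OF summable_on_geometric_product[OF r]])
    show "norm (case p of (n, m) \<Rightarrow> f n m) \<le> (case p of (n, m) \<Rightarrow> r ^ n * r ^ m)" for p
      using fb by (cases p) auto
  qed
  have s1: "(\<lambda>m. f n m) sums (- Ln (1 - q ^ Suc n))" for n
  proof -
    have "(\<lambda>m. - ((- (- (q ^ Suc n))) ^ m) / of_nat m) sums Ln (1 + (- (q ^ Suc n)))"
      by (rule Ln_series') (use qn in simp)
    then have "(\<lambda>m. - ((- (- (q ^ Suc n))) ^ Suc m) / of_nat (Suc m)) sums (Ln (1 + (- (q ^ Suc n))))"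
      by (subst sums_Suc_iff) simp
    then have "(\<lambda>m. - (- ((- (- (q ^ Suc n))) ^ Suc m) / of_nat (Suc m))) sums (- Ln (1 + (- (q ^ Suc n))))"
      by (rule sums_minus)
    moreover have "f n = (\<lambda>m. - (- ((- (- (q ^ Suc n))) ^ Suc m) / of_nat (Suc m)))"
      unfolding f_def by (rule ext) (simp only: power_mult minus_minus minus_divide_left)
    ultimately show ?thesis by simp
  qed
  have s2: "(\<lambda>n. f n m) sums (1 / (of_nat (Suc m) * (exp (of_nat (Suc m) * x) - 1)))" for m
  proof -
    have "(\<lambda>n. (q ^ Suc m) ^ n) sums (1 / (1 - q ^ Suc m))" by (rule geometric_sums[OF qn])
    then have "(\<lambda>n. q ^ Suc m / of_nat (Suc m) * (q ^ Suc m) ^ n) sums (q ^ Suc m / of_nat (Suc m) * (1 / (1 - q ^ Suc m)))"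
      by (rule sums_mult)
    moreover have "q ^ Suc m / of_nat (Suc m) * (q ^ Suc m) ^ n = f n m" for n
      by (simp add: f_def power_mult[symmetric] power_add[symmetric] algebra_simps)
    moreover have "q ^ Suc m = exp (- (of_nat (Suc m) * x))"
      by (simp add: q_def exp_of_nat_mult[symmetric] del: power_Suc of_nat_Suc)
    moreover have "exp (- (of_nat (Suc m) * x)) / of_nat (Suc m) * (1 / (1 - exp (- (of_nat (Suc m) * x)))) = 1 / (of_nat (Suc m) * (exp (of_nat (Suc m) * x) - 1))"
    proof -
      have "Re (of_nat (Suc m) * x) > 0" using x by simp
      then have "exp (of_nat (Suc m) * x) - 1 \<noteq> 0" by (rule exp_minus_one_nonzero)
      then show ?thesis by (simp add: exp_minus field_simps del: of_nat_Suc)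
    qed
    ultimately show ?thesis by simp
  qed
  have n1: "summable (\<lambda>m. norm (f n m))" for n
    by (rule summable_comparison_test'[where g = "\<lambda>m. r ^ n * r ^ m"])
       (use fb r in \<open>auto intro!: summable_mult summable_geometric\<close>)
  have n2: "summable (\<lambda>n. norm (f n m))" for m
    by (rule summable_comparison_test'[where g = "\<lambda>n. r ^ n * r ^ m"])
       (use fb r in \<open>auto intro!: summable_mult2 summable_geometric\<close>)
  have i1: "infsum (\<lambda>m. f n m) UNIV = - Ln (1 - q ^ Suc n)" for n
    using norm_summable_imp_has_sum[OF n1 s1] by (rule infsumI)
  have i2: "infsum (\<lambda>n. f n m) UNIV = 1 / (of_nat (Suc m) * (exp (of_nat (Suc m) * x) - 1))" for m
    using norm_summable_imp_has_sum[OF n2 s2] by (rule infsumI)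
  have sw: "infsum (\<lambda>n. - Ln (1 - q ^ Suc n)) UNIV = infsum (\<lambda>m. 1 / (of_nat (Suc m) * (exp (of_nat (Suc m) * x) - 1))) UNIV"
    using infsum_swap_banach[OF fs] unfolding i1 i2 .
  have "(\<lambda>n. infsum (f n) UNIV) summable_on UNIV"
    using summable_on_Sigma_banach[OF fs] by simp
  then have "((\<lambda>n. - Ln (1 - q ^ Suc n)) has_sum infsum (\<lambda>n. - Ln (1 - q ^ Suc n)) UNIV) UNIV"
    unfolding i1 by (rule has_sum_infsum)
  then have L: "(\<lambda>n. - Ln (1 - q ^ Suc n)) sums infsum (\<lambda>n. - Ln (1 - q ^ Suc n)) UNIV"
    by (rule has_sum_imp_sums)
  have R: "infsum (\<lambda>m. 1 / (of_nat (Suc m) * (exp (of_nat (Suc m) * x) - 1))) UNIV = Ulog x"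
    unfolding Ulog_def
    by (rule infsumI[OF norm_summable_imp_has_sum[OF summable_Ulog[OF x] summable_sums[OF summable_norm_cancel[OF summable_Ulog[OF x]]]]])
  have "(\<lambda>n. Ln (1 - q ^ Suc n)) sums (- Ulog x)"
    using sums_minus[OF L[unfolded sw R]] by (simp del: power_Suc)
  \<comment> \<open>Only \<open>exp (Ln w) = w\<close> for the single factors enters here; no branch
    of the logarithm of the whole product is chosen.\<close>
  then have "prodinf (\<lambda>n. exp (Ln (1 - q ^ Suc n))) = exp (- Ulog x)"
    by (simp add: prodinf_exp sums_iff)
  moreover have "exp (Ln (1 - q ^ Suc n)) = 1 - q ^ Suc n" for n
  proof (rule exp_Ln)
    show "1 - q ^ Suc n \<noteq> 0" using qn[of n] by auto
  qed
  ultimately show ?thesis by (simp add: Phi_def q_def)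
qed

section \<open>Regularisation of the Bose kernel\<close>

text \<open>The value at \<open>0\<close> is the removable one; it is the source of the factor \<open>x powr (- 1 / 2)\<close> in the expansion of \<open>Phi (exp (- x))\<close>.\<close>

definition bose_reg :: "complex \<Rightarrow> complex" where
  "bose_reg y = (if y = 0 then - 1 / 2 else 1 / (exp y - 1) - 1 / y)"

text \<open>The nonzero solutions of \<open>exp y = 1\<close> have modulus at least
  \<open>2 * pi\<close>; the radius 3 is a convenient value below that.\<close>

lemma exp_neq_one_ball: "y \<in> ball 0 3 \<Longrightarrow> y \<noteq> 0 \<Longrightarrow> exp y \<noteq> (1 :: complex)"
proof
  assume y: "y \<in> ball 0 3" "y \<noteq> 0" "exp y = 1"
  then obtain n :: int where n: "Re y = 0" "Im y = of_int (2 * n) * pi"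
    by (auto simp: exp_eq_1)
  have "n \<noteq> 0" using n y by (auto simp: complex_eq_iff)
  then have "\<bar>real_of_int n\<bar> \<ge> 1" by linarith
  then have "\<bar>Im y\<bar> \<ge> 2 * pi" using n by (simp add: abs_mult)
  moreover have "\<bar>Im y\<bar> \<le> norm y" by (rule abs_Im_le_cmod)
  ultimately show False using y pi_gt3 by auto
qed

text \<open>In \<open>2 * y * (exp y - 1) * (bose_reg y + 1 / 2)\<close> the linear and quadratic
  parts cancel, the latter precisely because of the \<open>1 / 2\<close>. A cubic remainder over a
  factor of order \<open>norm y ^ 2\<close> tends to 0.\<close>

lemma bose_reg_tendsto_0: "(bose_reg \<longlongrightarrow> bose_reg 0) (at 0)"
proof -
  have bd: "norm (bose_reg y + 1 / 2) \<le> 10 * norm y" if y: "y \<noteq> 0" "norm y < 1 / 4" for y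
  proof -
    define R where "R = exp y - 1 - y - y\<^sup>2 / 2"
    have "norm (exp y - (\<Sum>i\<le>2. y ^ i / fact i)) \<le> exp \<bar>Re y\<bar> * norm y ^ Suc 2 / fact 2"
      by (rule Taylor_exp)
    moreover have "(\<Sum>i\<le>2. y ^ i / fact i) = 1 + y + y\<^sup>2 / 2"
      by (simp add: numeral_2_eq_2)
    moreover have "exp \<bar>Re y\<bar> \<le> 3"
    proof -
      have "exp \<bar>Re y\<bar> \<le> exp 1" using abs_Re_le_cmod[of y] y by simp
      then show ?thesis using e_less_272 by linarith
    qed
    ultimately have R: "norm R \<le> 3 / 2 * norm y ^ 3"
      using mult_right_mono[of "exp \<bar>Re y\<bar>" 3 "norm y ^ 3"]
      by (simp add: R_def algebra_simps numeral_2_eq_2 numeral_3_eq_3)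
    have e: "exp y - 1 = y + y\<^sup>2 / 2 + R" by (simp add: R_def)
    have n2: "norm (y\<^sup>2) = (norm y)\<^sup>2" by (simp add: norm_power)
    have y2: "(norm y)\<^sup>2 \<le> norm y / 4" using y by (simp add: power2_eq_square)
    have y3: "norm y ^ 3 \<le> norm y / 16"
    proof -
      have "norm y ^ 3 = norm y * (norm y)\<^sup>2" by (simp add: power2_eq_square power3_eq_cube)
      also have "\<dots> \<le> norm y * (1/4)\<^sup>2" using y by (intro mult_left_mono power_mono) auto
      finally show ?thesis by (simp add: power2_eq_square)
    qed
    have "norm y \<le> norm (exp y - 1) + norm (y\<^sup>2 / 2 + R)"
      using norm_triangle_ineq4[of "exp y - 1" "y\<^sup>2 / 2 + R"] by (simp add: e)
    moreover have "norm (y\<^sup>2 / 2 + R) \<le> norm y / 4"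
    proof -
      have "norm (y\<^sup>2 / 2) = (norm y)\<^sup>2 / 2" by (simp add: norm_divide n2)
      then show ?thesis
        using norm_triangle_ineq[of "y\<^sup>2 / 2" R] R y2 y3 norm_ge_zero[of y] by linarith
    qed
    ultimately have low: "norm (exp y - 1) \<ge> norm y / 2" using norm_ge_zero[of y] by linarith
    then have ne: "exp y - 1 \<noteq> 0" using y by auto
    have "2 * y * (exp y - 1) * (bose_reg y + 1 / 2) = 2 * y - 2 * (exp y - 1) + y * (exp y - 1)"
      using y ne by (simp add: bose_reg_def field_simps)
    also have "\<dots> = y ^ 3 / 2 + y * R - 2 * R" unfolding e by (simp add: power2_eq_square power3_eq_cube field_simps)
    finally have "norm (2 * y * (exp y - 1) * (bose_reg y + 1 / 2)) \<le> norm (y ^ 3 / 2) + norm (y * R) + norm (2 * R)"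
      by (metis add_mono_thms_linordered_semiring(3) norm_triangle_ineq norm_triangle_ineq4 order_trans)
    also have "\<dots> \<le> norm y ^ 3 / 2 + 3 / 8 * norm y ^ 3 + 3 * norm y ^ 3"
    proof -
      have "norm (y * R) \<le> 1 / 4 * (3 / 2 * norm y ^ 3)"
        unfolding norm_mult using y R by (intro mult_mono) auto
      then show ?thesis using R by (simp add: norm_divide norm_power norm_mult)
    qed
    also have "\<dots> \<le> 10 * norm y ^ 3" by simp
    finally have "2 * norm y * norm (exp y - 1) * norm (bose_reg y + 1 / 2) \<le> 10 * norm y ^ 3"
      by (simp add: norm_mult)
    moreover have "2 * norm y * (norm y / 2) * norm (bose_reg y + 1 / 2) \<le> 2 * norm y * norm (exp y - 1) * norm (bose_reg y + 1 / 2)"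
      using low by (intro mult_right_mono mult_left_mono) auto
    ultimately have "(norm y)\<^sup>2 * norm (bose_reg y + 1 / 2) \<le> (norm y)\<^sup>2 * (10 * norm y)"
      by (simp add: power2_eq_square power3_eq_cube)
    then show ?thesis using y by simp
  qed
  have "((\<lambda>y. bose_reg y + 1 / 2) \<longlongrightarrow> 0) (at 0)"
  proof (rule Lim_null_comparison)
    show "eventually (\<lambda>y. norm (bose_reg y + 1 / 2) \<le> 10 * norm y) (at 0)"
      using bd by (auto simp: eventually_at dist_norm intro!: exI[of _ "1/4"])
    show "((\<lambda>y::complex. 10 * norm y) \<longlongrightarrow> 0) (at 0)"
      by (auto intro!: tendsto_eq_intros)
  qed
  then have "((\<lambda>y. (bose_reg y + 1 / 2) - 1 / 2) \<longlongrightarrow> 0 - 1 / 2) (at 0)"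
    by (intro tendsto_intros)
  then have "(bose_reg \<longlongrightarrow> - 1 / 2) (at 0)" by simp
  moreover have "bose_reg 0 = - 1 / 2" by (simp add: bose_reg_def)
  ultimately show ?thesis by simp
qed

text \<open>The disc makes the tip 0 of the sector an interior point, so that derivatives are
  available along segments that start at 0.\<close>

definition bose_reg_dom :: "complex set" where "bose_reg_dom = {y. Re y > 0} \<union> ball 0 3"

lemma open_bose_reg_dom: "open bose_reg_dom"
  unfolding bose_reg_dom_def by (intro open_Un open_halfspace_Re_gt open_ball)

lemma holomorphic_bose_reg: "bose_reg holomorphic_on bose_reg_dom"
proof (rule no_isolated_singularity'[OF _ _ open_bose_reg_dom])
  show "finite {0 :: complex}" by simp
  show "(bose_reg \<longlongrightarrow> bose_reg z) (at z within bose_reg_dom)" if "z \<in> {0}" for z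
    using bose_reg_tendsto_0 that by (auto intro: tendsto_within_subset)
  have "exp y - 1 \<noteq> 0" if "y \<in> bose_reg_dom - {0}" for y
    using that exp_minus_one_nonzero[of y] exp_neq_one_ball[of y] by (auto simp: bose_reg_dom_def)
  then have "(\<lambda>y. 1 / (exp y - 1) - 1 / y) holomorphic_on bose_reg_dom - {0}"
    by (intro holomorphic_intros) auto
  then show "bose_reg holomorphic_on bose_reg_dom - {0}"
    by (rule holomorphic_transform) (auto simp: bose_reg_def)
qed

lemma norm_bose_reg_le: "Re y > 0 \<Longrightarrow> norm (bose_reg y) \<le> 2 / Re y"
proof -
  assume y: "Re y > 0"
  have "norm (bose_reg y) \<le> norm (1 / (exp y - 1)) + norm (1 / y)"
    using y by (auto simp: bose_reg_def norm_triangle_ineq4)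
  moreover have "norm (1 / y) \<le> 1 / Re y"
    unfolding norm_divide using y complex_Re_le_cmod[of y]
    by (auto intro!: divide_left_mono mult_pos_pos)
  ultimately show ?thesis using norm_inverse_exp_minus_one_le[OF y] by simp
qed

text \<open>Cauchy's estimate on the disc of radius \<open>Re y / 2\<close>, where real parts stay
  above \<open>Re y / 2\<close>: each derivative gains a power of \<open>1 / Re y\<close>.\<close>

lemma norm_deriv_bose_reg_le:
  assumes y: "Re y > 0" and n: "n > 0"
  shows "norm ((deriv ^^ n) bose_reg y) \<le> fact n * (4 / Re y) / (Re y / 2) ^ n"
proof (rule Cauchy_higher_deriv_bound[of bose_reg y "Re y / 2" 0 "4 / Re y"])
  have sub: "Re w \<ge> Re y / 2" if "norm (y - w) \<le> Re y / 2" for w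
    using that abs_Re_le_cmod[of "y - w"] by simp
  have "cball y (Re y / 2) \<subseteq> bose_reg_dom"
    using sub y by (force simp: bose_reg_dom_def dist_norm)
  then show "continuous_on (cball y (Re y / 2)) bose_reg"
    using holomorphic_bose_reg by (meson holomorphic_on_imp_continuous_on holomorphic_on_subset)
  show "bose_reg holomorphic_on ball y (Re y / 2)"
    using holomorphic_bose_reg \<open>cball y (Re y / 2) \<subseteq> bose_reg_dom\<close> by (meson ball_subset_cball holomorphic_on_subset)
  fix w assume w: "w \<in> ball y (Re y / 2)"
  then have "norm (y - w) < Re y / 2" by (simp add: dist_norm)
  then have r: "Re w > Re y / 2"
    using abs_Re_le_cmod[of "y - w"] by simp
  then have "norm (bose_reg w) \<le> 2 / Re w" using y by (intro norm_bose_reg_le) simp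
  also have "\<dots> < 2 / (Re y / 2)" using r y by (intro divide_strict_left_mono) auto
  finally show "bose_reg w \<in> ball 0 (4 / Re y)" by (simp add: dist_norm)
qed (use y n in auto)

text \<open>Between the rays of argument \<open>- pi / 4\<close> and \<open>pi / 4\<close>, tip
  included, \<open>Re y\<close> and \<open>norm y\<close> are comparable, so half-plane estimates
  become radial ones. The bounding rays are the later paths of integration.\<close>

definition sector :: "complex set" where "sector = {y. \<bar>Im y\<bar> \<le> Re y}"

lemma convex_sector: "convex sector"
proof -
  have "sector = {y. Im y - Re y \<le> 0} \<inter> {y. - Im y - Re y \<le> 0}"
    by (auto simp: sector_def)
  moreover have "convex {y. Im y - Re y \<le> 0}" "convex {y. - Im y - Re y \<le> 0}"
    using convex_halfspace_le[of "Complex (-1) 1" 0] convex_halfspace_le[of "Complex (-1) (-1)" 0]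
    by (simp_all add: inner_complex_def algebra_simps)
  ultimately show ?thesis by (metis convex_Int)
qed

lemma sector_norm_le: "y \<in> sector \<Longrightarrow> norm y \<le> 2 * Re y"
  using cmod_le[of y] by (auto simp: sector_def)

lemma sector_Re_pos: "y \<in> sector \<Longrightarrow> y \<noteq> 0 \<Longrightarrow> Re y > 0"
  by (auto simp: sector_def complex_eq_iff)

lemma sector_subset_bose_reg_dom: "sector \<subseteq> bose_reg_dom"
  by (auto simp: bose_reg_dom_def intro!: sector_Re_pos)

lemma scaleR_sector: "y \<in> sector \<Longrightarrow> r \<ge> 0 \<Longrightarrow> of_real r * y \<in> sector"
  by (auto simp: sector_def abs_mult mult_left_mono)

text \<open>Compactness handles the neighbourhood of the tip. Further out Cauchy's estimate even
  gives cubic decay, of which a quadratic part suffices for summation.\<close>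

lemma deriv2_bose_reg_bound:
  "\<exists>C>0. \<forall>y\<in>sector. norm (deriv (deriv bose_reg) y) \<le> C / (1 + norm y)\<^sup>2"
proof -
  have hol: "deriv (deriv bose_reg) holomorphic_on bose_reg_dom"
    by (intro holomorphic_deriv open_bose_reg_dom holomorphic_bose_reg)
  have "continuous_on (cball 0 2) (deriv (deriv bose_reg))"
    by (rule holomorphic_on_imp_continuous_on[OF holomorphic_on_subset[OF hol]]) (auto simp: bose_reg_dom_def)
  then have "compact (deriv (deriv bose_reg) ` cball 0 2)" by (intro compact_continuous_image compact_cball)
  then obtain C0 where C0: "\<And>y. norm y \<le> 2 \<Longrightarrow> norm (deriv (deriv bose_reg) y) \<le> C0"
    using compact_imp_bounded bounded_iff by (metis imageI mem_cball_0)
  \<comment> \<open>9 is \<open>(1 + norm y)^2\<close> at \<open>norm y = 2\<close>; 600 exceeds the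
    576 that comes out of the Cauchy estimate.\<close>
  define C where "C = 9 * \<bar>C0\<bar> + 600"
  show ?thesis
  proof (intro exI[of _ C] conjI ballI)
    show "C > 0" by (simp add: C_def)
    fix y assume y: "y \<in> sector"
    show "norm (deriv (deriv bose_reg) y) \<le> C / (1 + norm y)\<^sup>2"
    proof (cases "norm y \<le> 2")
      case True
      have "(1 + norm y)\<^sup>2 \<le> 3\<^sup>2" using True by (intro power_mono) auto
      have "norm (deriv (deriv bose_reg) y) * (1 + norm y)\<^sup>2 \<le> \<bar>C0\<bar> * 9"
        using C0[OF True] \<open>(1 + norm y)\<^sup>2 \<le> 3\<^sup>2\<close> by (intro mult_mono) auto
      then show ?thesis
        by (subst pos_le_divide_eq) (auto simp: C_def add_pos_nonneg power2_eq_square)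
    next
      case False
      then have re: "Re y \<ge> norm y / 2" "Re y > 0" using sector_norm_le[OF y] by auto
      have "norm (deriv (deriv bose_reg) y) \<le> fact 2 * (4 / Re y) / (Re y / 2) ^ 2"
        using norm_deriv_bose_reg_le[OF re(2), of 2] by (simp add: numeral_2_eq_2)
      also have "\<dots> = 32 / (Re y) ^ 3" by (simp add: power2_eq_square power3_eq_cube)
      also have "\<dots> \<le> 32 / (norm y / 2) ^ 3"
        using re False by (intro frac_le power_mono zero_less_power) auto
      also have "\<dots> = 256 / norm y ^ 3" by (simp add: power_divide)
      finally have 1: "norm (deriv (deriv bose_reg) y) \<le> 256 / norm y ^ 3" .
      have "(1 + norm y)\<^sup>2 \<le> (3 / 2 * norm y)\<^sup>2" using False by (intro power_mono) auto
      also have "\<dots> = 9 / 4 * (norm y)\<^sup>2" by (simp add: power_mult_distrib power2_eq_square)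
      finally have 2: "(1 + norm y)\<^sup>2 \<le> 9 / 4 * (norm y)\<^sup>2" .
      have "norm (deriv (deriv bose_reg) y) * (1 + norm y)\<^sup>2 \<le> 256 / norm y ^ 3 * (9 / 4 * (norm y)\<^sup>2)"
        using 1 2 by (intro mult_mono) auto
      also have "\<dots> = 576 / norm y" using False by (simp add: power2_eq_square power3_eq_cube field_simps)
      also have "\<dots> \<le> 576" using False by (simp add: divide_le_eq)
      finally show ?thesis
        by (subst pos_le_divide_eq) (use False in \<open>auto simp: C_def add_pos_nonneg\<close>)
    qed
  qed
qed

text \<open>The terms are dominated by a telescoping series, the discrete form of comparison with
  the integral of \<open>1 / (1 + u * r)^2\<close>. Growth no worse than \<open>1 / r\<close> is the
  point: the sum gets multiplied by \<open>r^2\<close> and divided by \<open>r\<close>.\<close>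

lemma sum_inverse_square_le:
  assumes "r > (0::real)"
  shows "summable (\<lambda>m. 1 / (1 + real m * r)\<^sup>2)" "(\<Sum>m. 1 / (1 + real m * r)\<^sup>2) \<le> 1 + 1 / r"
proof -
  have *: "(\<Sum>m<Suc n. 1 / (1 + real m * r)\<^sup>2) \<le> 1 + 1 / r - 1 / (r * (1 + real n * r))" for n
  proof (induction n)
    case (Suc n)
    have p: "1 + real n * r > 0" "1 + real (Suc n) * r > 0" using assms by (auto intro: add_pos_nonneg)
    have "1 / (1 + real (Suc n) * r)\<^sup>2 \<le> 1 / ((1 + real n * r) * (1 + real (Suc n) * r))"
    proof -
      have e: "1 / p'\<^sup>2 \<le> 1 / (p * p')" if "0 < p" "p \<le> p'" for p p' :: real
        unfolding power2_eq_square using that by (intro frac_le mult_right_mono mult_pos_pos) auto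
      show ?thesis by (rule e) (use p assms in \<open>auto simp: algebra_simps\<close>)
    qed
    also have "\<dots> = 1 / (r * (1 + real n * r)) - 1 / (r * (1 + real (Suc n) * r))"
    proof -
      have e: "1 / (p * p') = 1 / (r * p) - 1 / (r * p')" if "p > 0" "p' > 0" "p' = p + r" for p p'
      proof -
        have "1 / (r * p) - 1 / (r * p') = (p' - p) / (r * p * p')"
          using that(1,2) assms by (simp add: divide_simps)
        then show ?thesis using that assms by simp
      qed
      show ?thesis by (rule e) (use p in \<open>auto simp: algebra_simps\<close>)
    qed
    finally show ?case using Suc by simp
  qed (use assms in simp)
  have bd: "(\<Sum>m<n. 1 / (1 + real m * r)\<^sup>2) \<le> 1 + 1 / r" for n
  proof (cases n)
    case (Suc m)
    have "1 / (r * (1 + real m * r)) \<ge> 0" using assms by simp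
    then show ?thesis unfolding Suc using *[of m] by linarith
  qed (use assms in simp)
  show s: "summable (\<lambda>m. 1 / (1 + real m * r)\<^sup>2)"
    by (rule summableI_nonneg_bounded[OF _ bd]) auto
  show "(\<Sum>m. 1 / (1 + real m * r)\<^sup>2) \<le> 1 + 1 / r"
    by (rule suminf_le_const[OF s bd])
qed

lemma has_field_derivative_bose_reg:
  "y \<in> bose_reg_dom \<Longrightarrow> (bose_reg has_field_derivative deriv bose_reg y) (at y)"
  "y \<in> bose_reg_dom \<Longrightarrow> (deriv bose_reg has_field_derivative deriv (deriv bose_reg) y) (at y)"
  using holomorphic_derivI[OF holomorphic_bose_reg open_bose_reg_dom]
    holomorphic_derivI[OF holomorphic_deriv[OF holomorphic_bose_reg open_bose_reg_dom] open_bose_reg_dom] by auto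

text \<open>The sum of \<open>x * deriv bose_reg (m * x)\<close> is compared with the telescoping sum of \<open>bose_reg (m * x) - bose_reg ((m - 1) * x)\<close>, which equals \<open>- bose_reg 0 = 1 / 2\<close>.\<close>

lemma sum_deriv_bose_reg_approx:
  "\<exists>C>0. \<forall>x\<in>sector - {0}. summable (\<lambda>m. deriv bose_reg (of_nat (Suc m) * x)) \<and>
     norm ((\<Sum>m. deriv bose_reg (of_nat (Suc m) * x)) - 1 / (2 * x)) \<le> C * (1 + norm x)"
proof -
  obtain C where "C > 0" "\<forall>y\<in>sector. norm (deriv (deriv bose_reg) y) \<le> C / (1 + norm y)\<^sup>2"
    using deriv2_bose_reg_bound by blast
  then have C: "C > 0" "\<And>y. y \<in> sector \<Longrightarrow> norm (deriv (deriv bose_reg) y) \<le> C / (1 + norm y)\<^sup>2"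
    by blast+
  have main: "summable (\<lambda>m. deriv bose_reg (of_nat (Suc m) * x)) \<and>
     norm ((\<Sum>m. deriv bose_reg (of_nat (Suc m) * x)) - 1 / (2 * x)) \<le> C * (1 + norm x)" if x: "x \<in> sector - {0}" for x
  proof -
    have nx: "norm x > 0" and rx: "Re x > 0" using x sector_Re_pos by auto
    have step: "norm (bose_reg (of_nat m * x) - bose_reg (of_nat (Suc m) * x) + x * deriv bose_reg (of_nat (Suc m) * x)) \<le> C * (norm x)\<^sup>2 * (1 / (1 + real m * norm x)\<^sup>2)" for m
    proof -
      define S where "S = closed_segment (of_nat m * x) (of_nat (Suc m) * x)"
      define f where "f = (\<lambda>i::nat. if i = 0 then bose_reg else if i = 1 then deriv bose_reg else deriv (deriv bose_reg))"
      have S: "\<exists>r \<ge> real m. u = of_real r * x" if u: "u \<in> S" for u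
      proof -
        obtain v where v: "0 \<le> v" "v \<le> 1" "u = (1 - v) *\<^sub>R (of_nat m * x) + v *\<^sub>R (of_nat (Suc m) * x)"
          using u by (auto simp: S_def in_segment)
        then have "u = of_real (real m + v) * x" by (simp add: scaleR_conv_of_real algebra_simps)
        then show ?thesis using v by (intro exI[of _ "real m + v"]) auto
      qed
      have Sc: "S \<subseteq> sector" using S x scaleR_sector
        by (metis DiffD1 of_nat_0_le_iff order_trans subsetI)
      \<comment> \<open>The Taylor expansion is taken about the right end of the segment, because
        that is where the sum samples \<open>deriv bose_reg\<close>.\<close>
      have "norm (f 0 (of_nat m * x) - (\<Sum>i\<le>1. f i (of_nat (Suc m) * x) * (of_nat m * x - of_nat (Suc m) * x) ^ i / fact i))
         \<le> C / (1 + real m * norm x)\<^sup>2 * norm (of_nat m * x - of_nat (Suc m) * x) ^ Suc 1 / fact 1"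
      proof (rule complex_Taylor[of S])
        show "convex S" by (simp add: S_def)
        show "(f i has_field_derivative f (Suc i) z) (at z within S)" if "z \<in> S" "i \<le> 1" for i z
          using that has_field_derivative_bose_reg[of z] Sc sector_subset_bose_reg_dom
          by (auto simp: f_def le_Suc_eq intro: has_field_derivative_at_within)
        show "norm (f (Suc 1) z) \<le> C / (1 + real m * norm x)\<^sup>2" if z: "z \<in> S" for z
        proof -
          obtain r where r: "r \<ge> real m" "z = of_real r * x" using S[OF z] by auto
          have "norm (f (Suc 1) z) \<le> C / (1 + norm z)\<^sup>2" using C(2)[of z] z Sc by (auto simp: f_def)
          also have "\<dots> \<le> C / (1 + real m * norm x)\<^sup>2"
          proof -
            have "r \<ge> 0" using r(1) by (meson of_nat_0_le_iff order_trans)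
            then have "norm z = r * norm x" using r(2) by (simp add: norm_mult)
            moreover have "0 < 1 + real m * norm x" by (intro add_pos_nonneg) auto
            moreover have "real m * norm x \<le> r * norm x" using r(1) by (intro mult_right_mono) auto
            ultimately show ?thesis
              using C(1) by (intro frac_le power_mono zero_less_power) auto
          qed
          finally show ?thesis .
        qed
      qed (auto simp: S_def)
      then show ?thesis
        by (simp add: f_def algebra_simps power2_eq_square)
    qed
    note si = sum_inverse_square_le[OF nx]
    have sE: "summable (\<lambda>m. norm (bose_reg (of_nat m * x) - bose_reg (of_nat (Suc m) * x) + x * deriv bose_reg (of_nat (Suc m) * x)))"
      by (rule summable_comparison_test'[OF summable_mult[OF si(1), of "C * (norm x)\<^sup>2"]])
         (use step in simp)
    have lim: "(\<lambda>m. bose_reg (of_nat m * x)) \<longlonglongrightarrow> 0"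
    proof (rule Lim_null_comparison)
      show "eventually (\<lambda>m. norm (bose_reg (of_nat m * x)) \<le> (2 / Re x) * (1 / real m)) sequentially"
        using eventually_gt_at_top[of 0]
      proof eventually_elim
        case (elim m)
        then have "Re (of_nat m * x) > 0" using rx by simp
        then show ?case using norm_bose_reg_le[of "of_nat m * x"] by (simp add: mult.commute)
      qed
      show "(\<lambda>m. 2 / Re x * (1 / real m)) \<longlonglongrightarrow> 0"
        by (intro tendsto_mult_right_zero lim_1_over_n)
    qed
    have tel: "(\<lambda>m. bose_reg (of_nat m * x) - bose_reg (of_nat (Suc m) * x)) sums (bose_reg (of_nat 0 * x) - 0)"
      by (rule telescope_sums'[OF lim])
    have sD: "summable (\<lambda>m. x * deriv bose_reg (of_nat (Suc m) * x))"
      using summable_diff[OF summable_norm_cancel[OF sE] sums_summable[OF tel]] by simp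
    then have sD': "summable (\<lambda>m. deriv bose_reg (of_nat (Suc m) * x))"
      using x by (auto simp: summable_cmult_iff simp del: of_nat_Suc)
    have "(\<Sum>m. bose_reg (of_nat m * x) - bose_reg (of_nat (Suc m) * x) + x * deriv bose_reg (of_nat (Suc m) * x)) = - 1 / 2 + x * (\<Sum>m. deriv bose_reg (of_nat (Suc m) * x))"
      using suminf_add[OF sums_summable[OF tel] sD] sums_unique[OF tel] suminf_mult[OF sD', of x]
      by (simp add: bose_reg_def del: of_nat_Suc)
    then have "norm (- 1 / 2 + x * (\<Sum>m. deriv bose_reg (of_nat (Suc m) * x))) \<le> (\<Sum>m. norm (bose_reg (of_nat m * x) - bose_reg (of_nat (Suc m) * x) + x * deriv bose_reg (of_nat (Suc m) * x)))"
      using summable_norm[OF sE] by simp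
    also have "\<dots> \<le> (\<Sum>m. C * (norm x)\<^sup>2 * (1 / (1 + real m * norm x)\<^sup>2))"
      by (rule suminf_le[OF step sE summable_mult[OF si(1)]])
    also have "\<dots> = C * (norm x)\<^sup>2 * (\<Sum>m. 1 / (1 + real m * norm x)\<^sup>2)"
      by (rule suminf_mult[OF si(1)])
    also have "\<dots> \<le> C * (norm x)\<^sup>2 * (1 + 1 / norm x)"
      using si(2) C by (intro mult_left_mono) auto
    also have "\<dots> = norm x * (C * (1 + norm x))" using nx by (simp add: power2_eq_square field_simps)
    finally have "norm (- 1 / 2 + x * (\<Sum>m. deriv bose_reg (of_nat (Suc m) * x))) \<le> norm x * (C * (1 + norm x))" .
    moreover have "- 1 / 2 + x * (\<Sum>m. deriv bose_reg (of_nat (Suc m) * x)) = x * ((\<Sum>m. deriv bose_reg (of_nat (Suc m) * x)) - 1 / (2 * x))"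
      using x by (simp add: right_diff_distrib)
    ultimately have "norm x * norm ((\<Sum>m. deriv bose_reg (of_nat (Suc m) * x)) - 1 / (2 * x)) \<le> norm x * (C * (1 + norm x))"
      by (simp add: norm_mult)
    then show ?thesis using sD' nx by (simp only: mult_le_cancel_left_pos)
  qed
  show ?thesis using main C(1) by blast
qed

section \<open>Behaviour of the Euler product at the tip of a sector\<close>

text \<open>The pole stems from the part \<open>1 / y\<close> of the Bose kernel, summed with
  weights \<open>1 / m^2\<close>; the logarithm stems from the value \<open>- 1 / 2\<close> of
  \<open>bose_reg\<close> at 0.\<close>

definition Ulog_rem :: "complex \<Rightarrow> complex" where
  "Ulog_rem x = Ulog x - of_real (pi\<^sup>2 / 6) / x - Ln x / 2"

text \<open>Differentiation cancels the weight \<open>1 / m\<close> in \<open>Ulog\<close> and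
  leaves the derivative of the Bose kernel at \<open>m * x\<close>. Its part
  \<open>- 1 / y^2\<close> sums to the derivative of the pole; what is left is the sum of
  \<open>deriv bose_reg\<close>, already compared with \<open>1 / (2 * x)\<close>.\<close>

lemma deriv_Ulog_rem_bound:
  "\<exists>C>0. \<forall>x\<in>sector - {0}. norm x \<le> 1 \<longrightarrow> (\<exists>D. (Ulog_rem has_field_derivative D) (at x) \<and> norm D \<le> C)"
proof -
  obtain C where C0: "C > 0"
    "\<forall>x\<in>sector - {0}. summable (\<lambda>m. deriv bose_reg (of_nat (Suc m) * x)) \<and>
     norm ((\<Sum>m. deriv bose_reg (of_nat (Suc m) * x)) - 1 / (2 * x)) \<le> C * (1 + norm x)"
    using sum_deriv_bose_reg_approx by blast
  then have C: "C > 0"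
    "\<And>x. x \<in> sector - {0} \<Longrightarrow> summable (\<lambda>m. deriv bose_reg (of_nat (Suc m) * x))"
    "\<And>x. x \<in> sector - {0} \<Longrightarrow> norm ((\<Sum>m. deriv bose_reg (of_nat (Suc m) * x)) - 1 / (2 * x)) \<le> C * (1 + norm x)"
    by blast+
  show ?thesis
  proof (intro exI[of _ "2 * C"] conjI ballI impI)
    show "2 * C > 0" using C by simp
    fix x assume x: "x \<in> sector - {0}" "norm x \<le> 1"
    have rx: "Re x > 0" "x \<noteq> 0" using x sector_Re_pos by auto
    have dh: "deriv bose_reg y = - exp y / (exp y - 1)\<^sup>2 + 1 / y\<^sup>2" if y: "Re y > 0" for y
    proof (rule DERIV_imp_deriv)
      have "((\<lambda>y. 1 / (exp y - 1) - 1 / y) has_field_derivative - exp y / (exp y - 1)\<^sup>2 + 1 / y\<^sup>2) (at y)"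
        using exp_minus_one_nonzero[OF y] y
        by (auto intro!: derivative_eq_intros simp: power2_eq_square)
      then show "(bose_reg has_field_derivative - exp y / (exp y - 1)\<^sup>2 + 1 / y\<^sup>2) (at y)"
        by (rule has_field_derivative_transform_within_open[OF _ open_halfspace_Re_gt[of 0]])
           (use y in \<open>auto simp: bose_reg_def\<close>)
    qed
    have t: "- exp (of_nat (Suc m) * x) / (exp (of_nat (Suc m) * x) - 1)\<^sup>2 =
        deriv bose_reg (of_nat (Suc m) * x) - of_real (1 / (real (Suc m))\<^sup>2) * (1 / x\<^sup>2)" for m
    proof -
      have "Re (of_nat (Suc m) * x) > 0" using rx by simp
      note dh[OF this]
      moreover have "1 / (of_nat (Suc m) * x)\<^sup>2 = of_real (1 / (real (Suc m))\<^sup>2) * (1 / x\<^sup>2)"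
        by (simp add: power_mult_distrib del: of_nat_Suc)
      ultimately show ?thesis by simp
    qed
    have "(\<lambda>m. of_real (1 / (real (Suc m))\<^sup>2) * (1 / x\<^sup>2)) sums (of_real (pi\<^sup>2 / 6) * (1 / x\<^sup>2))"
      using inverse_squares_sums by (intro sums_mult2 sums_of_real) simp
    then have "(\<lambda>m. - exp (of_nat (Suc m) * x) / (exp (of_nat (Suc m) * x) - 1)\<^sup>2) sums
        ((\<Sum>m. deriv bose_reg (of_nat (Suc m) * x)) - of_real (pi\<^sup>2 / 6) * (1 / x\<^sup>2))"
      unfolding t by (intro sums_diff summable_sums C(2) x)
    then have "(\<Sum>m. - exp (of_nat (Suc m) * x) / (exp (of_nat (Suc m) * x) - 1)\<^sup>2) =
        (\<Sum>m. deriv bose_reg (of_nat (Suc m) * x)) - of_real (pi\<^sup>2 / 6) * (1 / x\<^sup>2)"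
      by (rule sums_unique[symmetric])
    then have dU: "(Ulog has_field_derivative (\<Sum>m. deriv bose_reg (of_nat (Suc m) * x)) - of_real (pi\<^sup>2 / 6) * (1 / x\<^sup>2)) (at x)"
      using has_field_derivative_Ulog(1)[OF rx(1)] by simp
    have "(Ulog_rem has_field_derivative (\<Sum>m. deriv bose_reg (of_nat (Suc m) * x)) - 1 / (2 * x)) (at x)"
    proof -
      have dL: "(Ln has_field_derivative inverse x) (at x)"
        using rx by (intro has_field_derivative_Ln) (auto simp: complex_nonpos_Reals_iff)
      have dx: "((\<lambda>x. of_real (pi\<^sup>2 / 6) / x) has_field_derivative - (of_real (pi\<^sup>2 / 6) * (1 / x\<^sup>2))) (at x)"
        using rx by (auto intro!: derivative_eq_intros simp: power2_eq_square)
      have "((\<lambda>x. Ulog x - of_real (pi\<^sup>2 / 6) / x - Ln x / 2) has_field_derivative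
          ((\<Sum>m. deriv bose_reg (of_nat (Suc m) * x)) - of_real (pi\<^sup>2 / 6) * (1 / x\<^sup>2))
            - (- (of_real (pi\<^sup>2 / 6) * (1 / x\<^sup>2))) - inverse x / 2) (at x)"
        by (intro DERIV_diff dU dx DERIV_cdivide dL)
      moreover have "Ulog_rem = (\<lambda>x. Ulog x - of_real (pi\<^sup>2 / 6) / x - Ln x / 2)"
        by (rule ext) (rule Ulog_rem_def)
      ultimately show ?thesis by (simp add: inverse_eq_divide mult.commute)
    qed
    moreover have "norm ((\<Sum>m. deriv bose_reg (of_nat (Suc m) * x)) - 1 / (2 * x)) \<le> 2 * C"
    proof -
      have "C * (1 + norm x) \<le> C * 2" using x C by (intro mult_left_mono) auto
      then show ?thesis using C(3)[OF x(1)] by linarith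
    qed
    ultimately show "\<exists>D. (Ulog_rem has_field_derivative D) (at x) \<and> norm D \<le> 2 * C" by blast
  qed
qed

text \<open>A bounded derivative forces a limit at the tip of the sector. That the limit is real, as seen along the positive axis, is what fixes the phase of the main term later on.\<close>

lemma Ulog_rem_asymp:
  "\<exists>(m0 :: real) C. C > 0 \<and> (\<forall>x\<in>sector - {0}. norm x \<le> 1 \<longrightarrow> norm (Ulog_rem x - of_real m0) \<le> C * norm x)"
proof -
  obtain C where C: "C > 0"
    "\<forall>x\<in>sector - {0}. norm x \<le> 1 \<longrightarrow> (\<exists>D. (Ulog_rem has_field_derivative D) (at x) \<and> norm D \<le> C)"
    using deriv_Ulog_rem_bound by blast
  define S where "S = sector \<inter> {x. Re x > 0} \<inter> cball 0 1"
  have S: "x \<in> S \<longleftrightarrow> x \<in> sector - {0} \<and> norm x \<le> 1" for x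
    using sector_Re_pos by (auto simp: S_def)
  have "convex S" unfolding S_def by (intro convex_Int convex_sector convex_halfspace_Re_gt convex_cball)
  obtain D where D: "\<And>x. x \<in> S \<Longrightarrow> (Ulog_rem has_field_derivative D x) (at x) \<and> norm (D x) \<le> C"
    using C(2) S by metis
  have lip: "norm (Ulog_rem x - Ulog_rem y) \<le> C * norm (x - y)" if "x \<in> S" "y \<in> S" for x y
    by (rule field_differentiable_bound[OF \<open>convex S\<close> _ _ that, of Ulog_rem D C])
       (use D in \<open>auto intro: has_field_derivative_at_within\<close>)
  define X where "X n = (of_real (inverse (real (Suc n))) :: complex)" for n
  have XS: "X n \<in> S" for n
  proof -
    have "inverse (real (Suc n)) \<le> 1" by (simp add: inverse_le_1_iff)
    then show ?thesis by (auto simp: S X_def sector_def norm_inverse simp del: of_real_inverse)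
  qed
  have X0: "X \<longlonglongrightarrow> 0"
    unfolding X_def using tendsto_of_real[OF LIMSEQ_inverse_real_of_nat, where 'a = complex] by simp
  \<comment> \<open>The tip is not in \<open>S\<close>; the Lipschitz bound still forces values
    along a sequence tending to it to be Cauchy.\<close>
  have "C-lipschitz_on S Ulog_rem"
    using lip C by (intro lipschitz_onI) (auto simp: dist_norm)
  then have "Cauchy (\<lambda>n. Ulog_rem (X n))"
    using uniformly_continuous_on_Cauchy[OF lipschitz_on_uniformly_continuous LIMSEQ_imp_Cauchy[OF X0]] XS by blast
  then obtain L where L: "(\<lambda>n. Ulog_rem (X n)) \<longlonglongrightarrow> L"
    using convergentD[OF Cauchy_convergent] by metis
  have "Ulog_rem (X n) \<in> \<real>" for n
  proof -
    have p: "inverse (real (Suc n)) > 0" by simp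
    have "Ulog (X n) = cnj (Ulog (X n))"
      using Ulog_cnj[of "X n"] p by (simp add: X_def)
    then have "Ulog (X n) \<in> \<real>" by (metis Reals_cnj_iff)
    moreover have "Ln (X n) \<in> \<real>" unfolding X_def using p by (subst Ln_of_real) auto
    moreover have "X n \<in> \<real>" by (simp add: X_def)
    ultimately show ?thesis unfolding Ulog_rem_def by (intro Reals_diff Reals_divide) auto
  qed
  then have "L \<in> \<real>" using closed_sequentially[OF closed_complex_Reals _ L] by simp
  then obtain m0 where m0: "L = of_real m0" by (auto elim: Reals_cases)
  show ?thesis
  proof (rule exI[of _ m0], rule exI[of _ C], intro conjI ballI impI)
    show "C > 0" by fact
    fix x assume "x \<in> sector - {0}" "norm x \<le> 1"
    then have x: "x \<in> S" using S by blast
    show "norm (Ulog_rem x - of_real m0) \<le> C * norm x"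
    proof (rule LIMSEQ_le)
      show "(\<lambda>n. norm (Ulog_rem x - Ulog_rem (X n))) \<longlonglongrightarrow> norm (Ulog_rem x - of_real m0)"
        using L m0 by (intro tendsto_intros) auto
      have "(\<lambda>n. C * norm (x - X n)) \<longlonglongrightarrow> C * norm (x - 0)"
        using X0 by (intro tendsto_intros)
      then show "(\<lambda>n. C * norm (x - X n)) \<longlonglongrightarrow> C * norm x" by simp
      show "\<exists>N. \<forall>n\<ge>N. norm (Ulog_rem x - Ulog_rem (X n)) \<le> C * norm (x - X n)"
        using lip[OF x XS] by blast
    qed
  qed
qed

section \<open>The summand and its model at the tip\<close>

definition Fk :: "nat \<Rightarrow> complex \<Rightarrow> complex" where
  "Fk k x = exp (- x) * Phi (exp (- x)) ^ k"

text \<open>The model \<open>x powr (- k / 2) * exp (- A / x)\<close>, written as one exponential: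
  its norm is read off a real part, and an oscillating factor is merged by adding exponents.\<close>

definition Gk :: "nat \<Rightarrow> complex \<Rightarrow> complex" where
  "Gk k x = exp (- (of_nat k / 2 * Ln x) - of_real (real k * pi\<^sup>2 / 6) / x)"

lemma Fk_eq: "Re x > 0 \<Longrightarrow> Fk k x = exp (- x - of_nat k * Ulog x)"
  using exp_of_nat_mult[of k "- Ulog x"] exp_add[of "- x" "- (of_nat k * Ulog x)"]
  by (simp add: Fk_def Phi_exp_minus)

lemma holomorphic_Fk: "Fk k holomorphic_on {x. Re x > 0}"
proof -
  have "(\<lambda>x. exp (- x - of_nat k * Ulog x)) holomorphic_on {x. Re x > 0}"
    by (intro holomorphic_intros holomorphic_Ulog)
  then show ?thesis by (rule holomorphic_transform) (simp add: Fk_eq)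
qed

lemma norm_Fk_le: "Re x > 0 \<Longrightarrow> norm (Fk k x) \<le> exp (- Re x + real k * (pi\<^sup>2 / (6 * Re x)))"
proof -
  assume x: "Re x > 0"
  have "- Re (of_nat k * Ulog x) \<le> norm (of_nat k * Ulog x)" using abs_Re_le_cmod[of "of_nat k * Ulog x"] by linarith
  also have "\<dots> \<le> real k * (pi\<^sup>2 / (6 * Re x))" using mult_left_mono[OF norm_Ulog_le[OF x], of "real k"] by (simp add: norm_mult)
  finally show ?thesis using x by (simp add: Fk_eq)
qed

lemma Fk_cnj: "Re x > 0 \<Longrightarrow> Fk k (cnj x) = cnj (Fk k x)"
  by (simp add: Fk_eq Ulog_cnj exp_cnj)

lemma Fk_real_pos: "t > 0 \<Longrightarrow> \<exists>r>0. Fk k (of_real t) = of_real r"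
proof -
  assume t: "t > 0"
  have "Ulog (of_real t) = cnj (Ulog (of_real t))" using Ulog_cnj[of "of_real t"] t by simp
  then have "Ulog (of_real t) \<in> \<real>" by (metis Reals_cnj_iff)
  then obtain u where "Ulog (of_real t) = of_real u" by (auto elim: Reals_cases)
  then have "Fk k (of_real t) = of_real (exp (- t - real k * u))" using t by (simp add: Fk_eq exp_of_real[symmetric])
  then show ?thesis by (intro exI[of _ "exp (- t - real k * u)"]) auto
qed

lemma norm_exp_minus_one_le: "norm (exp w - 1) \<le> exp (norm w) * norm w" for w :: complex
proof -
  have "norm (exp w - 1) \<le> exp \<bar>Re w\<bar> * norm w"
    using Taylor_exp[of w 0] by simp
  also have "\<dots> \<le> exp (norm w) * norm w"
    using abs_Re_le_cmod[of w] by (intro mult_right_mono) auto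
  finally show ?thesis .
qed

text \<open>The expansion at the tip gives a relative error of order \<open>norm x\<close>. Far out
  \<open>Fk\<close> stays bounded while \<open>Gk\<close> may decay like \<open>norm x\<close> to
  the power \<open>- k / 2\<close>; the factor \<open>(1 + norm x) ^ k\<close> compensates, so that
  one inequality holds along the whole ray and no integral has to be split.\<close>

lemma Fk_asymp:
  "\<exists>\<kappa>>0. \<exists>C>0. \<forall>x\<in>sector - {0}.
     norm (Fk k x - of_real \<kappa> * Gk k x) \<le> C * norm x * (1 + norm x) ^ k * norm (Gk k x)"
proof -
  obtain m0 C where "C > 0" "\<forall>x\<in>sector - {0}. norm x \<le> 1 \<longrightarrow> norm (Ulog_rem x - of_real m0) \<le> C * norm x"
    using Ulog_rem_asymp by blast
  then have C: "C > 0"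
    "\<And>x. x \<in> sector - {0} \<Longrightarrow> norm x \<le> 1 \<Longrightarrow> norm (Ulog_rem x - of_real m0) \<le> C * norm x"
    by blast+
  \<comment> \<open>Positive because \<open>m0\<close> is real: the constant affects the amplitude
    of the main term and not its phase.\<close>
  define \<kappa> where "\<kappa> = exp (- real k * m0)"
  define A where "A = real k * pi\<^sup>2 / 6"
  define w where "w x = - x - of_nat k * (Ulog_rem x - of_real m0)" for x
  have A: "A \<ge> 0" by (simp add: A_def)
  have eq: "Fk k x = of_real \<kappa> * Gk k x * exp (w x)" if "Re x > 0" for x
  proof -
    have U: "Ulog x = Ulog_rem x + of_real (pi\<^sup>2 / 6) / x + Ln x / 2" by (simp add: Ulog_rem_def)
    show ?thesis
      unfolding Fk_eq[OF that] U Gk_def \<kappa>_def w_def exp_of_real[symmetric] exp_add[symmetric]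
      by (rule arg_cong[of _ _ exp]) (use that in \<open>auto simp: field_simps\<close>)
  qed
  define c1 where "c1 = 1 + real k * C"
  \<comment> \<open>For \<open>norm x > 1\<close> one has \<open>Re x > 1 / 2\<close>, whence
    \<open>norm (Fk k x) <= exp (2 * A)\<close>; the further \<open>A\<close> is the loss in the
    lower bound for \<open>Gk\<close>, and the 1 pays for the subtracted 1.\<close>
  define C2 where "C2 = 1 + exp (2 * A + A) / \<kappa>"
  define C3 where "C3 = \<kappa> * (c1 * exp c1 + C2)"
  have pos: "\<kappa> > 0" "c1 > 0" "C2 > 0"
    using C(1) by (auto simp: \<kappa>_def c1_def C2_def intro!: add_pos_nonneg)
  then have "C3 > 0" unfolding C3_def by (intro mult_pos_pos add_pos_pos) auto
  note pos = pos this
  have small: "norm (exp (w x) - 1) \<le> c1 * exp c1 * norm x" if x: "x \<in> sector - {0}" "norm x \<le> 1" for x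
  proof -
    have "norm (w x) \<le> norm x + norm (of_nat k * (Ulog_rem x - of_real m0))"
      unfolding w_def by (metis norm_minus_cancel norm_triangle_ineq4)
    also have "\<dots> \<le> norm x + real k * (C * norm x)"
      using C(2)[OF x] by (simp add: norm_mult mult_left_mono)
    finally have 1: "norm (w x) \<le> c1 * norm x" by (simp add: c1_def algebra_simps)
    also have "\<dots> \<le> c1 * 1" using pos x by (intro mult_left_mono) auto
    finally have 2: "norm (w x) \<le> c1" by simp
    have "norm (exp (w x) - 1) \<le> exp (norm (w x)) * norm (w x)" by (rule norm_exp_minus_one_le)
    also have "\<dots> \<le> exp c1 * (c1 * norm x)" using 1 2 pos by (intro mult_mono) auto
    finally show ?thesis by (simp add: mult_ac)
  qed
  have large: "norm (exp (w x) - 1) \<le> C2 * (1 + norm x) ^ k" if x: "x \<in> sector - {0}" "norm x > 1" for x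
  proof -
    have rx: "Re x > 0" "norm x \<le> 2 * Re x" using x sector_Re_pos sector_norm_le by auto
    have G: "norm (Gk k x) \<ge> exp (- (real k / 2 * ln (norm x)) - A)"
    proof -
      have "Re (of_real A / x) \<le> norm (of_real A / x)" by (rule complex_Re_le_cmod)
      also have "\<dots> \<le> A" using x A by (simp add: norm_divide divide_le_eq mult_le_cancel_left1)
      finally have "Re (of_real A / x) \<le> A" .
      moreover have "Re (of_nat k / 2 * Ln x) = real k / 2 * ln (norm x)"
        using x by simp
      moreover have "Re (- (of_nat k / 2 * Ln x) - of_real A / x) = - Re (of_nat k / 2 * Ln x) - Re (of_real A / x)"
        by (simp only: minus_complex.sel uminus_complex.sel)
      ultimately show ?thesis unfolding Gk_def norm_exp_eq_Re A_def[symmetric] exp_le_cancel_iff by linarith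
    qed
    have F: "norm (Fk k x) \<le> exp (2 * A)"
    proof -
      have "- Re x + real k * (pi\<^sup>2 / (6 * Re x)) \<le> A / Re x" using rx by (simp add: A_def)
      also have "\<dots> \<le> A / (1/2)" using rx x A by (intro divide_left_mono) auto
      finally have "- Re x + real k * (pi\<^sup>2 / (6 * Re x)) \<le> 2 * A" by simp
      then show ?thesis using norm_Fk_le[OF rx(1), of k] by (meson exp_le_cancel_iff order_trans)
    qed
    have "\<kappa> * exp (- (real k / 2 * ln (norm x)) - A) * norm (exp (w x)) \<le> \<kappa> * norm (Gk k x) * norm (exp (w x))"
      using G pos by (intro mult_right_mono mult_left_mono) auto
    also have "\<dots> = norm (Fk k x)" using eq[OF rx(1)] pos by (simp add: norm_mult)
    finally have "\<kappa> * exp (- (real k / 2 * ln (norm x)) - A) * norm (exp (w x)) \<le> exp (2 * A)" using F by linarith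
    then have "norm (exp (w x)) \<le> exp (2 * A) / (\<kappa> * exp (- (real k / 2 * ln (norm x)) - A))"
      using pos by (subst pos_le_divide_eq) (auto simp: mult_ac)
    also have "\<dots> = exp (2 * A + A) / \<kappa> * exp (real k / 2 * ln (norm x))"
    proof -
      have "exp a / (\<kappa> * exp (- r - A)) = exp (a + A) / \<kappa> * exp r" for r a
        using pos(1) by (simp add: exp_diff exp_add exp_minus divide_simps)
      then show ?thesis .
    qed
    also have "\<dots> \<le> exp (2 * A + A) / \<kappa> * (1 + norm x) ^ k"
    proof -
      have "exp (real k / 2 * ln (norm x)) \<le> exp (real k * ln (norm x))"
        using x by (auto intro!: mult_right_mono)
      also have "\<dots> = norm x ^ k" using x by (simp add: exp_of_nat_mult)
      also have "\<dots> \<le> (1 + norm x) ^ k" by (intro power_mono) auto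
      finally show ?thesis using pos by (intro mult_left_mono) auto
    qed
    finally have "norm (exp (w x)) \<le> exp (2 * A + A) / \<kappa> * (1 + norm x) ^ k" .
    moreover have "1 \<le> (1 + norm x) ^ k" by (intro one_le_power) auto
    moreover have "norm (exp (w x) - 1) \<le> norm (exp (w x)) + 1" using norm_triangle_ineq4[of "exp (w x)" 1] by simp
    ultimately show ?thesis unfolding C2_def distrib_right by linarith
  qed
  have all: "norm (exp (w x) - 1) \<le> (c1 * exp c1 + C2) * (norm x * (1 + norm x) ^ k)" if x: "x \<in> sector - {0}" for x
  proof (cases "norm x \<le> 1")
    case True
    have "1 \<le> (1 + norm x) ^ k" by (intro one_le_power) auto
    then have "norm x * 1 \<le> norm x * (1 + norm x) ^ k" by (intro mult_left_mono) auto
    then have "c1 * exp c1 * norm x \<le> c1 * exp c1 * (norm x * (1 + norm x) ^ k)"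
      using pos by (intro mult_left_mono) auto
    moreover have "0 \<le> C2 * (norm x * (1 + norm x) ^ k)" using pos by simp
    ultimately show ?thesis using small[OF x True] by (simp add: distrib_right)
  next
    case False
    have "1 * (1 + norm x) ^ k \<le> norm x * (1 + norm x) ^ k" using False by (intro mult_right_mono) auto
    then have "C2 * (1 + norm x) ^ k \<le> C2 * (norm x * (1 + norm x) ^ k)" using pos by (intro mult_left_mono) auto
    moreover have "0 \<le> c1 * exp c1 * (norm x * (1 + norm x) ^ k)" using pos by simp
    ultimately show ?thesis using large[OF x] False by (simp add: distrib_right)
  qed
  show ?thesis
  proof (rule exI[of _ \<kappa>], rule conjI[OF pos(1)], rule exI[of _ C3], rule conjI[OF pos(4)], rule ballI)
    fix x assume x: "x \<in> sector - {0}"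
    then have rx: "Re x > 0" using sector_Re_pos by auto
    have "norm (Fk k x - of_real \<kappa> * Gk k x) = \<kappa> * norm (Gk k x) * norm (exp (w x) - 1)"
      using pos unfolding eq[OF rx] by (simp add: norm_mult[symmetric] algebra_simps) (simp add: norm_mult flip: right_diff_distrib)
    also have "\<dots> \<le> \<kappa> * norm (Gk k x) * ((c1 * exp c1 + C2) * (norm x * (1 + norm x) ^ k))"
      using pos all[OF x] by (intro mult_left_mono) auto
    also have "\<dots> = C3 * norm x * (1 + norm x) ^ k * norm (Gk k x)" by (simp add: C3_def mult_ac)
    finally show "norm (Fk k x - of_real \<kappa> * Gk k x) \<le> C3 * norm x * (1 + norm x) ^ k * norm (Gk k x)" .
  qed
qed

section \<open>The Abel-Plana formula\<close>

lemma contour_integral_linepath_same_Im: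
  assumes "a < b"
  shows "contour_integral (linepath (Complex a c) (Complex b c)) f = integral {a..b} (\<lambda>x. f (Complex x c))"
proof -
  have "contour_integral (linepath (Complex a c) (Complex b c)) f =
         (Complex b c - Complex a c) * integral {0..1} (\<lambda>x. f (linepath (Complex a c) (Complex b c) x))"
    by (simp add: contour_integral_integral)
  also have "Complex b c - Complex a c = of_real (b - a)"
    by (simp add: complex_eq_iff)
  also have "integral {0..1} (\<lambda>x. f (linepath (Complex a c) (Complex b c) x)) =
             integral {0..1} (\<lambda>x. f (Complex (linepath a b x) c))"
    by (intro arg_cong2[of _ _ _ _ integral] ext arg_cong[of _ _ f])
       (auto simp: linepath_def complex_eq_iff algebra_simps)
  also have "\<dots> = integral {0..(b - a) / (b - a)} (\<lambda>x. f (Complex (a + (b - a) * x) c))"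
    using \<open>a < b\<close> by (simp add: algebra_simps linepath_def)
  also have "{0..(b - a) / (b - a)} = (\<lambda>x. x / (b - a)) ` {0..b - a}"
    using \<open>a < b\<close> by simp
  also have "integral \<dots> (\<lambda>x. f (Complex (a + (b - a) * x) c)) =
             integral {a-a..b-a} (\<lambda>x. f (Complex (x + a) c)) / of_real (b - a)"
    using \<open>a < b\<close> by (subst integral_stretch_real) (auto simp: scaleR_conv_of_real add_ac)
  also have "\<dots> = integral {a..b} (\<lambda>x. f (Complex x c)) / of_real (b - a)"
    by (subst integral_shift_real_ivl) (rule refl)
  finally show ?thesis
    using \<open>a < b\<close> by simp
qed

lemma inverse_one_minus_exp_le: "y > 0 \<Longrightarrow> 1 / (1 - exp (- y)) \<le> 1 + 1 / y" for y :: real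
proof -
  assume y: "y > 0"
  have "exp (- y) \<le> 1 / (1 + y)"
    using exp_ge_add_one_self[of y] y by (simp add: exp_minus inverse_eq_divide frac_le)
  then have "1 - exp (- y) \<ge> y / (1 + y)" using y by (simp add: field_simps)
  then have "1 / (1 - exp (- y)) \<le> 1 / (y / (1 + y))" using y by (intro frac_le) auto
  then show ?thesis using y by (simp add: add_divide_distrib)
qed

section \<open>The summation kernel and lower bounds for its denominator\<close>

definition e2pi :: "complex \<Rightarrow> complex" where "e2pi \<zeta> = exp (2 * of_real pi * \<i> * \<zeta>)"

lemma norm_e2pi: "norm (e2pi \<zeta>) = exp (- (2 * pi * Im \<zeta>))"
  by (simp add: e2pi_def norm_exp_eq_Re)

lemma norm_one_minus_e2pi_ge: "norm (1 - e2pi \<zeta>) \<ge> 1 - exp (- (2 * pi * Im \<zeta>))"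
  using norm_triangle_ineq2[of 1 "e2pi \<zeta>"] by (simp add: norm_e2pi)

lemma e2pi_add: "e2pi (a + b) = e2pi a * e2pi b"
  by (simp add: e2pi_def exp_add algebra_simps)

lemma e2pi_minus: "e2pi (- a) = 1 / e2pi a"
  by (simp add: e2pi_def exp_minus inverse_eq_divide)

lemma e2pi_nonzero [simp]: "e2pi a \<noteq> 0"
  by (simp add: e2pi_def)

lemma e2pi_cnj: "e2pi (- cnj \<zeta>) = cnj (e2pi \<zeta>)"
  by (simp add: e2pi_def exp_cnj)

text \<open>The Abel-Plana kernel: its poles are simple, at the integers \<open>n\<close>, with
  residue \<open>exp (\<i> * \<theta> * n) / (2 * pi * \<i>)\<close>.\<close>

definition kern :: "real \<Rightarrow> complex \<Rightarrow> complex" where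
  "kern \<theta> \<zeta> = exp (\<i> * of_real \<theta> * \<zeta>) / (e2pi \<zeta> - 1)"

text \<open>The defining form suits the upper half-plane, this one the lower. The frequency
  \<open>\<theta> - 2 * pi\<close> that appears is the origin of the complementary frequency
  \<open>2 * pi - \<theta>\<close>.\<close>

lemma kern_alt: "kern \<theta> \<zeta> = exp (\<i> * of_real (\<theta> - 2 * pi) * \<zeta>) / (1 - e2pi (- \<zeta>))"
proof -
  have e: "exp (\<i> * of_real \<theta> * \<zeta>) = exp (\<i> * of_real (\<theta> - 2 * pi) * \<zeta>) * e2pi \<zeta>"
    by (simp add: e2pi_def mult_exp_exp algebra_simps)
  have d: "e2pi \<zeta> - 1 = (1 - e2pi (- \<zeta>)) * e2pi \<zeta>" by (simp add: e2pi_minus algebra_simps)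
  show ?thesis unfolding kern_def e d by simp
qed

text \<open>In either half-plane one of the two forms of the kernel has an exponential factor of
  norm at most 1. Reflection then leaves only denominators with nonnegative imaginary part to be
  studied.\<close>

lemma norm_kern_le:
  assumes "0 \<le> \<theta>" "\<theta> \<le> 2 * pi"
  shows "norm (kern \<theta> \<zeta>) \<le> 1 / norm (1 - e2pi (Complex (Re \<zeta>) \<bar>Im \<zeta>\<bar>))"
proof (cases "Im \<zeta> \<ge> 0")
  case True
  then have c: "Complex (Re \<zeta>) \<bar>Im \<zeta>\<bar> = \<zeta>" by (simp add: complex_eq_iff)
  have "norm (exp (\<i> * of_real \<theta> * \<zeta>)) \<le> 1" using True assms by (simp add: norm_exp_eq_Re)
  then show ?thesis unfolding c kern_def norm_divide norm_minus_commute[of "e2pi \<zeta>"]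
    by (intro divide_right_mono) auto
next
  case False
  then have c: "Complex (Re \<zeta>) \<bar>Im \<zeta>\<bar> = cnj \<zeta>" by (simp add: complex_eq_iff)
  have "norm (exp (\<i> * of_real (\<theta> - 2 * pi) * \<zeta>)) = exp ((2 * pi - \<theta>) * Im \<zeta>)"
    by (simp add: norm_exp_eq_Re algebra_simps)
  also have "\<dots> \<le> 1" using False assms by (simp add: mult_nonneg_nonpos)
  finally have "norm (exp (\<i> * of_real (\<theta> - 2 * pi) * \<zeta>)) \<le> 1" .
  moreover have "norm (1 - e2pi (cnj \<zeta>)) = norm (1 - e2pi (- \<zeta>))"
    using e2pi_cnj[of "- \<zeta>"] complex_mod_cnj[of "1 - e2pi (- \<zeta>)"] by simp
  ultimately show ?thesis unfolding c kern_alt norm_divide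
    by (simp add: divide_right_mono)
qed

text \<open>The radius lies halfway between the poles \<open>N + \<alpha>\<close> and
  \<open>N + 1 + \<alpha>\<close>. Either \<open>Im x\<close> is at least 1 / 4 and
  \<open>e2pi\<close> is small, or \<open>Re x\<close> is within 1 / 16 of the radius; then the half
  turns into a phase near pi, and \<open>e2pi\<close> has nonpositive real part.\<close>

lemma norm_one_minus_e2pi_right:
  fixes N :: nat and \<alpha> :: real
  assumes "N \<ge> 1" "0 < \<alpha>" and x: "norm x = real N + \<alpha> + 1 / 2" "Re x \<ge> 0" "Im x \<ge> 0"
  shows "norm (1 - e2pi (x - of_real \<alpha>)) \<ge> 1 / 2"
proof (cases "Im x \<ge> 1 / 4")
  case True
  have "2 * pi * Im x \<ge> 2 * pi * (1 / 4)" using True pi_gt_zero by (intro mult_left_mono) auto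
  then have y: "2 * pi * Im x \<ge> 1" using pi_gt3 by linarith
  have "exp (- (2 * pi * Im x)) \<le> exp (- 1)" using y by simp
  also have "\<dots> \<le> 1 / (2::real)" using exp_ge_add_one_self[of 1] by (simp add: exp_minus inverse_eq_divide divide_le_eq)
  finally show ?thesis using norm_one_minus_e2pi_ge[of "x - of_real \<alpha>"] by simp
next
  case False
  define R where "R = real N + \<alpha> + 1 / 2"
  have R: "R \<ge> 1" using assms by (simp add: R_def)
  have sq: "(Re x)\<^sup>2 + (Im x)\<^sup>2 = R\<^sup>2" using x(1) by (simp add: R_def cmod_power2[symmetric])
  have im: "(Im x)\<^sup>2 \<le> 1 / 16" using False x power_mono[of "Im x" "1/4" 2] by (simp add: power2_eq_square)
  have reR: "Re x \<le> R" using x(1) complex_Re_le_cmod[of x] by (simp add: R_def)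
  have "R - Re x \<le> 1 / 16"
  proof -
    have "(R - Re x) * 1 \<le> (R - Re x) * (R + Re x)" using reR R x by (intro mult_left_mono) auto
    also have "\<dots> = (Im x)\<^sup>2" using sq by (simp add: power2_eq_square algebra_simps)
    finally show ?thesis using im by simp
  qed
  then obtain \<eta> where \<eta>: "Re x = R - \<eta>" "0 \<le> \<eta>" "\<eta> \<le> 1 / 16" using reR by (metis add.commute diff_add_cancel diff_ge_0_iff_ge le_diff_eq diff_diff_eq2 add_diff_cancel_right')
  have "Re (e2pi (x - of_real \<alpha>)) = exp (- (2 * pi * Im x)) * cos (2 * pi * (Re x - \<alpha>))"
    by (simp add: e2pi_def Re_exp)
  also have "2 * pi * (Re x - \<alpha>) = (pi - 2 * pi * \<eta>) + 2 * pi * real N"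
    by (simp add: \<eta> R_def algebra_simps)
  also have "cos \<dots> = - cos (2 * pi * \<eta>)"
  proof -
    have "cos (2 * pi * real N) = 1" "sin (2 * pi * real N) = 0"
      using cos_2npi[of N] sin_2npi[of N] by (simp_all add: mult_ac)
    then show ?thesis by (simp add: cos_add cos_diff sin_diff)
  qed
  finally have re: "Re (e2pi (x - of_real \<alpha>)) = - (exp (- (2 * pi * Im x)) * cos (2 * pi * \<eta>))" by simp
  have "2 * pi * \<eta> \<le> 2 * pi * (1 / 16)" using \<eta> by (intro mult_left_mono) auto
  moreover have "0 \<le> 2 * pi * \<eta>" using \<eta> by simp
  ultimately have "cos (2 * pi * \<eta>) \<ge> 0" using pi_gt_zero by (intro cos_ge_zero) linarith+
  then have "Re (1 - e2pi (x - of_real \<alpha>)) \<ge> 1" using re by simp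
  then show ?thesis using complex_Re_le_cmod[of "1 - e2pi (x - of_real \<alpha>)"] by linarith
qed

text \<open>For \<open>\<alpha> < 1\<close> the denominator is nonzero at the tip. For
  \<open>\<alpha> = 1\<close> it has a simple zero there, which dictates a bound that vanishes
  linearly; the quadratic decay of \<open>G\<close> makes up for it.\<close>

lemma norm_one_minus_e2pi_left:
  assumes "0 < \<alpha>" "\<alpha> \<le> (1::real)"
  shows "\<exists>\<epsilon>0>0. \<forall>x. norm x \<le> \<epsilon>0 \<longrightarrow> norm (1 - e2pi (x - of_real \<alpha>)) \<ge> norm x"
proof -
  have ecx: "norm (e2pi x - 1) \<le> 3 * (2 * pi * norm x)" if "norm x \<le> 1 / (2 * pi)" for x
  proof -
    have n: "norm (2 * of_real pi * \<i> * x) = 2 * pi * norm x" by (simp add: norm_mult)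
    then have "exp (norm (2 * of_real pi * \<i> * x)) \<le> exp 1" using that by (simp add: field_simps)
    then have "exp (norm (2 * of_real pi * \<i> * x)) \<le> 3" using e_less_272 by linarith
    then have "exp (norm (2 * of_real pi * \<i> * x)) * norm (2 * of_real pi * \<i> * x) \<le> 3 * norm (2 * of_real pi * \<i> * x)"
      by (intro mult_right_mono) auto
    then show ?thesis using norm_exp_minus_one_le[of "2 * of_real pi * \<i> * x"] unfolding e2pi_def n by linarith
  qed
  show ?thesis
  proof (cases "\<alpha> = 1")
    case True
    show ?thesis
    proof (intro exI[of _ "1 / (24 * pi)"] conjI allI impI)
      fix x :: complex assume x: "norm x \<le> 1 / (24 * pi)"
      define z where "z = 2 * of_real pi * \<i> * x"
      have nz: "norm z = 2 * pi * norm x" by (simp add: z_def norm_mult)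
      have z: "norm z \<le> 1 / 12" using x unfolding nz by (simp add: field_simps)
      have "norm (exp z - (\<Sum>i\<le>1. z ^ i / fact i)) \<le> exp \<bar>Re z\<bar> * norm z ^ Suc 1 / fact 1" by (rule Taylor_exp)
      then have t: "norm (exp z - 1 - z) \<le> exp \<bar>Re z\<bar> * norm z ^ 2" by (simp add: algebra_simps numeral_2_eq_2)
      have "exp \<bar>Re z\<bar> \<le> exp 1" using abs_Re_le_cmod[of z] z by simp
      then have "exp \<bar>Re z\<bar> \<le> 3" using e_less_272 by linarith
      then have "exp \<bar>Re z\<bar> * norm z ^ 2 \<le> 3 * norm z ^ 2" by (intro mult_right_mono) auto
      also have "3 * norm z ^ 2 \<le> 3 * (norm z * (1 / 12))" using z unfolding power2_eq_square by (intro mult_left_mono) auto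
      finally have "norm (exp z - 1 - z) \<le> norm z / 2" using t norm_ge_zero[of z] by linarith
      then have "norm (exp z - 1) \<ge> norm z / 2" using norm_triangle_ineq2[of z "z - (exp z - 1)"]
        by (simp add: norm_minus_commute)
      moreover have "norm z / 2 \<ge> norm x" unfolding nz using pi_gt3 by (simp add: mult_le_cancel_right1)
      moreover have "e2pi (x - of_real \<alpha>) = exp z"
      proof -
        have "e2pi (x - of_real \<alpha>) = e2pi x * e2pi (- 1)" using e2pi_add[of x "- 1"] True by simp
        also have "e2pi (- 1) = 1" by (simp add: e2pi_minus) (simp add: e2pi_def exp_two_pi_i')
        finally show ?thesis by (simp add: e2pi_def z_def)
      qed
      ultimately show "norm (1 - e2pi (x - of_real \<alpha>)) \<ge> norm x" by (simp add: norm_minus_commute)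
    qed auto
  next
    case False
    define c0 where "c0 = norm (1 - e2pi (- of_real \<alpha>))"
    have "c0 > 0"
    proof -
      have "e2pi (- of_real \<alpha>) \<noteq> 1"
      proof
        assume "e2pi (- of_real \<alpha>) = 1"
        then obtain n :: int where "- (2 * pi * \<alpha>) = of_int (2 * n) * pi"
          by (auto simp: e2pi_def exp_eq_1)
        then have "pi * (- \<alpha>) = pi * of_int n" by (simp add: algebra_simps)
        then have "- \<alpha> = of_int n" using pi_neq_zero mult_left_cancel by blast
        moreover have "- 1 < - \<alpha>" "- \<alpha> < 0" using assms False by auto
        ultimately have "real_of_int (- 1) < real_of_int n" "real_of_int n < real_of_int 0" by simp_all
        then have "- 1 < n" "n < 0" by (simp_all only: of_int_less_iff)
        then show False by simp
      qed
      then show ?thesis by (simp add: c0_def)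
    qed
    \<comment> \<open>The first entry is the range of \<open>ecx\<close>; the second solves
      \<open>c0 - 6 * pi * n >= n\<close> for \<open>n = norm x\<close>.\<close>
    define \<epsilon>0 where "\<epsilon>0 = min (1 / (2 * pi)) (c0 / (1 + 6 * pi))"
    show ?thesis
    proof (intro exI[of _ \<epsilon>0] conjI allI impI)
      show "\<epsilon>0 > 0" using \<open>c0 > 0\<close> pi_gt_zero by (auto simp: \<epsilon>0_def intro!: divide_pos_pos add_pos_pos)
      fix x :: complex assume x: "norm x \<le> \<epsilon>0"
      have "norm (e2pi x - 1) \<le> 3 * (2 * pi * norm x)" using x by (intro ecx) (simp add: \<epsilon>0_def)
      moreover have "norm ((1 - e2pi x) * e2pi (- of_real \<alpha>)) = norm (e2pi x - 1)"
        by (simp add: norm_mult norm_e2pi norm_minus_commute)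
      moreover have "1 - e2pi (x - of_real \<alpha>) = (1 - e2pi (- of_real \<alpha>)) + (1 - e2pi x) * e2pi (- of_real \<alpha>)"
        using e2pi_add[of x "- of_real \<alpha>"] by (simp add: algebra_simps)
      moreover note norm_diff_ineq[of "1 - e2pi (- of_real \<alpha>)" "(1 - e2pi x) * e2pi (- of_real \<alpha>)"]
      ultimately have "norm (1 - e2pi (x - of_real \<alpha>)) \<ge> c0 - 3 * (2 * pi * norm x)"
        unfolding c0_def by (metis diff_left_mono order_trans)
      moreover have "norm x * (1 + 6 * pi) \<le> c0"
        using x pi_gt_zero by (subst pos_le_divide_eq[symmetric]) (auto simp: \<epsilon>0_def add_pos_pos)
      ultimately show "norm (1 - e2pi (x - of_real \<alpha>)) \<ge> norm x" by (simp add: algebra_simps)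
    qed
  qed
qed

lemma integrable_exp_minus_abs: "integrable lborel (\<lambda>u::real. exp (- \<bar>u\<bar>))"
proof (rule Bochner_Integration.integrable_bound)
  have "integrable lborel (\<lambda>u::real. inverse (1 + u\<^sup>2))"
    using integrable_inverse_1_plus_square by (simp add: set_integrable_def einterval_def)
  then show "integrable lborel (\<lambda>u::real. 2 * inverse (1 + u\<^sup>2))" by simp
  show "AE u in (lborel :: real measure). norm (exp (- \<bar>u\<bar>)) \<le> norm (2 * inverse (1 + u\<^sup>2))"
  proof (rule AE_I2)
    fix u :: real
    have "exp \<bar>u\<bar> \<ge> (1 + u\<^sup>2) / 2" using exp_lower_Taylor_quadratic[of "\<bar>u\<bar>"] by simp
    then have "1 / exp \<bar>u\<bar> \<le> 1 / ((1 + u\<^sup>2) / 2)" by (intro frac_le) (auto intro: add_pos_nonneg)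
    then show "norm (exp (- \<bar>u\<bar>)) \<le> norm (2 * inverse (1 + u\<^sup>2))"
      by (simp add: exp_minus inverse_eq_divide)
  qed
qed measurable

lemma tendsto_integral_exhaust:
  fixes g :: "real \<Rightarrow> complex"
  assumes g: "continuous_on UNIV g" "integrable lborel g"
    and X: "filterlim X at_bot sequentially" and Y: "filterlim Y at_top sequentially"
  shows "(\<lambda>n. integral {X n..Y n} g) \<longlonglongrightarrow> (LINT u|lborel. g u)"
proof -
  have eq: "integral {X n..Y n} g = (LINT u|lborel. indicator {X n..Y n} u *\<^sub>R g u)" for n
  proof -
    have "set_integrable lborel {X n..Y n} g"
      by (rule borel_integrable_atLeastAtMost'[OF continuous_on_subset[OF g(1)]]) auto
    from set_borel_integral_eq_integral(2)[OF this] show ?thesis by (simp add: set_lebesgue_integral_def)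
  qed
  show ?thesis unfolding eq
  proof (rule integral_dominated_convergence[where w = "\<lambda>u. norm (g u)"])
    show "AE u in lborel. (\<lambda>n. indicator {X n..Y n} u *\<^sub>R g u) \<longlonglongrightarrow> g u"
    proof (rule AE_I2)
      fix u
      have "eventually (\<lambda>n. X n \<le> u) sequentially" "eventually (\<lambda>n. u \<le> Y n) sequentially"
        using X Y by (auto simp: filterlim_at_bot filterlim_at_top)
      then have "eventually (\<lambda>n. indicator {X n..Y n} u *\<^sub>R g u = g u) sequentially"
        by eventually_elim auto
      then show "(\<lambda>n. indicator {X n..Y n} u *\<^sub>R g u) \<longlonglongrightarrow> g u" by (rule tendsto_eventually)
    qed
  qed (use g in \<open>auto intro!: AE_I2 simp: indicator_def\<close>)
qed

text \<open>The logarithmic parameter \<open>u\<close> is the logarithm of the modulus, so that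
  rescaling \<open>x\<close> becomes a translation of \<open>u\<close>, under which integrals over
  the line are invariant.\<close>

definition ray :: "real \<Rightarrow> complex" where "ray u = exp (Complex u (pi / 4))"

lemma Re_ray: "Re (ray u) = exp u / sqrt 2" and Im_ray: "Im (ray u) = exp u / sqrt 2"
  by (simp_all add: ray_def Re_exp Im_exp cos_45 sin_45 real_div_sqrt)
    (simp_all add: field_simps)

lemma norm_ray [simp]: "norm (ray u) = exp u"
  by (simp add: ray_def norm_exp_eq_Re)

lemma ray_sector: "ray u \<in> sector - {0}"
  by (auto simp: sector_def Re_ray Im_ray) (simp add: ray_def)

lemma continuous_ray [continuous_intros]: "continuous_on A ray"
proof -
  have "ray = (\<lambda>u. exp (of_real u + \<i> * of_real (pi / 4)))"
    by (rule ext) (simp add: ray_def Complex_eq)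
  moreover have "continuous_on A (\<lambda>u. exp (of_real u + \<i> * of_real (pi / 4)))"
    by (intro continuous_intros)
  ultimately show ?thesis by (simp only:)
qed

text \<open>The leading \<open>ray u\<close> is the Jacobian of the logarithmic parameter. The
  denominator has the opposite sign to the one in \<open>kern\<close>, which accounts for the upper
  edge of the contour being traversed from right to left.\<close>

definition ap_fun :: "(complex \<Rightarrow> complex) \<Rightarrow> real \<Rightarrow> real \<Rightarrow> real \<Rightarrow> complex" where
  "ap_fun G \<alpha> \<theta> u = ray u * G (ray u) * exp (\<i> * of_real \<theta> * (ray u - of_real \<alpha>)) / (1 - e2pi (ray u - of_real \<alpha>))"

text \<open>The imaginary part grows like \<open>exp u\<close>, independently of
  \<open>\<alpha>\<close>. The denominator thus degenerates only at the tip and costs at most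
  \<open>exp (- u)\<close> there, which the Jacobian cancels.\<close>

lemma norm_one_minus_e2pi_ray: "1 / norm (1 - e2pi (ray u - of_real \<alpha>)) \<le> 1 + exp (- u)"
  "1 - e2pi (ray u - of_real \<alpha>) \<noteq> 0"
proof -
  define y where "y = 2 * pi * Im (ray u)"
  have s2: "sqrt 2 \<le> (2::real)" by (rule real_le_lsqrt) auto
  have "exp u * 1 \<le> exp u * (2 * pi / sqrt 2)"
    using s2 pi_gt3 by (intro mult_left_mono) (auto simp: le_divide_eq)
  then have y: "y \<ge> exp u" by (simp add: y_def Im_ray mult_ac)
  then have y0: "y > 0" using exp_gt_zero[of u] by linarith
  have "norm (1 - e2pi (ray u - of_real \<alpha>)) \<ge> 1 - exp (- y)"
    using norm_one_minus_e2pi_ge[of "ray u - of_real \<alpha>"] by (simp add: y_def)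
  moreover have p: "1 - exp (- y) > 0" using y0 by simp
  ultimately have "1 / norm (1 - e2pi (ray u - of_real \<alpha>)) \<le> 1 / (1 - exp (- y))"
    by (intro frac_le) auto
  also have "\<dots> \<le> 1 + 1 / y" using y0 by (rule inverse_one_minus_exp_le)
  also have "\<dots> \<le> 1 + 1 / exp u" using y by (intro add_mono frac_le) auto
  finally show "1 / norm (1 - e2pi (ray u - of_real \<alpha>)) \<le> 1 + exp (- u)"
    by (simp add: exp_minus inverse_eq_divide)
  show "1 - e2pi (ray u - of_real \<alpha>) \<noteq> 0"
    using p norm_one_minus_e2pi_ge[of "ray u - of_real \<alpha>"] by (auto simp: y_def)
qed

lemma norm_ap_fun_le: "norm (ap_fun G \<alpha> \<theta> u) \<le> (1 + exp u) * norm (G (ray u)) * exp (- (\<theta> * exp u / sqrt 2))"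
proof -
  have "norm (exp (\<i> * of_real \<theta> * (ray u - of_real \<alpha>))) = exp (- (\<theta> * exp u / sqrt 2))"
    by (simp add: norm_exp_eq_Re Im_ray)
  then have "norm (ap_fun G \<alpha> \<theta> u) = exp u * norm (G (ray u)) * exp (- (\<theta> * exp u / sqrt 2)) * (1 / norm (1 - e2pi (ray u - of_real \<alpha>)))"
    by (simp add: ap_fun_def norm_mult norm_divide)
  also have "\<dots> \<le> exp u * norm (G (ray u)) * exp (- (\<theta> * exp u / sqrt 2)) * (1 + exp (- u))"
    by (intro mult_left_mono norm_one_minus_e2pi_ray) auto
  also have "\<dots> = (1 + exp u) * norm (G (ray u)) * exp (- (\<theta> * exp u / sqrt 2))"
    by (simp add: algebra_simps exp_minus_inverse flip: exp_add)
  finally show ?thesis .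
qed

lemma e2pi_eq_1D: "e2pi \<zeta> = 1 \<Longrightarrow> \<exists>n::int. \<zeta> = of_int n"
proof -
  assume "e2pi \<zeta> = 1"
  then obtain n :: int where n: "Re (2 * of_real pi * \<i> * \<zeta>) = 0" "Im (2 * of_real pi * \<i> * \<zeta>) = of_int (2 * n) * pi"
    unfolding e2pi_def exp_eq_1 by blast
  have "Im \<zeta> = 0" using n(1) by simp
  moreover have "pi * Re \<zeta> = pi * of_int n" using n(2) by simp
  then have "Re \<zeta> = of_int n" using pi_neq_zero mult_left_cancel by blast
  ultimately show ?thesis by (intro exI[of _ n]) (simp add: complex_eq_iff)
qed

text \<open>Quadratic vanishing at the tip and quadratic decay at infinity give integrability in the
  logarithmic parameter and make the vertical edges disappear. \<open>sym\<close> turns the lower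
  ray into the conjugate of the upper one; \<open>nz\<close> ensures that every zero of the kernel
  denominator is a genuine simple pole.\<close>

locale abel_plana =
  fixes G :: "complex \<Rightarrow> complex" and C \<alpha> :: real
  assumes hol: "G holomorphic_on {x. Re x > 0}"
    and bound: "\<And>x. x \<in> sector - {0} \<Longrightarrow> norm (G x) \<le> C * min ((norm x)\<^sup>2) (1 / (norm x)\<^sup>2)"
    and sym: "\<And>x. Re x > 0 \<Longrightarrow> G (cnj x) = cnj (G x)"
    and nz: "\<And>x. Re x > 0 \<Longrightarrow> G x \<noteq> 0"
    and \<alpha>: "0 < \<alpha>" "\<alpha> \<le> 1"
begin

lemma C_nonneg: "C \<ge> 0"
  using bound[of 1] norm_ge_zero[of "G 1"] by (simp add: sector_def del: norm_ge_zero)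

lemma continuous_ap_fun: "continuous_on UNIV (ap_fun G \<alpha> \<theta>)"
proof -
  have "continuous_on UNIV (\<lambda>u. G (ray u))"
    by (rule continuous_on_compose2[OF holomorphic_on_imp_continuous_on[OF hol] continuous_ray])
       (use ray_sector sector_Re_pos in force)
  then show ?thesis unfolding ap_fun_def e2pi_def
    by (intro continuous_intros) (use norm_one_minus_e2pi_ray(2) in \<open>auto simp: e2pi_def\<close>)
qed

lemma norm_ap_fun_bound: "\<theta> \<ge> 0 \<Longrightarrow> norm (ap_fun G \<alpha> \<theta> u) \<le> 2 * C * exp (- \<bar>u\<bar>)"
proof -
  assume \<theta>: "\<theta> \<ge> 0"
  have "norm (ap_fun G \<alpha> \<theta> u) \<le> (1 + exp u) * norm (G (ray u)) * exp (- (\<theta> * exp u / sqrt 2))" by (rule norm_ap_fun_le)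
  also have "\<dots> \<le> (1 + exp u) * norm (G (ray u)) * 1"
    using \<theta> by (intro mult_left_mono) auto
  also have "\<dots> \<le> (1 + exp u) * (C * min ((exp u)\<^sup>2) (1 / (exp u)\<^sup>2))"
    using bound[OF ray_sector[of u]] by (simp add: mult_left_mono add_nonneg_nonneg)
  also have "\<dots> \<le> 2 * C * exp (- \<bar>u\<bar>)"
  proof (cases "u \<ge> 0")
    case True
    have "(1 + exp u) * (C * min ((exp u)\<^sup>2) (1 / (exp u)\<^sup>2)) \<le> (exp u + exp u) * (C * (1 / (exp u)\<^sup>2))"
      using True C_nonneg by (intro mult_mono add_mono mult_left_mono) auto
    also have "\<dots> = 2 * C * exp (- u)" by (simp add: power2_eq_square exp_minus field_simps)
    finally show ?thesis using True by simp
  next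
    case False
    have "(1 + exp u) * (C * min ((exp u)\<^sup>2) (1 / (exp u)\<^sup>2)) \<le> (1 + 1) * (C * ((exp u)\<^sup>2))"
      using False C_nonneg by (intro mult_mono add_mono mult_left_mono) auto
    also have "\<dots> \<le> 2 * (C * (exp u * 1))"
      using False C_nonneg unfolding power2_eq_square by (simp add: mult_left_mono)
    finally show ?thesis using False by simp
  qed
  finally show ?thesis .
qed

lemma integrable_ap_fun: "\<theta> \<ge> 0 \<Longrightarrow> integrable lborel (ap_fun G \<alpha> \<theta>)"
proof (rule Bochner_Integration.integrable_bound)
  show "integrable lborel (\<lambda>u. 2 * C * exp (- \<bar>u\<bar>))" using integrable_exp_minus_abs by simp
  show "ap_fun G \<alpha> \<theta> \<in> borel_measurable lborel"
    using borel_measurable_continuous_onI[OF continuous_ap_fun] by simp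
  show "AE u in lborel. norm (ap_fun G \<alpha> \<theta> u) \<le> norm (2 * C * exp (- \<bar>u\<bar>))" if "\<theta> \<ge> 0"
    using norm_ap_fun_bound[OF that] C_nonneg by (intro AE_I2) (simp add: abs_mult)
qed

text \<open>In the variable \<open>w = Ln x\<close> the sector is a strip, so that a rectangle can serve as contour.\<close>

definition strip_fun :: "real \<Rightarrow> complex \<Rightarrow> complex" where
  "strip_fun \<theta> w = exp w * G (exp w) * kern \<theta> (exp w - of_real \<alpha>)"

lemma strip_fun_top: "strip_fun \<theta> (Complex u (pi / 4)) = - ap_fun G \<alpha> \<theta> u"
  unfolding strip_fun_def ap_fun_def kern_def ray_def
  by (metis minus_diff_eq minus_divide_right times_divide_eq_right)

text \<open>The second form of the kernel applies on the lower edge: frequency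
  \<open>\<theta> - 2 * pi\<close> at a conjugate point is the conjugate of frequency
  \<open>2 * pi - \<theta>\<close> at the point itself.\<close>

lemma strip_fun_bot: "strip_fun \<theta> (Complex u (- (pi / 4))) = cnj (ap_fun G \<alpha> (2 * pi - \<theta>) u)"
proof -
  have x: "exp (Complex u (- (pi / 4))) = cnj (ray u)"
    by (simp add: ray_def exp_cnj complex_eq_iff Re_exp Im_exp)
  have "Re (ray u) > 0" by (simp add: Re_ray)
  then have G: "G (cnj (ray u)) = cnj (G (ray u))" by (rule sym)
  show ?thesis unfolding strip_fun_def ap_fun_def kern_alt x G
  proof (simp only: complex_cnj_mult complex_cnj_divide complex_cnj_diff complex_cnj_one times_divide_eq_right, rule arg_cong2[of _ _ _ _ "(/)"])
    have "- (cnj (ray u) - of_real \<alpha>) = - cnj (ray u - of_real \<alpha>)" by simp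
    then show "1 - e2pi (- (cnj (ray u) - complex_of_real \<alpha>)) = 1 - cnj (e2pi (ray u - complex_of_real \<alpha>))"
      by (simp only: e2pi_cnj)
    have "cnj (exp (\<i> * of_real (2 * pi - \<theta>) * (ray u - of_real \<alpha>))) = exp (cnj (\<i> * of_real (2 * pi - \<theta>) * (ray u - of_real \<alpha>)))"
      by (rule exp_cnj)
    also have "cnj (\<i> * of_real (2 * pi - \<theta>) * (ray u - of_real \<alpha>)) = \<i> * of_real (\<theta> - 2 * pi) * (cnj (ray u) - of_real \<alpha>)"
      by (simp add: algebra_simps)
    finally show "cnj (ray u) * cnj (G (ray u)) * exp (\<i> * complex_of_real (\<theta> - 2 * pi) * (cnj (ray u) - complex_of_real \<alpha>)) =
      cnj (ray u) * cnj (G (ray u)) * cnj (exp (\<i> * complex_of_real (2 * pi - \<theta>) * (ray u - complex_of_real \<alpha>)))"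
      by simp
  qed
qed


text \<open>In the variable \<open>w\<close> the poles sit at \<open>ln (m + \<alpha>)\<close>. A
  left edge below \<open>ln \<alpha>\<close> and a right edge halfway between two poles enclose
  exactly those with \<open>m <= N\<close>, each with winding number 1.\<close>

lemma rectpath_strip_fun:
  fixes N :: nat
  assumes \<epsilon>: "0 < \<epsilon>" "\<epsilon> < \<alpha>"
  defines "a1 \<equiv> Complex (ln \<epsilon>) (- (pi / 4))"
    and "a3 \<equiv> Complex (ln (real N + \<alpha> + 1 / 2)) (pi / 4)"
  shows "contour_integral (rectpath a1 a3) (strip_fun \<theta>) = (\<Sum>m\<le>N. exp (\<i> * of_real \<theta> * of_nat m) * G (of_real (real m + \<alpha>)))"
    and "continuous_on (path_image (rectpath a1 a3)) (strip_fun \<theta>)"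
proof -
  define p where "p m = (of_real (ln (real m + \<alpha>)) :: complex)" for m :: nat
  define pts where "pts = p ` {..N}"
  \<comment> \<open>The bound \<open>pi / 2\<close> keeps \<open>exp w\<close> in the right
    half-plane, where \<open>G\<close> is holomorphic; 3 / 4 gives an open neighbourhood of the
    rectangle that still misses the next pole.\<close>
  define S where "S = {w. Im w < pi / 2} \<inter> {w. Im w > - (pi / 2)} \<inter> {w. Re w < ln (real N + \<alpha> + 3 / 4)}"
  define num where "num w = exp w * G (exp w) * exp (\<i> * of_real \<theta> * (exp w - of_real \<alpha>))" for w
  define den where "den w = e2pi (exp w - of_real \<alpha>) - 1" for w
  have strip_fun: "strip_fun \<theta> = (\<lambda>w. num w / den w)"
    by (rule ext) (simp add: strip_fun_def num_def den_def kern_def)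
  have S: "open S" "convex S"
    unfolding S_def by (intro open_Int open_halfspace_Im_lt open_halfspace_Im_gt open_halfspace_Re_lt)
      (intro convex_Int convex_halfspace_Im_lt convex_halfspace_Im_gt convex_halfspace_Re_lt)
  have exp_pos: "Re (exp w) > 0" if "w \<in> S" for w
    using that cos_gt_zero_pi[of "Im w"] by (simp add: S_def Re_exp)
  have expp: "exp (p m) = of_real (real m + \<alpha>)" for m
    using \<alpha> unfolding p_def by (simp add: exp_of_real add_nonneg_pos)
  have holn: "num holomorphic_on S"
  proof -
    have "(G \<circ> exp) holomorphic_on S"
      by (rule holomorphic_on_compose_gen[OF _ hol]) (use exp_pos in \<open>auto intro: holomorphic_intros\<close>)
    then have "(\<lambda>w. G (exp w)) holomorphic_on S" by (simp add: o_def)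
    then show ?thesis unfolding num_def by (intro holomorphic_intros)
  qed
  have hold: "den holomorphic_on S" unfolding den_def e2pi_def by (intro holomorphic_intros)
  have zero: "w \<in> pts" if w: "w \<in> S" "den w = 0" for w
  proof -
    obtain n :: int where n: "exp w - of_real \<alpha> = of_int n"
      using w(2) e2pi_eq_1D[of "exp w - of_real \<alpha>"] by (auto simp: den_def)
    then have n': "exp w = of_real (real_of_int n + \<alpha>)" by (simp add: algebra_simps)
    have im: "Im (exp w) = 0" unfolding n' by simp
    have re: "Re (exp w) = real_of_int n + \<alpha>" unfolding n' by simp
    have "sin (Im w) = 0" using im by (simp add: Im_exp)
    then have iw: "Im w = 0"
      using w(1) sin_gt_zero_02 sin_eq_0_pi[of "Im w"] pi_gt_zero by (auto simp: S_def)
    then have rw: "exp (Re w) = real_of_int n + \<alpha>" using re by (simp add: Re_exp)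
    have "real_of_int n + \<alpha> > 0" using rw exp_gt_zero[of "Re w"] by simp
    then have "real_of_int n > real_of_int (- 1)" using \<alpha> by simp
    then have n0: "n \<ge> 0" by (simp only: of_int_less_iff)
    have "exp (Re w) < exp (ln (real N + \<alpha> + 3 / 4))" using w(1) by (simp add: S_def)
    also have "\<dots> = real N + \<alpha> + 3 / 4" using \<alpha> by (intro exp_ln) (auto intro: add_nonneg_pos)
    finally have "real_of_int n < real_of_int (int N + 1)" using rw by simp
    then have nN: "n \<le> int N" by (simp only: of_int_less_iff)
    have "Re w = ln (real (nat n) + \<alpha>)" using rw n0 by (metis ln_exp of_nat_nat of_int_of_nat_eq)
    then have "w = p (nat n)" using iw by (simp add: p_def complex_eq_iff)
    then show ?thesis using nN by (auto simp: pts_def)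
  qed
  have holf: "strip_fun \<theta> holomorphic_on S - pts"
    unfolding strip_fun by (rule holomorphic_on_divide)
      (use zero holn hold in \<open>auto intro: holomorphic_on_subset\<close>)
  have lne: "ln \<epsilon> < ln (real m + \<alpha>)" for m :: nat using \<epsilon> \<alpha> by (intro ln_less_cancel_iff[THEN iffD2]) auto
  have lnR: "ln (real m + \<alpha>) < ln (real N + \<alpha> + 1 / 2)" if "m \<le> N" for m :: nat
    using \<alpha> that by (intro ln_less_cancel_iff[THEN iffD2]) auto
  have lnR': "ln (real N + \<alpha> + 1 / 2) < ln (real N + \<alpha> + 3 / 4)"
    using \<alpha> by (intro ln_less_cancel_iff[THEN iffD2]) auto
  have le: "Re a1 \<le> Re a3" "Im a1 \<le> Im a3"
    using lne[of 0] lnR[of 0] by (auto simp: a1_def a3_def)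
  have sub: "cbox a1 a3 \<subseteq> S"
  proof
    fix w assume "w \<in> cbox a1 a3"
    then have w: "- (pi / 4) \<le> Im w" "Im w \<le> pi / 4" "Re w \<le> ln (real N + \<alpha> + 1 / 2)"
      by (auto simp: in_cbox_complex_iff a1_def a3_def)
    then have "Im w < pi / 2" "Im w > - (pi / 2)" "Re w < ln (real N + \<alpha> + 3 / 4)"
      using lnR' pi_gt_zero by linarith+
    then show "w \<in> S" by (simp add: S_def)
  qed
  have avoid: "path_image (rectpath a1 a3) \<subseteq> S - pts"
  proof -
    have "path_image (rectpath a1 a3) \<subseteq> S" using path_image_rectpath_subset_cbox[OF le] sub by blast
    moreover have "path_image (rectpath a1 a3) \<inter> pts = {}"
    proof -
      have "p m \<notin> path_image (rectpath a1 a3)" if "m \<le> N" for m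
        unfolding path_image_rectpath[OF le] using lne[of m] lnR[OF that] pi_gt_zero
        by (simp add: p_def a1_def a3_def)
      then show ?thesis by (auto simp: pts_def)
    qed
    ultimately show ?thesis by blast
  qed
  show "continuous_on (path_image (rectpath a1 a3)) (strip_fun \<theta>)"
    using holomorphic_on_imp_continuous_on[OF holf] avoid by (rule continuous_on_subset)
  \<comment> \<open>The Jacobian \<open>exp w\<close> in the numerator cancels the inner derivative
    of \<open>exp w\<close> in the denominator, so no trace of the logarithmic variable remains in
    the residue.\<close>
  have res: "residue (strip_fun \<theta>) (p m) = exp (\<i> * of_real \<theta> * of_nat m) * G (of_real (real m + \<alpha>)) / (2 * of_real pi * \<i>)" if m: "m \<le> N" for m
  proof -
    have d: "(den has_field_derivative e2pi (exp (p m) - of_real \<alpha>) * (2 * of_real pi * \<i> * exp (p m))) (at (p m))"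
      unfolding den_def e2pi_def by (auto intro!: derivative_eq_intros)
    have e1: "e2pi (exp (p m) - of_real \<alpha>) = 1"
      unfolding expp e2pi_def exp_eq_1 by (auto intro!: exI[of _ "int m"])
    have "residue (\<lambda>w. num w / den w) (p m) = num (p m) / (e2pi (exp (p m) - of_real \<alpha>) * (2 * of_real pi * \<i> * exp (p m)))"
    proof (rule residue_simple_pole_deriv[OF holn hold S(1) convex_connected[OF S(2)] _ d])
      show "p m \<in> S" using lnR[OF m] lnR' pi_gt_zero by (auto simp: S_def p_def)
      then show "num (p m) \<noteq> 0" using nz[OF exp_pos] by (simp add: num_def)
      show "den (p m) = 0" using e1 by (simp add: den_def)
      show "e2pi (exp (p m) - of_real \<alpha>) * (2 * of_real pi * \<i> * exp (p m)) \<noteq> 0" by simp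
    qed
    moreover define q where "q = complex_of_real (real m + \<alpha>)"
    moreover have "q \<noteq> 0" using \<alpha> unfolding q_def of_real_eq_0_iff by linarith
    moreover have "num (p m) = q * G q * exp (\<i> * of_real \<theta> * of_nat m)"
      unfolding num_def expp q_def by simp
    moreover have "e2pi (q - of_real \<alpha>) = 1" using e1 unfolding expp q_def .
    ultimately show ?thesis unfolding strip_fun expp q_def[symmetric] by (simp add: mult.commute)
  qed
  have inj: "inj_on p {..N}"
  proof (rule inj_onI)
    fix m n assume "p m = p n"
    then have "exp (p m) = exp (p n)" by simp
    then show "m = n" unfolding expp of_real_eq_iff by simp
  qed
  have wn: "winding_number (rectpath a1 a3) (p m) = 1" if "m \<le> N" for m
    by (rule winding_number_rectpath)
       (use lne[of m] lnR[OF that] pi_gt_zero in \<open>auto simp: in_box_complex_iff p_def a1_def a3_def\<close>)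
  have "contour_integral (rectpath a1 a3) (strip_fun \<theta>) = of_real (2 * pi) * \<i> * (\<Sum>q\<in>pts. winding_number (rectpath a1 a3) q * residue (strip_fun \<theta>) q)"
  proof (rule Residue_theorem[OF S(1) convex_connected[OF S(2)] _ holf _ _ avoid])
    show "finite pts" by (simp add: pts_def)
    show "valid_path (rectpath a1 a3)" by (simp add: rectpath_def Let_def)
    show "\<forall>z. z \<notin> S \<longrightarrow> winding_number (rectpath a1 a3) z = 0"
      using winding_number_rectpath_outside[OF le] sub by blast
  qed simp
  also have "(\<Sum>q\<in>pts. winding_number (rectpath a1 a3) q * residue (strip_fun \<theta>) q) = (\<Sum>m\<le>N. residue (strip_fun \<theta>) (p m))"
    unfolding pts_def by (subst sum.reindex[OF inj]) (simp add: wn)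
  also have "of_real (2 * pi) * \<i> * \<dots> = (\<Sum>m\<le>N. exp (\<i> * of_real \<theta> * of_nat m) * G (of_real (real m + \<alpha>)))"
    unfolding sum_distrib_left by (intro sum.cong) (simp_all add: res)
  finally show "contour_integral (rectpath a1 a3) (strip_fun \<theta>) = (\<Sum>m\<le>N. exp (\<i> * of_real \<theta> * of_nat m) * G (of_real (real m + \<alpha>)))" .
qed

text \<open>Reflecting \<open>exp w\<close> into the first quadrant lets the lower bounds for the
  kernel denominator treat both halves of a vertical edge at once.\<close>

lemma norm_strip_fun_le:
  assumes "0 \<le> \<theta>" "\<theta> \<le> 2 * pi" "\<bar>Im w\<bar> \<le> pi / 4"
  defines "x' \<equiv> Complex (Re (exp w)) \<bar>Im (exp w)\<bar>"
  shows "norm (strip_fun \<theta> w) \<le> exp (Re w) * (C * min ((exp (Re w))\<^sup>2) (1 / (exp (Re w))\<^sup>2)) * (1 / norm (1 - e2pi (x' - of_real \<alpha>)))"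
    and "norm x' = exp (Re w)" "Re x' \<ge> 0" "Im x' \<ge> 0"
proof -
  have c: "cos (Im w) \<ge> \<bar>sin (Im w)\<bar>" "cos (Im w) \<ge> 0"
  proof -
    have "cos \<bar>Im w\<bar> \<ge> cos (pi / 4)" using assms pi_gt_zero by (intro cos_monotone_0_pi_le) auto
    moreover have "\<bar>sin (Im w)\<bar> \<le> sin (pi / 4)"
    proof -
      have "sin \<bar>Im w\<bar> \<le> sin (pi / 4)" using assms pi_gt_zero by (intro sin_monotone_2pi_le) auto
      moreover have "\<bar>sin (Im w)\<bar> = sin \<bar>Im w\<bar>"
      proof -
        have "sin \<bar>Im w\<bar> \<ge> 0" using assms pi_gt_zero by (intro sin_ge_zero) auto
        then show ?thesis by (cases "Im w \<ge> 0") (auto simp: abs_if)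
      qed
      ultimately show ?thesis by simp
    qed
    ultimately show "cos (Im w) \<ge> \<bar>sin (Im w)\<bar>" by (simp add: sin_45 cos_45)
    then show "cos (Im w) \<ge> 0" by linarith
  qed
  have sec: "exp w \<in> sector - {0}"
    using c by (auto simp: sector_def Re_exp Im_exp abs_mult)
  have "norm (kern \<theta> (exp w - of_real \<alpha>)) \<le> 1 / norm (1 - e2pi (Complex (Re (exp w - of_real \<alpha>)) \<bar>Im (exp w - of_real \<alpha>)\<bar>))"
    by (rule norm_kern_le[OF assms(1,2)])
  also have "Complex (Re (exp w - of_real \<alpha>)) \<bar>Im (exp w - of_real \<alpha>)\<bar> = x' - of_real \<alpha>"
    by (simp add: x'_def complex_eq_iff)
  finally have k: "norm (kern \<theta> (exp w - of_real \<alpha>)) \<le> 1 / norm (1 - e2pi (x' - of_real \<alpha>))" .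
  have "norm (G (exp w)) \<le> C * min ((exp (Re w))\<^sup>2) (1 / (exp (Re w))\<^sup>2)"
    using bound[OF sec] by (simp add: norm_exp_eq_Re)
  then show "norm (strip_fun \<theta> w) \<le> exp (Re w) * (C * min ((exp (Re w))\<^sup>2) (1 / (exp (Re w))\<^sup>2)) * (1 / norm (1 - e2pi (x' - of_real \<alpha>)))"
    unfolding strip_fun_def norm_mult norm_exp_eq_Re using k C_nonneg
    by (intro mult_mono mult_left_mono mult_nonneg_nonneg) (auto simp: min_def)
  have "norm x' = norm (exp w)" by (simp add: x'_def cmod_def)
  then show "norm x' = exp (Re w)" by (simp add: norm_exp_eq_Re)
  show "Re x' \<ge> 0" "Im x' \<ge> 0" using c by (auto simp: x'_def Re_exp)
qed

end

context abel_plana begin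

text \<open>The rectangles exhaust the strip. On the right edge the integrand is at most
  \<open>2 * C / N\<close>, on the left at most \<open>C * \<epsilon>^2\<close>, so only the
  horizontal edges survive; they converge to the ray integrals by dominated convergence.\<close>

theorem abel_plana_sums:
  assumes \<theta>: "0 \<le> \<theta>" "\<theta> \<le> 2 * pi"
  shows "(\<lambda>m. exp (\<i> * of_real \<theta> * of_nat m) * G (of_real (real m + \<alpha>))) sums
    ((LINT u|lborel. ap_fun G \<alpha> \<theta> u) + cnj (LINT u|lborel. ap_fun G \<alpha> (2 * pi - \<theta>) u))"
proof -
  \<comment> \<open>Tends to 0; the summand 2 keeps it strictly below \<open>\<alpha>\<close>
    already for \<open>N = 0\<close>.\<close>
  define \<epsilon> where "\<epsilon> N = \<alpha> / (real N + 2)" for N :: nat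
  define R where "R N = real N + \<alpha> + 1 / 2" for N :: nat
  define T where "T N = (\<Sum>m\<le>N. exp (\<i> * of_real \<theta> * of_nat m) * G (of_real (real m + \<alpha>)))" for N
  define VR where "VR N = contour_integral (linepath (Complex (ln (R N)) (- (pi / 4))) (Complex (ln (R N)) (pi / 4))) (strip_fun \<theta>)" for N
  define VL where "VL N = contour_integral (linepath (Complex (ln (\<epsilon> N)) (pi / 4)) (Complex (ln (\<epsilon> N)) (- (pi / 4)))) (strip_fun \<theta>)" for N
  have \<epsilon>: "0 < \<epsilon> N" "\<epsilon> N < \<alpha>" for N using \<alpha> by (auto simp: \<epsilon>_def divide_less_eq)
  have R: "R N > 0" "\<alpha> < R N" for N using \<alpha> by (auto simp: R_def add_nonneg_pos)
  have lnlt: "ln (\<epsilon> N) < ln (R N)" for N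
    using \<epsilon>[of N] R[of N] by (intro ln_less_cancel_iff[THEN iffD2]) auto
  have eq: "T N = integral {ln (\<epsilon> N)..ln (R N)} (\<lambda>u. cnj (ap_fun G \<alpha> (2 * pi - \<theta>) u)) + VR N
      + integral {ln (\<epsilon> N)..ln (R N)} (ap_fun G \<alpha> \<theta>) + VL N"
    and ints: "strip_fun \<theta> contour_integrable_on (linepath (Complex (ln (R N)) (- (pi / 4))) (Complex (ln (R N)) (pi / 4)))"
      "strip_fun \<theta> contour_integrable_on (linepath (Complex (ln (\<epsilon> N)) (pi / 4)) (Complex (ln (\<epsilon> N)) (- (pi / 4))))" for N
  proof -
    define a1 where "a1 = Complex (ln (\<epsilon> N)) (- (pi / 4))"
    define a2 where "a2 = Complex (ln (R N)) (- (pi / 4))"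
    define a3 where "a3 = Complex (ln (R N)) (pi / 4)"
    define a4 where "a4 = Complex (ln (\<epsilon> N)) (pi / 4)"
    have rp: "rectpath a1 a3 = linepath a1 a2 +++ linepath a2 a3 +++ linepath a3 a4 +++ linepath a4 a1"
      by (simp add: rectpath_def Let_def a1_def a2_def a3_def a4_def)
    have RT: "contour_integral (rectpath a1 a3) (strip_fun \<theta>) = T N"
      unfolding a1_def a3_def T_def R_def using rectpath_strip_fun(1)[OF \<epsilon>(1) \<epsilon>(2)] .
    have cont: "continuous_on (path_image (rectpath a1 a3)) (strip_fun \<theta>)"
      unfolding a1_def a3_def R_def using rectpath_strip_fun(2)[OF \<epsilon>(1) \<epsilon>(2)] .
    have pim: "path_image (rectpath a1 a3) = closed_segment a1 a2 \<union> closed_segment a2 a3 \<union> closed_segment a3 a4 \<union> closed_segment a4 a1"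
      unfolding rp by (simp add: path_image_join Un_assoc)
    have c: "continuous_on (closed_segment a1 a2) (strip_fun \<theta>)" "continuous_on (closed_segment a2 a3) (strip_fun \<theta>)"
      "continuous_on (closed_segment a3 a4) (strip_fun \<theta>)" "continuous_on (closed_segment a4 a1) (strip_fun \<theta>)"
      unfolding pim by (auto intro: continuous_on_subset[OF cont[unfolded pim]])
    have h: "(strip_fun \<theta> has_contour_integral contour_integral (linepath a1 a2) (strip_fun \<theta>)) (linepath a1 a2)"
      "(strip_fun \<theta> has_contour_integral contour_integral (linepath a2 a3) (strip_fun \<theta>)) (linepath a2 a3)"
      "(strip_fun \<theta> has_contour_integral contour_integral (linepath a3 a4) (strip_fun \<theta>)) (linepath a3 a4)"
      "(strip_fun \<theta> has_contour_integral contour_integral (linepath a4 a1) (strip_fun \<theta>)) (linepath a4 a1)"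
      using c by (auto intro!: has_contour_integral_integral contour_integrable_continuous_linepath)
    have "(strip_fun \<theta> has_contour_integral (contour_integral (linepath a1 a2) (strip_fun \<theta>) + (contour_integral (linepath a2 a3) (strip_fun \<theta>)
       + (contour_integral (linepath a3 a4) (strip_fun \<theta>) + contour_integral (linepath a4 a1) (strip_fun \<theta>))))) (rectpath a1 a3)"
      unfolding rp by (intro has_contour_integral_join h) auto
    then have "T N = contour_integral (linepath a1 a2) (strip_fun \<theta>) + (contour_integral (linepath a2 a3) (strip_fun \<theta>)
       + (contour_integral (linepath a3 a4) (strip_fun \<theta>) + contour_integral (linepath a4 a1) (strip_fun \<theta>)))"
      using RT contour_integral_unique by metis
    moreover have "contour_integral (linepath a1 a2) (strip_fun \<theta>) = integral {ln (\<epsilon> N)..ln (R N)} (\<lambda>u. cnj (ap_fun G \<alpha> (2 * pi - \<theta>) u))"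
      unfolding a1_def a2_def contour_integral_linepath_same_Im[OF lnlt] strip_fun_bot ..
    moreover have "contour_integral (linepath a3 a4) (strip_fun \<theta>) = integral {ln (\<epsilon> N)..ln (R N)} (ap_fun G \<alpha> \<theta>)"
    proof -
      have "contour_integral (linepath a3 a4) (strip_fun \<theta>) = - contour_integral (linepath a4 a3) (strip_fun \<theta>)"
        by (rule contour_integral_reverse_linepath) (use c(3) in \<open>simp add: closed_segment_commute\<close>)
      then show ?thesis
        unfolding a3_def a4_def contour_integral_linepath_same_Im[OF lnlt] strip_fun_top by simp
    qed
    ultimately show "T N = integral {ln (\<epsilon> N)..ln (R N)} (\<lambda>u. cnj (ap_fun G \<alpha> (2 * pi - \<theta>) u)) + VR N
      + integral {ln (\<epsilon> N)..ln (R N)} (ap_fun G \<alpha> \<theta>) + VL N"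
      by (simp add: VR_def VL_def a1_def a2_def a3_def a4_def)
    show "strip_fun \<theta> contour_integrable_on (linepath (Complex (ln (R N)) (- (pi / 4))) (Complex (ln (R N)) (pi / 4)))"
      "strip_fun \<theta> contour_integrable_on (linepath (Complex (ln (\<epsilon> N)) (pi / 4)) (Complex (ln (\<epsilon> N)) (- (pi / 4))))"
      using c(2,4) by (auto simp: a1_def a2_def a3_def a4_def intro!: contour_integrable_continuous_linepath)
  qed
  have seg: "Re w = c \<and> \<bar>Im w\<bar> \<le> pi / 4"
    if "w \<in> closed_segment (Complex c (- (pi / 4))) (Complex c (pi / 4)) \<or> w \<in> closed_segment (Complex c (pi / 4)) (Complex c (- (pi / 4)))" for w c
    using that pi_gt_zero by (auto simp: closed_segment_same_Re closed_segment_eq_real_ivl split: if_splits)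
  have VR: "VR \<longlonglongrightarrow> 0"
  proof (rule Lim_null_comparison)
    show "eventually (\<lambda>N. norm (VR N) \<le> 2 * C * (pi / 2) * (1 / real N)) sequentially"
      using eventually_ge_at_top[of 1]
    proof eventually_elim
      case (elim N)
      have b: "norm (strip_fun \<theta> w) \<le> 2 * C * (1 / real N)" if "w \<in> closed_segment (Complex (ln (R N)) (- (pi / 4))) (Complex (ln (R N)) (pi / 4))" for w
      proof -
        have w: "Re w = ln (R N)" "\<bar>Im w\<bar> \<le> pi / 4" using seg that by auto
        define x' where "x' = Complex (Re (exp w)) \<bar>Im (exp w)\<bar>"
        note n = norm_strip_fun_le[OF \<theta> w(2), folded x'_def]
        have e: "exp (Re w) = R N" using w(1) R by simp
        have "norm (1 - e2pi (x' - of_real \<alpha>)) \<ge> 1 / 2"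
          by (rule norm_one_minus_e2pi_right[OF elim \<alpha>(1) _ n(3,4)]) (simp add: n(2) e R_def)
        then have i: "1 / norm (1 - e2pi (x' - of_real \<alpha>)) \<le> 1 / (1 / 2)" by (intro frac_le) auto
        have "norm (strip_fun \<theta> w) \<le> R N * (C * min ((R N)\<^sup>2) (1 / (R N)\<^sup>2)) * (1 / norm (1 - e2pi (x' - of_real \<alpha>)))"
          using n(1) unfolding e .
        also have "\<dots> \<le> R N * (C * (1 / (R N)\<^sup>2)) * 2"
          using i R[of N] C_nonneg by (intro mult_mono mult_left_mono mult_nonneg_nonneg) auto
        also have "\<dots> = 2 * C * (1 / R N)" using R(1)[of N] by (simp add: power2_eq_square)
        also have "\<dots> \<le> 2 * C * (1 / real N)"
          using elim C_nonneg \<alpha> by (intro mult_left_mono frac_le) (auto simp: R_def)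
        finally show ?thesis .
      qed
      have "norm (VR N) \<le> 2 * C * (1 / real N) * norm (Complex (ln (R N)) (pi / 4) - Complex (ln (R N)) (- (pi / 4)))"
        unfolding VR_def by (rule contour_integral_bound_linepath[OF ints(1) _ b]) (use C_nonneg in auto)
      also have "Complex (ln (R N)) (pi / 4) - Complex (ln (R N)) (- (pi / 4)) = \<i> * of_real (pi / 2)"
        by (simp add: complex_eq_iff)
      finally show ?case by (simp add: norm_mult)
    qed
    show "(\<lambda>N. 2 * C * (pi / 2) * (1 / real N)) \<longlonglongrightarrow> 0"
      by (intro tendsto_mult_right_zero lim_1_over_n)
  qed
  have \<epsilon>0: "\<epsilon> \<longlonglongrightarrow> 0"
    unfolding \<epsilon>_def by real_asymp
  have VL: "VL \<longlonglongrightarrow> 0"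
  proof (rule Lim_null_comparison)
    obtain \<epsilon>0 where e0: "\<epsilon>0 > 0" "\<And>x. norm x \<le> \<epsilon>0 \<Longrightarrow> norm (1 - e2pi (x - of_real \<alpha>)) \<ge> norm x"
      using norm_one_minus_e2pi_left[OF \<alpha>] by blast
    have "eventually (\<lambda>N. \<epsilon> N < \<epsilon>0) sequentially"
      using order_tendstoD(2)[OF \<epsilon>0 e0(1)] .
    then show "eventually (\<lambda>N. norm (VL N) \<le> C * (pi / 2) * (\<epsilon> N)\<^sup>2) sequentially"
    proof eventually_elim
      case (elim N)
      have b: "norm (strip_fun \<theta> w) \<le> C * (\<epsilon> N)\<^sup>2" if "w \<in> closed_segment (Complex (ln (\<epsilon> N)) (pi / 4)) (Complex (ln (\<epsilon> N)) (- (pi / 4)))" for w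
      proof -
        have w: "Re w = ln (\<epsilon> N)" "\<bar>Im w\<bar> \<le> pi / 4" using seg that by auto
        define x' where "x' = Complex (Re (exp w)) \<bar>Im (exp w)\<bar>"
        note n = norm_strip_fun_le[OF \<theta> w(2), folded x'_def]
        have e: "exp (Re w) = \<epsilon> N" using w(1) \<epsilon> by simp
        have "norm (1 - e2pi (x' - of_real \<alpha>)) \<ge> norm x'"
          by (rule e0(2)) (use elim n(2) e in simp)
        then have i: "1 / norm (1 - e2pi (x' - of_real \<alpha>)) \<le> 1 / \<epsilon> N" using \<epsilon>(1)[of N] n(2) e by (intro frac_le) auto
        have "norm (strip_fun \<theta> w) \<le> \<epsilon> N * (C * min ((\<epsilon> N)\<^sup>2) (1 / (\<epsilon> N)\<^sup>2)) * (1 / norm (1 - e2pi (x' - of_real \<alpha>)))"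
          using n(1) unfolding e .
        also have "\<dots> \<le> \<epsilon> N * (C * ((\<epsilon> N)\<^sup>2)) * (1 / \<epsilon> N)"
          using i \<epsilon>(1)[of N] C_nonneg by (intro mult_mono mult_left_mono mult_nonneg_nonneg) auto
        also have "\<dots> = C * (\<epsilon> N)\<^sup>2" using \<epsilon>(1)[of N] by simp
        finally show ?thesis .
      qed
      have "norm (VL N) \<le> C * (\<epsilon> N)\<^sup>2 * norm (Complex (ln (\<epsilon> N)) (- (pi / 4)) - Complex (ln (\<epsilon> N)) (pi / 4))"
        unfolding VL_def by (rule contour_integral_bound_linepath[OF ints(2) _ b]) (use C_nonneg in auto)
      also have "Complex (ln (\<epsilon> N)) (- (pi / 4)) - Complex (ln (\<epsilon> N)) (pi / 4) = - (\<i> * of_real (pi / 2))"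
        by (simp add: complex_eq_iff)
      finally show ?case by (simp add: norm_mult mult_ac)
    qed
    show "(\<lambda>N. C * (pi / 2) * (\<epsilon> N)\<^sup>2) \<longlonglongrightarrow> 0"
    proof (rule tendsto_mult_right_zero)
      show "(\<lambda>N. (\<epsilon> N)\<^sup>2) \<longlonglongrightarrow> 0" using tendsto_power[OF \<epsilon>0, of 2] by simp
    qed
  qed
  have X: "filterlim (\<lambda>N. ln (\<epsilon> N)) at_bot sequentially"
    unfolding \<epsilon>_def using \<alpha> by real_asymp
  have Y: "filterlim (\<lambda>N. ln (R N)) at_top sequentially"
    unfolding R_def using \<alpha> by real_asymp
  have I1: "(\<lambda>N. integral {ln (\<epsilon> N)..ln (R N)} (ap_fun G \<alpha> \<theta>)) \<longlonglongrightarrow> (LINT u|lborel. ap_fun G \<alpha> \<theta> u)"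
    by (rule tendsto_integral_exhaust[OF continuous_ap_fun integrable_ap_fun[OF \<theta>(1)] X Y])
  have i2: "integrable lborel (ap_fun G \<alpha> (2 * pi - \<theta>))" using \<theta> by (intro integrable_ap_fun) simp
  have "(\<lambda>N. integral {ln (\<epsilon> N)..ln (R N)} (\<lambda>u. cnj (ap_fun G \<alpha> (2 * pi - \<theta>) u))) \<longlonglongrightarrow> (LINT u|lborel. cnj (ap_fun G \<alpha> (2 * pi - \<theta>) u))"
    by (rule tendsto_integral_exhaust[OF _ _ X Y])
       (use i2 continuous_on_cnj[OF continuous_ap_fun] integrable_bounded_linear[OF bounded_linear_cnj i2] in auto)
  also have "(LINT u|lborel. cnj (ap_fun G \<alpha> (2 * pi - \<theta>) u)) = cnj (LINT u|lborel. ap_fun G \<alpha> (2 * pi - \<theta>) u)"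
    by (rule integral_bounded_linear[OF bounded_linear_cnj i2])
  finally have I2: "(\<lambda>N. integral {ln (\<epsilon> N)..ln (R N)} (\<lambda>u. cnj (ap_fun G \<alpha> (2 * pi - \<theta>) u))) \<longlonglongrightarrow> cnj (LINT u|lborel. ap_fun G \<alpha> (2 * pi - \<theta>) u)" .
  have "T \<longlonglongrightarrow> cnj (LINT u|lborel. ap_fun G \<alpha> (2 * pi - \<theta>) u) + 0 + (LINT u|lborel. ap_fun G \<alpha> \<theta> u) + 0"
    unfolding eq[abs_def] by (intro tendsto_add I1 I2 VR VL)
  then have "T \<longlonglongrightarrow> (LINT u|lborel. ap_fun G \<alpha> \<theta> u) + cnj (LINT u|lborel. ap_fun G \<alpha> (2 * pi - \<theta>) u)"
    by (simp add: add.commute)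
  then show ?thesis unfolding sums_def_le T_def .
qed

end

section \<open>Gaussian integrals and crude bounds\<close>

lemma gaussian_moment_even:
  "has_bochner_integral lborel (\<lambda>v::real. exp (- v\<^sup>2) * v ^ (2 * n)) (sqrt pi * (fact (2 * n) / (2 ^ (2 * n) * fact n)))"
  using has_bochner_integral_even_function[OF gaussian_moment_even_pos[where k = n]] by simp

text \<open>Matches the binomial coefficients of \<open>(1 - w) powr (- 1 / 2)\<close> with the
  normalised even Gaussian moments over \<open>fact n\<close>, so that integrating the exponential
  series of \<open>w * v^2\<close> termwise reproduces the binomial series.\<close>

lemma minus_half_gchoose:
  "((- 1 / 2) gchoose n) * (- 1) ^ n = (of_real (fact (2 * n) / (2 ^ (2 * n) * fact n) / fact n) :: 'a :: {real_field, field_char_0})"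
proof (induction n)
  case (Suc n)
  have "((- 1 / 2 :: 'a) gchoose Suc n) = ((- 1 / 2) gchoose n) * (- 1 / 2 - of_nat n) / of_nat (Suc n)"
    by (simp add: gbinomial_prod_rev prod.atLeast0_lessThan_Suc)
  then have "((- 1 / 2 :: 'a) gchoose Suc n) * (- 1) ^ Suc n = (((- 1 / 2) gchoose n) * (- 1) ^ n) * ((1 / 2 + of_nat n) / of_nat (Suc n))"
    by (simp add: field_simps)
  also have "\<dots> = of_real (fact (2 * n) / (2 ^ (2 * n) * fact n) / fact n * ((1 / 2 + real n) / real (Suc n)))"
    unfolding Suc.IH by simp
  also have "fact (2 * n) / (2 ^ (2 * n) * fact n) / fact n * ((1 / 2 + real n) / real (Suc n)) = fact (2 * Suc n) / (2 ^ (2 * Suc n) * fact (Suc n)) / fact (Suc n)"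
    by (simp add: divide_simps) (simp add: algebra_simps)
  finally show ?case .
qed simp

text \<open>Termwise integration, justified by the same series at \<open>norm w\<close>. Since the
  value arises as a binomial series, it comes with the principal branch of the root.\<close>

lemma gaussian_complex_disc:
  fixes w :: complex
  assumes w: "norm w < 1"
  shows "has_bochner_integral lborel (\<lambda>v::real. exp (- ((1 - w) * of_real (v\<^sup>2)))) (of_real (sqrt pi) * (1 - w) powr (- 1 / 2))"
proof -
  define b :: "nat \<Rightarrow> real" where "b n = fact (2 * n) / (2 ^ (2 * n) * fact n) / fact n" for n
  have b0: "b n \<ge> 0" for n by (simp add: b_def)
  define f where "f n v = of_real (exp (- v\<^sup>2) * v ^ (2 * n)) * (w ^ n / fact n)" for n and v :: real
  have hf: "has_bochner_integral lborel (f n) (of_real (sqrt pi * b n) * w ^ n)" for n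
  proof -
    have "has_bochner_integral lborel (\<lambda>v. of_real (exp (- v\<^sup>2) * v ^ (2 * n)) :: complex) (of_real (sqrt pi * (fact (2 * n) / (2 ^ (2 * n) * fact n))))"
      by (rule has_bochner_integral_of_real[OF gaussian_moment_even])
    then have "has_bochner_integral lborel (f n) (of_real (sqrt pi * (fact (2 * n) / (2 ^ (2 * n) * fact n))) * (w ^ n / fact n))"
      unfolding f_def by (rule has_bochner_integral_mult_left)
    then show ?thesis by (simp add: b_def)
  qed
  have hn: "(LINT v|lborel. norm (f n v)) = sqrt pi * (b n * norm w ^ n)" for n
  proof -
    have "norm (f n v) = exp (- v\<^sup>2) * v ^ (2 * n) * (norm w ^ n / fact n)" for v
      by (simp add: f_def norm_mult norm_divide norm_power abs_mult power_even_abs)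
    moreover have "has_bochner_integral lborel (\<lambda>v. exp (- v\<^sup>2) * v ^ (2 * n) * (norm w ^ n / fact n)) (sqrt pi * (fact (2 * n) / (2 ^ (2 * n) * fact n)) * (norm w ^ n / fact n))"
      by (rule has_bochner_integral_mult_left[OF gaussian_moment_even])
    ultimately show ?thesis by (simp add: has_bochner_integral_iff b_def)
  qed
  have "(\<lambda>n. ((- 1 / 2) gchoose n) * (- norm w) ^ n) sums (1 + (- norm w)) powr (- 1 / 2)"
    by (rule gen_binomial_real) (use w in simp)
  moreover have "((- 1 / 2) gchoose n) * (- norm w) ^ n = b n * norm w ^ n" for n
    using minus_half_gchoose[of n, where 'a = real] power_mult_distrib[of "- 1" "norm w" n] by (simp add: b_def mult.assoc[symmetric])
  ultimately have sn: "summable (\<lambda>n. b n * norm w ^ n)" by (simp add: sums_iff)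
  have "(\<lambda>n. ((- 1 / 2) gchoose n) * (- w) ^ n) sums (1 + (- w)) powr (- 1 / 2)"
    by (rule gen_binomial_complex) (use w in simp)
  moreover have "((- 1 / 2) gchoose n) * (- w) ^ n = of_real (b n) * w ^ n" for n
    using minus_half_gchoose[of n, where 'a = complex] power_mult_distrib[of "- 1" w n] by (simp add: b_def mult.assoc[symmetric])
  ultimately have s: "(\<lambda>n. of_real (b n) * w ^ n) sums ((1 - w) powr (- 1 / 2))" by simp
  have fs: "f n v = of_real (exp (- v\<^sup>2)) * ((w * of_real (v\<^sup>2)) ^ n / fact n)" for n v
    by (simp add: f_def power_mult_distrib power_mult[symmetric])
  have fsum: "(\<lambda>n. f n v) sums exp (- ((1 - w) * of_real (v\<^sup>2)))" for v
  proof -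
    have "(\<lambda>n. (w * of_real (v\<^sup>2)) ^ n / fact n) sums exp (w * of_real (v\<^sup>2))"
      using exp_converges[of "w * of_real (v\<^sup>2)"] by (simp add: scaleR_conv_of_real field_simps)
    then have "(\<lambda>n. f n v) sums (of_real (exp (- v\<^sup>2)) * exp (w * of_real (v\<^sup>2)))"
      unfolding fs by (rule sums_mult)
    also have "of_real (exp (- v\<^sup>2)) * exp (w * of_real (v\<^sup>2)) = exp (- ((1 - w) * of_real (v\<^sup>2)))"
      unfolding exp_of_real[symmetric] mult_exp_exp by (simp add: algebra_simps)
    finally show ?thesis .
  qed
  have sv: "summable (\<lambda>n. norm (f n v))" for v
  proof -
    have "summable (\<lambda>n. norm ((w * of_real (v\<^sup>2)) ^ n /\<^sub>R fact n))" by (rule summable_norm_exp)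
    then have "summable (\<lambda>n. exp (- v\<^sup>2) * norm ((w * of_real (v\<^sup>2)) ^ n /\<^sub>R fact n))" by (rule summable_mult)
    then show ?thesis unfolding fs by (simp add: norm_mult norm_divide norm_inverse divide_inverse mult_ac)
  qed
  have si: "summable (\<lambda>n. LINT v|lborel. norm (f n v))" unfolding hn by (rule summable_mult[OF sn])
  have int: "integrable lborel (f n)" for n using hf by (simp add: has_bochner_integral_iff)
  have "(\<lambda>n. integral\<^sup>L lborel (f n)) sums (LINT v|lborel. (\<Sum>n. f n v))"
    by (rule sums_integral[OF int _ si]) (use sv in auto)
  moreover have "integral\<^sup>L lborel (f n) = of_real (sqrt pi) * (of_real (b n) * w ^ n)" for n
    using hf[of n] by (simp add: has_bochner_integral_iff)
  moreover have "(\<lambda>n. of_real (sqrt pi) * (of_real (b n) * w ^ n)) sums (of_real (sqrt pi) * (1 - w) powr (- 1 / 2))"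
    by (rule sums_mult[OF s])
  moreover have "(\<Sum>n. f n v) = exp (- ((1 - w) * of_real (v\<^sup>2)))" for v
    using fsum by (simp add: sums_iff)
  ultimately have "(LINT v|lborel. exp (- ((1 - w) * of_real (v\<^sup>2)))) = of_real (sqrt pi) * (1 - w) powr (- 1 / 2)"
    by (simp add: sums_iff)
  moreover have "integrable lborel (\<lambda>v. \<Sum>n. f n v)"
    by (rule integrable_suminf[OF int _ si]) (use sv in auto)
  ultimately show ?thesis using fsum by (simp add: has_bochner_integral_iff sums_iff)
qed

lemma gaussian_scale:
  fixes c :: complex
  assumes "has_bochner_integral lborel (\<lambda>v::real. exp (- (c * of_real (v\<^sup>2)))) I" "r > 0"
  shows "has_bochner_integral lborel (\<lambda>v::real. exp (- (of_real r * c * of_real (v\<^sup>2)))) (I / of_real (sqrt r))"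
proof -
  have "has_bochner_integral lborel (\<lambda>v. exp (- (c * of_real ((0 + sqrt r * v)\<^sup>2)))) (I /\<^sub>R \<bar>sqrt r\<bar>)"
    using assms by (subst lborel_has_bochner_integral_real_affine_iff[symmetric]) auto
  moreover have "exp (- (c * of_real ((0 + sqrt r * v)\<^sup>2))) = exp (- (of_real r * c * of_real (v\<^sup>2)))" for v
    using assms(2) by (simp add: power_mult_distrib mult_ac flip: of_real_mult of_real_power)
  ultimately show ?thesis using assms(2) by (simp add: scaleR_conv_of_real field_simps)
qed

text \<open>The power series in \<open>w\<close> reaches \<open>1 - w = (1 - \<i>) / 2\<close>, which lies on the required ray; scaling does the rest.\<close>

lemma gaussian_ray:
  "\<exists>g>0. \<forall>r>0. has_bochner_integral lborel (\<lambda>v::real. exp (- (of_real r * cis (- (pi / 4)) * of_real (v\<^sup>2)))) (of_real (g / sqrt r) * cis (pi / 8))"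
proof -
  define w where "w = Complex (1 / 2) (1 / 2)"
  have nw: "norm w < 1" by (simp add: w_def cmod_def power2_eq_square)
  have c: "1 - w = of_real (1 / sqrt 2) * cis (- (pi / 4))"
    by (simp add: w_def complex_eq_iff cos_45 sin_45 real_div_sqrt)
  \<comment> \<open>The argument \<open>- pi / 4\<close> of \<open>1 - w\<close> becomes the phase
    \<open>pi / 8\<close> under the power \<open>- 1 / 2\<close>.\<close>
  have "Ln (1 - w) = of_real (ln (1 / sqrt 2)) + \<i> * of_real (- (pi / 4))"
    unfolding c cis_conv_exp exp_of_real[symmetric]
  proof -
    have "of_real (1 / sqrt 2) * exp (\<i> * of_real (- (pi / 4))) = exp (of_real (ln (1 / sqrt 2)) + \<i> * of_real (- (pi / 4)))"
      unfolding exp_add exp_of_real by simp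
    then show "Ln (of_real (1 / sqrt 2) * exp (\<i> * of_real (- (pi / 4)))) = of_real (ln (1 / sqrt 2)) + \<i> * of_real (- (pi / 4))"
      by (simp only:) (rule Ln_exp; simp; insert pi_gt_zero; linarith)
  qed
  then have L: "- 1 / 2 * Ln (1 - w) = of_real (- (1 / 2) * ln (1 / sqrt 2)) + \<i> * of_real (pi / 8)"
    by (simp only:) (simp add: algebra_simps)
  have "1 - w \<noteq> 0" by (simp add: w_def complex_eq_iff)
  then have "(1 - w) powr (- 1 / 2) = exp (of_real (- (1 / 2) * ln (1 / sqrt 2)) + \<i> * of_real (pi / 8))"
    unfolding powr_def L[symmetric] by simp
  also have "\<dots> = of_real (exp (- (1 / 2) * ln (1 / sqrt 2))) * cis (pi / 8)"
    unfolding exp_add exp_of_real cis_conv_exp ..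
  finally have pw: "(1 - w) powr (- 1 / 2) = of_real (exp (- (1 / 2) * ln (1 / sqrt 2))) * cis (pi / 8)" .
  define g0 where "g0 = sqrt pi * exp (- (1 / 2) * ln (1 / sqrt 2))"
  have h: "has_bochner_integral lborel (\<lambda>v::real. exp (- ((1 - w) * of_real (v\<^sup>2)))) (of_real g0 * cis (pi / 8))"
    using gaussian_complex_disc[OF nw] unfolding pw by (simp add: g0_def mult.assoc)
  show ?thesis
  proof (intro exI[of _ "g0 / sqrt (sqrt 2)"] conjI allI impI)
    show "g0 / sqrt (sqrt 2) > 0" by (simp add: g0_def)
    fix r :: real assume r: "r > 0"
    have "has_bochner_integral lborel (\<lambda>v::real. exp (- (of_real (r * sqrt 2) * (1 - w) * of_real (v\<^sup>2)))) (of_real g0 * cis (pi / 8) / of_real (sqrt (r * sqrt 2)))"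
      by (rule gaussian_scale[OF h]) (use r in simp)
    moreover have "of_real (r * sqrt 2) * (1 - w) = of_real r * cis (- (pi / 4))"
    proof -
      have "complex_of_real (sqrt 2) * of_real (1 / sqrt 2) = 1" by (simp flip: of_real_mult)
      then show ?thesis unfolding c of_real_mult by (metis mult.assoc mult.left_neutral)
    qed
    moreover have "of_real g0 * cis (pi / 8) / of_real (sqrt (r * sqrt 2)) = of_real (g0 / sqrt (sqrt 2) / sqrt r) * cis (pi / 8)"
      by (simp add: real_sqrt_mult field_simps)
    ultimately show "has_bochner_integral lborel (\<lambda>v::real. exp (- (of_real r * cis (- (pi / 4)) * of_real (v\<^sup>2)))) (of_real (g0 / sqrt (sqrt 2) / sqrt r) * cis (pi / 8))"
      by (simp only:)
  qed
qed

text \<open>The rate \<open>r / 4\<close> is the part of the Gaussian decay that remains for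
  integration once all growing factors have been absorbed.\<close>

lemma gaussian_real_quarter:
  "\<exists>g>0. \<forall>r>0. has_bochner_integral lborel (\<lambda>v::real. exp (- (r * v\<^sup>2 / 4))) (g / sqrt r)"
proof (intro exI[of _ "2 * sqrt pi"] conjI allI impI)
  fix r :: real assume r: "r > 0"
  have "has_bochner_integral lborel (\<lambda>v::real. exp (- v\<^sup>2)) (sqrt pi)"
    using gaussian_moment_even[of 0] by simp
  then have "has_bochner_integral lborel (\<lambda>v. exp (- (0 + (sqrt r / 2) * v)\<^sup>2)) (sqrt pi /\<^sub>R \<bar>sqrt r / 2\<bar>)"
    using r by (subst lborel_has_bochner_integral_real_affine_iff[symmetric]) auto
  moreover have "exp (- (0 + (sqrt r / 2) * v)\<^sup>2) = exp (- (r * v\<^sup>2 / 4))" for v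
    using r by (simp add: power_mult_distrib power_divide)
  ultimately show "has_bochner_integral lborel (\<lambda>v::real. exp (- (r * v\<^sup>2 / 4))) (2 * sqrt pi / sqrt r)"
    using r by (simp add: field_simps)
qed simp

section \<open>Crude bounds for the summand on the whole sector\<close>

lemma power_le_exp: "y \<ge> 0 \<Longrightarrow> y ^ n \<le> fact n * exp y" for y :: real
proof -
  assume y: "y \<ge> 0"
  have "(\<Sum>i\<in>{n}. y ^ i /\<^sub>R fact i) \<le> (\<Sum>i. y ^ i /\<^sub>R fact i)"
    by (rule sum_le_suminf) (use y summable_exp_generic[of y] in auto)
  also have "\<dots> = exp y" by (simp add: exp_def)
  finally show ?thesis by (simp add: divide_inverse[symmetric] field_simps)
qed

lemma power_le_exp_scaled: "y \<ge> 0 \<Longrightarrow> \<delta> > 0 \<Longrightarrow> y ^ n \<le> fact n / \<delta> ^ n * exp (\<delta> * y)" for y \<delta> :: real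
  using power_le_exp[of "\<delta> * y" n] by (simp add: power_mult_distrib field_simps)

lemma sector_norm_le_sqrt2: "x \<in> sector \<Longrightarrow> norm x \<le> sqrt 2 * Re x"
proof -
  assume x: "x \<in> sector"
  then have "\<bar>Im x\<bar> \<le> Re x" by (simp add: sector_def)
  then have "(Im x)\<^sup>2 \<le> (Re x)\<^sup>2" "Re x \<ge> 0" by (auto simp: abs_le_square_iff[symmetric])
  then have "sqrt ((Re x)\<^sup>2 + (Im x)\<^sup>2) \<le> sqrt (2 * (Re x)\<^sup>2)" by (intro real_sqrt_le_mono) auto
  then show ?thesis using \<open>Re x \<ge> 0\<close> by (simp add: cmod_def real_sqrt_mult)
qed

lemma norm_Gk: "x \<noteq> 0 \<Longrightarrow> norm (Gk k x) = exp (- (real k / 2 * ln (norm x)) - real k * pi\<^sup>2 / 6 * (Re x / (norm x)\<^sup>2))"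
proof -
  assume x: "x \<noteq> 0"
  have "Re (of_real a / x) = a * (Re x / (norm x)\<^sup>2)" for a
    by (simp add: Re_divide cmod_power2)
  moreover have "Re (of_nat k / 2 * Ln x) = real k / 2 * ln (norm x)" using x by simp
  ultimately show ?thesis unfolding Gk_def norm_exp_eq_Re minus_complex.sel uminus_complex.sel
    by (simp only:)
qed

text \<open>Giving up the part \<open>A - A'\<close> of the exponential rate pays for every power of
  \<open>1 / norm x\<close> near the tip; for \<open>norm x > 1\<close> the decay of
  \<open>exp (- Re x)\<close> pays instead. The \<open>sqrt 2\<close> arises because
  \<open>Re (1 / x)\<close> is at least \<open>1 / (sqrt 2 * norm x)\<close> in the sector.\<close>

lemma norm_Fk_crude:
  fixes A' :: real
  assumes k: "k \<ge> 1" and A': "0 \<le> A'" "A' < real k * pi\<^sup>2 / 6"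
  shows "\<exists>C>0. \<forall>x\<in>sector - {0}. norm (Fk k x) * (1 + norm x) \<le>
     C * exp (- (A' / (sqrt 2 * norm x))) * min ((norm x)\<^sup>2) (1 / (norm x)\<^sup>2)"
proof -
  define A where "A = real k * pi\<^sup>2 / 6"
  define \<delta> where "\<delta> = (A - A') / sqrt 2"
  have \<delta>: "\<delta> > 0" and A: "A > 0" using A' by (auto simp: \<delta>_def A_def)
  obtain \<kappa> C where \<kappa>: "\<kappa> > 0" "C > 0" and asy:
    "\<forall>x\<in>sector - {0}. norm (Fk k x - of_real \<kappa> * Gk k x) \<le> C * norm x * (1 + norm x) ^ k * norm (Gk k x)"
    using Fk_asymp by blast
  \<comment> \<open>Of the \<open>k + 2\<close> powers of \<open>1 / n\<close> to be absorbed,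
    \<open>k\<close> bound the algebraic factor of \<open>Gk\<close> and two create the factor
    \<open>n^2\<close>.\<close>
  define C1 where "C1 = (\<kappa> + C * 2 ^ k) * 2 * (fact (k + 2) / \<delta> ^ (k + 2))"
  define C2 where "C2 = 2 * exp (sqrt 2 * A) * exp A' * (fact 3 / (1 / sqrt 2) ^ 3)"
  have C12: "C1 > 0" "C2 > 0"
    unfolding C1_def C2_def using \<kappa> \<delta>
    by (intro mult_pos_pos add_pos_pos divide_pos_pos zero_less_power; simp)+
  have "norm (Fk k x) * (1 + norm x) \<le> (C1 + C2) * exp (- (A' / (sqrt 2 * norm x))) * min ((norm x)\<^sup>2) (1 / (norm x)\<^sup>2)"
    if x: "x \<in> sector - {0}" for x
  proof -
    define n where "n = norm x"
    have n: "n > 0" using x by (simp add: n_def)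
    have re: "Re x \<ge> n / sqrt 2" using sector_norm_le_sqrt2[of x] x by (simp add: n_def field_simps)
    then have re0: "Re x > 0" using n by (smt (verit) divide_pos_pos real_sqrt_gt_0_iff)
    have ex: "exp (- (A' / (sqrt 2 * n))) > 0" by simp
    show ?thesis
    proof (cases "n \<le> 1")
      case True
      have G: "norm (Gk k x) \<le> (1 / n) ^ k * exp (- (A / (sqrt 2 * n)))"
      proof -
        have "A / (sqrt 2 * n) = A * (n / sqrt 2 / n\<^sup>2)" using n by (simp add: power2_eq_square)
        also have "\<dots> \<le> A * (Re x / n\<^sup>2)" using A re by (intro mult_left_mono divide_right_mono) auto
        finally have 1: "A / (sqrt 2 * n) \<le> A * (Re x / n\<^sup>2)" .
        have "real k * ln n \<le> real k / 2 * ln n"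
          using n True by (simp add: mult_left_mono_neg field_simps mult_nonneg_nonpos)
        then have "norm (Gk k x) \<le> exp (- (real k * ln n) - A / (sqrt 2 * n))"
          using norm_Gk[of x k] x 1 by (simp add: n_def A_def)
        also have "\<dots> = (1 / n) ^ k * exp (- (A / (sqrt 2 * n)))"
        proof -
          have "exp (- (real k * ln n) - z) = (1 / n) ^ k * exp (- z)" for z
            using n by (simp add: exp_diff exp_minus exp_of_nat_mult power_divide inverse_eq_divide)
          then show ?thesis .
        qed
        finally show ?thesis .
      qed
      have "norm (Fk k x) \<le> norm (of_real \<kappa> * Gk k x) + norm (Fk k x - of_real \<kappa> * Gk k x)"
        by (metis add.commute diff_add_cancel norm_triangle_ineq)
      also have "\<dots> \<le> \<kappa> * norm (Gk k x) + C * n * (1 + n) ^ k * norm (Gk k x)"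
        using asy x \<kappa> by (auto simp: norm_mult n_def)
      also have "\<dots> \<le> \<kappa> * norm (Gk k x) + C * 1 * 2 ^ k * norm (Gk k x)"
        using n True \<kappa> by (intro add_left_mono mult_right_mono mult_mono power_mono) auto
      also have "\<dots> = (\<kappa> + C * 2 ^ k) * norm (Gk k x)" by (simp add: distrib_right)
      finally have "norm (Fk k x) * (1 + n) \<le> (\<kappa> + C * 2 ^ k) * norm (Gk k x) * 2"
        using n True \<kappa> by (intro mult_mono) auto
      also have "\<dots> \<le> (\<kappa> + C * 2 ^ k) * ((1 / n) ^ k * exp (- (A / (sqrt 2 * n)))) * 2"
        using G \<kappa> by (intro mult_right_mono mult_left_mono) auto
      also have "exp (- (A / (sqrt 2 * n))) = exp (- (A' / (sqrt 2 * n))) * exp (- (\<delta> * (1 / n)))"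
        using n by (simp add: mult_exp_exp \<delta>_def field_simps)
      also have "(\<kappa> + C * 2 ^ k) * ((1 / n) ^ k * (exp (- (A' / (sqrt 2 * n))) * exp (- (\<delta> * (1 / n))))) * 2 =
          (\<kappa> + C * 2 ^ k) * 2 * exp (- (A' / (sqrt 2 * n))) * n\<^sup>2 * ((1 / n) ^ (k + 2) * exp (- (\<delta> * (1 / n))))"
        using n by (simp add: power_add power_divide power2_eq_square)
      also have "\<dots> \<le> (\<kappa> + C * 2 ^ k) * 2 * exp (- (A' / (sqrt 2 * n))) * n\<^sup>2 * (fact (k + 2) / \<delta> ^ (k + 2))"
      proof (intro mult_left_mono)
        have "(1 / n) ^ (k + 2) * exp (- (\<delta> * (1 / n))) \<le> (fact (k + 2) / \<delta> ^ (k + 2) * exp (\<delta> * (1 / n))) * exp (- (\<delta> * (1 / n)))"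
          using power_le_exp_scaled[of "1 / n" \<delta> "k + 2"] n \<delta> by (intro mult_right_mono) auto
        then show "(1 / n) ^ (k + 2) * exp (- (\<delta> * (1 / n))) \<le> fact (k + 2) / \<delta> ^ (k + 2)"
          by (simp add: mult.assoc mult_exp_exp)
      qed (use \<kappa> in auto)
      also have "\<dots> = C1 * exp (- (A' / (sqrt 2 * n))) * n\<^sup>2" by (simp add: C1_def)
      also have "n\<^sup>2 = min (n\<^sup>2) (1 / n\<^sup>2)"
      proof -
        have "n\<^sup>2 \<le> 1" using n True by (simp add: power_le_one)
        then have "n\<^sup>2 \<le> 1 / n\<^sup>2" using n by (smt (verit) divide_le_eq_1_pos le_divide_eq_1_pos zero_less_power one_le_numeral)
        then show ?thesis by simp
      qed
      finally have "norm (Fk k x) * (1 + n) \<le> C1 * exp (- (A' / (sqrt 2 * n))) * min (n\<^sup>2) (1 / n\<^sup>2)" .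
      also have "\<dots> \<le> (C1 + C2) * exp (- (A' / (sqrt 2 * n))) * min (n\<^sup>2) (1 / n\<^sup>2)"
        using C12 by (intro mult_right_mono) auto
      finally show ?thesis by (simp add: n_def)
    next
      case False
      have "norm (Fk k x) \<le> exp (- Re x + real k * (pi\<^sup>2 / (6 * Re x)))" by (rule norm_Fk_le[OF re0])
      also have "\<dots> \<le> exp (- (n / sqrt 2) + sqrt 2 * A)"
      proof -
        have "real k * (pi\<^sup>2 / (6 * Re x)) = A / Re x" by (simp add: A_def)
        also have "\<dots> \<le> A / (1 / sqrt 2)"
          using re False A re0 by (intro frac_le) (auto simp: field_simps intro: order_trans)
        finally show ?thesis using re by (simp add: mult.commute)
      qed
      finally have "norm (Fk k x) * (1 + n) \<le> exp (- (n / sqrt 2) + sqrt 2 * A) * (2 * n)"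
        using False by (intro mult_mono) auto
      also have "\<dots> = 2 * exp (sqrt 2 * A) * (1 / n\<^sup>2) * (n ^ 3 * exp (- ((1 / sqrt 2) * n)))"
      proof -
        have "exp (- (n / sqrt 2) + sqrt 2 * A) = exp (sqrt 2 * A) * exp (- ((1 / sqrt 2) * n))"
          by (simp add: mult_exp_exp)
        then show ?thesis using n by (simp add: power2_eq_square power3_eq_cube)
      qed
      also have "\<dots> \<le> 2 * exp (sqrt 2 * A) * (1 / n\<^sup>2) * (fact 3 / (1 / sqrt 2) ^ 3)"
      proof (intro mult_left_mono)
        have "n ^ 3 * exp (- ((1 / sqrt 2) * n)) \<le> (fact 3 / (1 / sqrt 2) ^ 3 * exp ((1 / sqrt 2) * n)) * exp (- ((1 / sqrt 2) * n))"
          by (intro mult_right_mono power_le_exp_scaled) (use n in auto)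
        then show "n ^ 3 * exp (- ((1 / sqrt 2) * n)) \<le> fact 3 / (1 / sqrt 2) ^ 3"
          by (simp only: mult.assoc mult_exp_exp) simp
      qed auto
      also have "\<dots> = 2 * exp (sqrt 2 * A) * (fact 3 / (1 / sqrt 2) ^ 3) * (1 / n\<^sup>2) * 1" by simp
      \<comment> \<open>For \<open>n > 1\<close> the exponential factor is bounded below by
        \<open>exp (- A')\<close>; inserting it gives both ranges the same shape.\<close>
      also have "\<dots> \<le> 2 * exp (sqrt 2 * A) * (fact 3 / (1 / sqrt 2) ^ 3) * (1 / n\<^sup>2) * (exp A' * exp (- (A' / (sqrt 2 * n))))"
      proof (intro mult_left_mono)
        have "1 \<le> sqrt 2 * n" using False by (smt (verit) mult_le_cancel_right1 real_sqrt_ge_1_iff)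
        then have "A' / (sqrt 2 * n) \<le> A' / 1" using A' by (intro frac_le) auto
        then show "1 \<le> exp A' * exp (- (A' / (sqrt 2 * n)))" by (simp add: mult_exp_exp)
      qed auto
      also have "\<dots> = C2 * exp (- (A' / (sqrt 2 * n))) * (1 / n\<^sup>2)" by (simp add: C2_def)
      also have "1 / n\<^sup>2 = min (n\<^sup>2) (1 / n\<^sup>2)"
      proof -
        have "n\<^sup>2 \<ge> 1" using False by (simp add: one_le_power)
        then have "1 / n\<^sup>2 \<le> n\<^sup>2" using n by (smt (verit) divide_le_eq_1_pos zero_less_power)
        then show ?thesis by simp
      qed
      finally have "norm (Fk k x) * (1 + n) \<le> C2 * exp (- (A' / (sqrt 2 * n))) * min (n\<^sup>2) (1 / n\<^sup>2)" .
      also have "\<dots> \<le> (C1 + C2) * exp (- (A' / (sqrt 2 * n))) * min (n\<^sup>2) (1 / n\<^sup>2)"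
        using C12 by (intro mult_right_mono) auto
      finally show ?thesis by (simp add: n_def)
    qed
  qed
  then show ?thesis using C12 by (intro exI[of _ "C1 + C2"]) auto
qed

section \<open>The saddle point\<close>

lemma cosh_ge_quadratic: "1 + v\<^sup>2 / 2 \<le> cosh v" for v :: real
proof -
  have "(\<Sum>n<3. if even n then v ^ n /\<^sub>R fact n else 0) \<le> (\<Sum>n. if even n then v ^ n /\<^sub>R fact n else 0)"
    by (rule sum_le_suminf) (use cosh_converges[of v] in \<open>auto simp: sums_iff zero_le_even_power\<close>)
  also have "\<dots> = cosh v" using cosh_converges[of v] by (simp add: sums_iff)
  finally show ?thesis by (simp add: eval_nat_numeral)
qed

lemma exp_real_Taylor: "\<bar>exp v - (\<Sum>i\<le>n. v ^ i / fact i)\<bar> \<le> exp \<bar>v\<bar> * \<bar>v\<bar> ^ Suc n" for v :: real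
proof -
  have "norm (exp (of_real v) - (\<Sum>i\<le>n. of_real v ^ i / fact i) :: complex) \<le> exp \<bar>Re (of_real v)\<bar> * norm (of_real v :: complex) ^ Suc n / fact n"
    by (rule Taylor_exp)
  also have "exp (of_real v) - (\<Sum>i\<le>n. of_real v ^ i / fact i) = (of_real (exp v - (\<Sum>i\<le>n. v ^ i / fact i)) :: complex)"
    by (simp add: exp_of_real)
  also have "exp \<bar>Re (of_real v)\<bar> * norm (of_real v :: complex) ^ Suc n / fact n \<le> exp \<bar>v\<bar> * \<bar>v\<bar> ^ Suc n / 1"
    unfolding norm_of_real Re_complex_of_real by (intro divide_left_mono) (auto simp: fact_ge_1)
  finally show ?thesis by (simp only: norm_of_real div_by_1)
qed

lemma abs_mean_le:
  fixes a b p q r c X :: real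
  assumes "\<bar>a - p\<bar> \<le> X" "\<bar>b - q\<bar> \<le> X" "c = (a + b) / 2" "r = (p + q) / 2"
  shows "\<bar>c - r\<bar> \<le> X"
  using abs_le_D1[OF assms(1)] abs_le_D2[OF assms(1)] abs_le_D1[OF assms(2)] abs_le_D2[OF assms(2)] assms(3,4)
  by (intro abs_leI) (simp_all add: field_simps)

lemma cosh_minus_one_le: "\<bar>cosh v - 1\<bar> \<le> exp \<bar>v\<bar> * v\<^sup>2" for v :: real
proof -
  define X where "X = exp \<bar>v\<bar> * v\<^sup>2"
  have "\<bar>exp v - (1 + v)\<bar> \<le> X" "\<bar>exp (- v) - (1 - v)\<bar> \<le> X"
    using exp_real_Taylor[of v 1] exp_real_Taylor[of "- v" 1] by (simp_all add: numeral_2_eq_2 X_def)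
  moreover have "cosh v = (exp v + exp (- v)) / 2" by (simp add: cosh_def)
  ultimately show ?thesis unfolding X_def[symmetric] by (rule abs_mean_le) simp
qed

lemma cosh_minus_quadratic_le: "\<bar>cosh v - 1 - v\<^sup>2 / 2\<bar> \<le> exp \<bar>v\<bar> * v ^ 4" for v :: real
proof -
  define X where "X = exp \<bar>v\<bar> * v ^ 4"
  have p: "\<bar>v\<bar> ^ 4 = v ^ 4" by (simp add: power_even_abs)
  have "\<bar>exp v - (1 + v + v\<^sup>2 / 2 + v ^ 3 / 6)\<bar> \<le> X"
    using exp_real_Taylor[of v 3] p by (simp add: eval_nat_numeral fact_numeral X_def)
  moreover have "\<bar>exp (- v) - (1 - v + v\<^sup>2 / 2 - v ^ 3 / 6)\<bar> \<le> X"
    using exp_real_Taylor[of "- v" 3] p by (simp add: eval_nat_numeral fact_numeral X_def)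
  moreover have "cosh v = (exp v + exp (- v)) / 2" by (simp add: cosh_def)
  ultimately have "\<bar>cosh v - (1 + v\<^sup>2 / 2)\<bar> \<le> X" by (rule abs_mean_le) (simp add: field_simps)
  then show ?thesis by (simp add: X_def diff_diff_eq)
qed

lemma norm_exp_minus_one_le_right: "Re z \<ge> 0 \<Longrightarrow> norm (exp (- z) - 1) \<le> norm z" for z :: complex
proof -
  assume z: "Re z \<ge> 0"
  have "norm (exp (- z) - exp (- 0)) \<le> 1 * norm (z - 0)"
  proof (rule field_differentiable_bound[where S = "{z. Re z \<ge> 0}" and f' = "\<lambda>z. - exp (- z)"])
    show "convex {z. Re z \<ge> 0}" by (rule convex_halfspace_Re_ge)
    show "((\<lambda>z. exp (- z)) has_field_derivative - exp (- w)) (at w within {z. Re z \<ge> 0})" for w :: complex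
      by (auto intro!: derivative_eq_intros)
  qed (use z in \<open>auto simp: norm_exp_eq_Re\<close>)
  then show ?thesis by simp
qed

text \<open>Expanding \<open>(4 * p - \<bar>v\<bar>)^2 >= 0\<close>: an exponential factor costs an
  eighth of the Gaussian rate, uniformly for \<open>\<mu> >= 1\<close>.\<close>

lemma exp_abs_le_gauss: "\<mu> \<ge> 1 \<Longrightarrow> exp (p * \<bar>v\<bar>) \<le> exp (2 * p\<^sup>2) * exp (\<mu> * v\<^sup>2 / 8)" for p v \<mu> :: real
proof -
  assume \<mu>: "\<mu> \<ge> 1"
  have "0 \<le> (4 * p - \<bar>v\<bar>)\<^sup>2" by simp
  then have "p * \<bar>v\<bar> \<le> 2 * p\<^sup>2 + v\<^sup>2 / 8" by (simp add: power2_eq_square algebra_simps)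
  moreover have "1 * v\<^sup>2 \<le> \<mu> * v\<^sup>2" using \<mu> by (intro mult_right_mono) auto
  ultimately show ?thesis by (simp add: mult_exp_exp)
qed

text \<open>The quadratic rate at the saddle is \<open>1 / sqrt 2\<close>. It is spent in portions:
  eighths against growing factors, a quarter kept for integration.\<close>

lemma inverse_sqrt2_bounds: "1 / sqrt 2 \<ge> (1 / 2 + 1 / 8 :: real)"
proof -
  have "sqrt 2 \<le> sqrt ((8 / 5)\<^sup>2)" by (intro real_sqrt_le_mono) (simp add: power2_eq_square)
  then have "sqrt 2 \<le> 8 / 5" by simp
  then have "1 / (8 / 5) \<le> 1 / sqrt (2::real)" by (intro frac_le) auto
  then show ?thesis by simp
qed

text \<open>The common direction of both exponents on the upper ray: \<open>1 / x\<close> is a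
  positive and \<open>\<i> * x\<close> a negative multiple of it.\<close>

definition wbar :: complex where "wbar = cis (- (pi / 4))"

lemma exp_wbar: "exp (- (of_real r * wbar)) = of_real (exp (- (r / sqrt 2))) * cis (r / sqrt 2)"
proof -
  have s: "sqrt 2 / 2 = 1 / sqrt (2::real)" by (simp add: field_simps)
  have "- (of_real r * wbar) = of_real (- (r / sqrt 2)) + \<i> * of_real (r / sqrt 2)"
  proof -
    have "cos (pi / 4) = 1 / sqrt 2" "sin (pi / 4) = 1 / sqrt 2" by (simp_all add: cos_45 sin_45 s)
    then show ?thesis unfolding wbar_def by (simp add: complex_eq_iff)
  qed
  then show ?thesis by (simp only: exp_add exp_of_real cis_conv_exp)
qed

lemma norm_exp_wbar: "norm (exp (- (of_real r * wbar))) = exp (- (r / sqrt 2))"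
  unfolding exp_wbar norm_mult by simp

text \<open>The quadratic lower bound for \<open>cosh\<close> splits off the minimum of the exponent
  exactly, and what exceeds it beats \<open>exp (p * \<bar>v\<bar>)\<close>, leaving a Gaussian of
  rate \<open>\<mu> / 4\<close>.\<close>

lemma exp_cosh_gauss:
  fixes \<mu> p v :: real
  assumes "\<mu> \<ge> 1"
  shows "exp (p * \<bar>v\<bar>) * exp (- (2 * \<mu> * cosh v / sqrt 2)) \<le> exp (- (2 * \<mu> / sqrt 2)) * (exp (2 * p\<^sup>2) * exp (- (\<mu> * v\<^sup>2 / 4)))"
proof -
  have "2 * \<mu> * cosh v * (1 / sqrt 2) \<ge> 2 * \<mu> * (1 + v\<^sup>2 / 2) * (1 / sqrt 2)"
    using cosh_ge_quadratic[of v] assms by (intro mult_right_mono mult_left_mono) auto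
  moreover have "\<mu> * v\<^sup>2 * (1 / sqrt 2) \<ge> \<mu> * v\<^sup>2 * (1 / 2 + 1 / 8)"
    using assms inverse_sqrt2_bounds by (intro mult_left_mono) auto
  ultimately have "2 * \<mu> * cosh v / sqrt 2 \<ge> 2 * \<mu> / sqrt 2 + \<mu> * v\<^sup>2 * (1 / 2 + 1 / 8)"
  proof -
    have "2 * \<mu> * (1 + v\<^sup>2 / 2) * (1 / sqrt 2) = 2 * \<mu> * (1 / sqrt 2) + \<mu> * v\<^sup>2 * (1 / sqrt 2)"
    proof -
      have "2 * \<mu> * (1 + w / 2) * c = 2 * \<mu> * c + \<mu> * w * c" for w c by (simp add: algebra_simps)
      then show ?thesis .
    qed
    then show ?thesis
      using \<open>2 * \<mu> * cosh v * (1 / sqrt 2) \<ge> 2 * \<mu> * (1 + v\<^sup>2 / 2) * (1 / sqrt 2)\<close> \<open>\<mu> * v\<^sup>2 * (1 / sqrt 2) \<ge> \<mu> * v\<^sup>2 * (1 / 2 + 1 / 8)\<close>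
      by simp
  qed
  moreover have "\<mu> * v\<^sup>2 \<ge> 0" using assms by simp
  ultimately have e: "- (2 * \<mu> * cosh v / sqrt 2) \<le> - (2 * \<mu> / sqrt 2) - \<mu> * v\<^sup>2 / 8 - \<mu> * v\<^sup>2 / 4" by (simp add: algebra_simps)
  have "exp (p * \<bar>v\<bar>) * exp (- (2 * \<mu> * cosh v / sqrt 2)) \<le> (exp (2 * p\<^sup>2) * exp (\<mu> * v\<^sup>2 / 8)) * exp (- (2 * \<mu> / sqrt 2) - \<mu> * v\<^sup>2 / 8 - \<mu> * v\<^sup>2 / 4)"
    using e exp_abs_le_gauss[OF assms] by (intro mult_mono) auto
  also have "\<dots> = exp (- (2 * \<mu> / sqrt 2)) * (exp (2 * p\<^sup>2) * exp (- (\<mu> * v\<^sup>2 / 4)))"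
    unfolding mult_exp_exp by (rule arg_cong[of _ _ exp]) simp
  finally show ?thesis .
qed

text \<open>On the Gaussian scale \<open>v^2\<close> is of order \<open>1 / \<mu>\<close>. The
  amplitude error is quadratic in \<open>v\<close>, the exponent error is \<open>\<mu>\<close> times
  a quartic, hence both are of order \<open>1 / \<mu>\<close>. An amplitude
  \<open>exp (a * v)\<close> would contribute a linear term and only
  \<open>1 / sqrt \<mu>\<close>.\<close>

lemma saddle_pointwise:
  fixes a \<mu> v :: real
  assumes \<mu>: "\<mu> \<ge> 1"
  shows "norm (of_real (cosh (a * v)) * exp (- (of_real (2 * \<mu> * cosh v) * wbar))
      - exp (- (of_real (2 * \<mu>) * wbar)) * exp (- (of_real \<mu> * wbar * of_real (v\<^sup>2))))
    \<le> exp (- (2 * \<mu> / sqrt 2)) * ((8 * a\<^sup>2 * exp (2 * a\<^sup>2) + 256 * exp 2) / \<mu>) * exp (- (\<mu> * v\<^sup>2 / 4))"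
proof -
  define h where "h = cosh v - 1 - v\<^sup>2 / 2"
  \<comment> \<open>Each error estimate uses \<open>exp y\<close> twice, once against an exponential
    in \<open>v\<close> and once to convert powers of \<open>v\<close> into powers of
    \<open>1 / \<mu>\<close>; \<open>B\<close> supplies the compensating
    \<open>exp (- (2 * y))\<close>.\<close>
  define y where "y = \<mu> * v\<^sup>2 / 8"
  have h: "h \<ge> 0" "h \<le> exp \<bar>v\<bar> * v ^ 4"
    using cosh_ge_quadratic[of v] cosh_minus_quadratic_le[of v] by (auto simp: h_def)
  have y: "y \<ge> 0" using \<mu> by (simp add: y_def)
  define E where "E = exp (- (of_real (2 * \<mu> * h) * wbar))"
  define B where "B = exp (- (of_real (2 * \<mu>) * wbar)) * exp (- (of_real \<mu> * wbar * of_real (v\<^sup>2)))"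
  have "exp (- (of_real (2 * \<mu> * cosh v) * wbar)) = B * E"
    unfolding B_def E_def mult_exp_exp by (rule arg_cong[of _ _ exp]) (simp add: h_def algebra_simps)
  then have "of_real (cosh (a * v)) * exp (- (of_real (2 * \<mu> * cosh v) * wbar)) - B = B * (of_real (cosh (a * v) - 1) * E + (E - 1))"
    by (simp add: algebra_simps)
  moreover have nB: "norm B = exp (- (2 * \<mu> / sqrt 2)) * exp (- (\<mu> * v\<^sup>2 / sqrt 2))"
    using norm_exp_wbar[of "2 * \<mu>"] norm_exp_wbar[of "\<mu> * v\<^sup>2"] by (simp add: B_def norm_mult mult_ac)
  moreover have nE: "norm E \<le> 1"
    unfolding E_def norm_exp_wbar using h \<mu> by simp
  moreover have nE1: "norm (E - 1) \<le> 2 * \<mu> * h"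
  proof -
    have "Re (of_real (2 * \<mu> * h) * wbar) \<ge> 0" using h \<mu> by (simp add: wbar_def cos_45)
    then have "norm (E - 1) \<le> norm (of_real (2 * \<mu> * h) * wbar)" unfolding E_def by (rule norm_exp_minus_one_le_right)
    also have "\<dots> = 2 * \<mu> * h" using h \<mu> by (simp add: norm_mult wbar_def)
    finally show ?thesis .
  qed
  ultimately have k1: "norm (of_real (cosh (a * v)) * exp (- (of_real (2 * \<mu> * cosh v) * wbar)) - B)
      \<le> norm B * (\<bar>cosh (a * v) - 1\<bar> * 1 + 2 * \<mu> * h)"
  proof -
    have "norm (of_real (cosh (a * v) - 1) * E + (E - 1)) \<le> norm (of_real (cosh (a * v) - 1) * E) + norm (E - 1)" by (rule norm_triangle_ineq)
    also have "\<dots> \<le> \<bar>cosh (a * v) - 1\<bar> * 1 + 2 * \<mu> * h"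
      unfolding norm_mult norm_of_real using nE nE1 by (intro add_mono mult_left_mono) auto
    finally show ?thesis
      using \<open>of_real (cosh (a * v)) * exp (- (of_real (2 * \<mu> * cosh v) * wbar)) - B = B * (of_real (cosh (a * v) - 1) * E + (E - 1))\<close>
      by (simp only: norm_mult mult_left_mono norm_ge_zero)
  qed
  have k2: "\<bar>cosh (a * v) - 1\<bar> * 1 + 2 * \<mu> * h \<le> (8 * a\<^sup>2 * exp (2 * a\<^sup>2) + 256 * exp 2) / \<mu> * exp (2 * y)"
  proof -
    have v2: "v\<^sup>2 \<le> 8 / \<mu> * exp y"
      using power_le_exp[OF y, of 1] \<mu> by (simp add: y_def field_simps)
    have "y\<^sup>2 \<le> 2 * exp y" using power_le_exp[OF y, of 2] by simp
    moreover have "64 * y\<^sup>2 = \<mu> * (\<mu> * v ^ 4)" by (simp add: y_def power2_eq_square eval_nat_numeral)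
    ultimately have "\<mu> * (\<mu> * v ^ 4) \<le> 128 * exp y" by linarith
    then have v4: "\<mu> * v ^ 4 \<le> 128 / \<mu> * exp y" using \<mu> by (simp add: field_simps)
    have e2y: "exp (2 * y) = exp y * exp y" unfolding mult_2 exp_add ..
    have e1: "exp \<bar>a * v\<bar> \<le> exp (2 * a\<^sup>2) * exp y"
      using exp_abs_le_gauss[OF \<mu>, of "\<bar>a\<bar>" v] unfolding y_def abs_mult power2_abs .
    have e2: "exp \<bar>v\<bar> \<le> exp 2 * exp y"
      using exp_abs_le_gauss[OF \<mu>, of 1 v] unfolding y_def by simp
    have "\<bar>cosh (a * v) - 1\<bar> \<le> exp \<bar>a * v\<bar> * (a * v)\<^sup>2" by (rule cosh_minus_one_le)
    also have "\<dots> = a\<^sup>2 * (exp \<bar>a * v\<bar> * v\<^sup>2)" by (simp add: power_mult_distrib)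
    also have "\<dots> \<le> a\<^sup>2 * ((exp (2 * a\<^sup>2) * exp y) * (8 / \<mu> * exp y))"
      using e1 v2 by (intro mult_left_mono mult_mono) auto
    also have "\<dots> = 8 * a\<^sup>2 * exp (2 * a\<^sup>2) / \<mu> * exp (2 * y)" by (simp add: e2y)
    finally have 1: "\<bar>cosh (a * v) - 1\<bar> \<le> 8 * a\<^sup>2 * exp (2 * a\<^sup>2) / \<mu> * exp (2 * y)" .
    have "2 * \<mu> * h \<le> 2 * \<mu> * (exp \<bar>v\<bar> * v ^ 4)" using h \<mu> by (intro mult_left_mono) auto
    also have "\<dots> = 2 * (exp \<bar>v\<bar> * (\<mu> * v ^ 4))" by simp
    also have "\<dots> \<le> 2 * ((exp 2 * exp y) * (128 / \<mu> * exp y))"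
    proof -
      have "0 \<le> \<mu> * v ^ 4" using \<mu> by simp
      then show ?thesis using e2 v4 by (intro mult_left_mono[OF mult_mono]) auto
    qed
    also have "\<dots> = 256 * exp 2 / \<mu> * exp (2 * y)" by (simp add: e2y)
    finally have "2 * \<mu> * h \<le> 256 * exp 2 / \<mu> * exp (2 * y)" .
    then show ?thesis using 1 by (simp add: add_divide_distrib distrib_right)
  qed
  have k3: "norm B \<le> exp (- (2 * \<mu> / sqrt 2)) * (exp (- (\<mu> * v\<^sup>2 / 4)) * exp (- (2 * y)))"
  proof -
    have "\<mu> * v\<^sup>2 * (1 / sqrt 2) \<ge> \<mu> * v\<^sup>2 * (1 / 2)"
    proof (rule mult_left_mono)
      show "1 / 2 \<le> 1 / sqrt (2::real)" using inverse_sqrt2_bounds by linarith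
    qed (use \<mu> in simp)
    then show ?thesis unfolding nB mult_exp_exp by (simp add: y_def)
  qed
  have "norm (of_real (cosh (a * v)) * exp (- (of_real (2 * \<mu> * cosh v) * wbar)) - B)
     \<le> exp (- (2 * \<mu> / sqrt 2)) * (exp (- (\<mu> * v\<^sup>2 / 4)) * exp (- (2 * y))) * ((8 * a\<^sup>2 * exp (2 * a\<^sup>2) + 256 * exp 2) / \<mu> * exp (2 * y))"
    by (rule order_trans[OF k1 mult_mono[OF k3 k2]]) (use \<mu> h in \<open>auto intro!: add_nonneg_nonneg\<close>)
  also have "\<dots> = exp (- (2 * \<mu> / sqrt 2)) * ((8 * a\<^sup>2 * exp (2 * a\<^sup>2) + 256 * exp 2) / \<mu>) * exp (- (\<mu> * v\<^sup>2 / 4)) * (exp (- (2 * y)) * exp (2 * y))"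
    by (simp only: mult_ac)
  finally show ?thesis by (simp add: B_def exp_minus_inverse mult_exp_exp)
qed

lemma lborel_integral_shift:
  fixes f :: "real \<Rightarrow> complex"
  shows "(LINT u|lborel. f u) = (LINT v|lborel. f (c + v))"
  using lborel_integral_real_affine[of 1 f c] by simp

lemma borel_measurable_continuous: "continuous_on UNIV f \<Longrightarrow> f \<in> borel_measurable lborel"
  using borel_measurable_continuous_onI[of f] by simp

text \<open>The constant \<open>g\<close> precedes \<open>a\<close> because the amplitude has the
  value 1 at the saddle \<open>v = 0\<close>. The odd part of \<open>exp (a * v)\<close> integrates
  to 0 against the even exponential, which secures the error \<open>1 / \<mu>\<close>.\<close>

lemma saddle_integral:
  "\<exists>g>0. \<forall>a::real. \<exists>C>0. \<forall>\<mu>\<ge>1.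
     integrable lborel (\<lambda>v::real. of_real (exp (a * v)) * exp (- (of_real (2 * \<mu> * cosh v) * wbar))) \<and>
     norm ((LINT v|lborel. of_real (exp (a * v)) * exp (- (of_real (2 * \<mu> * cosh v) * wbar)))
        - exp (- (of_real (2 * \<mu>) * wbar)) * (of_real (g / sqrt \<mu>) * cis (pi / 8)))
     \<le> C / \<mu> * (exp (- (2 * \<mu> / sqrt 2)) / sqrt \<mu>)"
proof -
  obtain g where g: "g > 0" "\<And>r. r > 0 \<Longrightarrow> has_bochner_integral lborel (\<lambda>v::real. exp (- (of_real r * wbar * of_real (v\<^sup>2)))) (of_real (g / sqrt r) * cis (pi / 8))"
    using gaussian_ray unfolding wbar_def by blast
  obtain q where q: "q > 0" "\<And>r. r > 0 \<Longrightarrow> has_bochner_integral lborel (\<lambda>v::real. exp (- (r * v\<^sup>2 / 4))) (q / sqrt r)"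
    using gaussian_real_quarter by blast
  show ?thesis
  proof (rule exI[of _ g], rule conjI[OF g(1)], rule allI)
    fix a :: real
    define K where "K = 8 * a\<^sup>2 * exp (2 * a\<^sup>2) + 256 * exp 2"
    have K: "K > 0" unfolding K_def by (intro add_nonneg_pos) auto
    show "\<exists>C>0. \<forall>\<mu>\<ge>1.
     integrable lborel (\<lambda>v::real. of_real (exp (a * v)) * exp (- (of_real (2 * \<mu> * cosh v) * wbar))) \<and>
     norm ((LINT v|lborel. of_real (exp (a * v)) * exp (- (of_real (2 * \<mu> * cosh v) * wbar)))
        - exp (- (of_real (2 * \<mu>) * wbar)) * (of_real (g / sqrt \<mu>) * cis (pi / 8)))
     \<le> C / \<mu> * (exp (- (2 * \<mu> / sqrt 2)) / sqrt \<mu>)"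
    proof (rule exI[of _ "K * q"], rule conjI, use K q in simp, intro allI impI)
      fix \<mu> :: real assume \<mu>: "\<mu> \<ge> 1"
      then have \<mu>0: "\<mu> > 0" by simp
      define f where "f v = of_real (exp (a * v)) * exp (- (of_real (2 * \<mu> * cosh v) * wbar))" for v
      define h where "h v = of_real (cosh (a * v)) * exp (- (of_real (2 * \<mu> * cosh v) * wbar))" for v
      define b where "b v = exp (- (of_real (2 * \<mu>) * wbar)) * exp (- (of_real \<mu> * wbar * of_real (v\<^sup>2)))" for v :: real
      have cf: "continuous_on UNIV f" unfolding f_def by (intro continuous_intros)
      have fi: "integrable lborel f"
      proof (rule Bochner_Integration.integrable_bound)
        show "integrable lborel (\<lambda>v. exp (- (2 * \<mu> / sqrt 2)) * exp (2 * a\<^sup>2) * exp (- (\<mu> * v\<^sup>2 / 4)))"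
          using q(2)[OF \<mu>0] by (simp add: has_bochner_integral_iff)
        show "f \<in> borel_measurable lborel" using cf by (rule borel_measurable_continuous)
        show "AE v in lborel. norm (f v) \<le> norm (exp (- (2 * \<mu> / sqrt 2)) * exp (2 * a\<^sup>2) * exp (- (\<mu> * v\<^sup>2 / 4)))"
        proof (rule AE_I2)
          fix v
          have "norm (f v) = exp (a * v) * exp (- (2 * \<mu> * cosh v / sqrt 2))"
            unfolding f_def norm_mult norm_exp_wbar by simp
          also have "\<dots> \<le> exp (\<bar>a\<bar> * \<bar>v\<bar>) * exp (- (2 * \<mu> * cosh v / sqrt 2))"
            by (intro mult_right_mono) (auto simp flip: abs_mult)
          also have "\<dots> \<le> exp (- (2 * \<mu> / sqrt 2)) * (exp (2 * \<bar>a\<bar>\<^sup>2) * exp (- (\<mu> * v\<^sup>2 / 4)))"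
            by (rule exp_cosh_gauss[OF \<mu>])
          finally show "norm (f v) \<le> norm (exp (- (2 * \<mu> / sqrt 2)) * exp (2 * a\<^sup>2) * exp (- (\<mu> * v\<^sup>2 / 4)))"
            by (simp add: abs_mult)
        qed
      qed
      have fi': "integrable lborel (\<lambda>v. f (- v))"
        using lborel_integrable_real_affine[OF fi, of "-1" 0] by simp
      have refl: "(LINT v|lborel. f v) = (LINT v|lborel. f (- v))"
        using lborel_integral_real_affine[of "-1" f 0] by simp
      \<comment> \<open>Averaging with the reflection replaces \<open>exp (a * v)\<close> by
        \<open>cosh (a * v)\<close> and keeps the integral.\<close>
      have hf: "h = (\<lambda>v. (f v + f (- v)) / 2)"
        by (rule ext) (simp add: h_def f_def cosh_def scaleR_conv_of_real field_simps)
      have hi: "integrable lborel h" unfolding hf using fi fi' by simp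
      have hI: "(LINT v|lborel. h v) = (LINT v|lborel. f v)"
        unfolding hf using fi fi' refl by simp
      have bi: "has_bochner_integral lborel b (exp (- (of_real (2 * \<mu>) * wbar)) * (of_real (g / sqrt \<mu>) * cis (pi / 8)))"
        unfolding b_def by (rule has_bochner_integral_mult_right[OF g(2)[OF \<mu>0]])
      have "norm (LINT v|lborel. h v - b v) \<le> (LINT v|lborel. exp (- (2 * \<mu> / sqrt 2)) * (K / \<mu>) * exp (- (\<mu> * v\<^sup>2 / 4)))"
      proof (rule Bochner_Integration.integral_norm_bound_integral)
        show "integrable lborel (\<lambda>v. h v - b v)" using hi bi by (simp add: has_bochner_integral_iff)
        show "integrable lborel (\<lambda>v. exp (- (2 * \<mu> / sqrt 2)) * (K / \<mu>) * exp (- (\<mu> * v\<^sup>2 / 4)))"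
          using q(2)[OF \<mu>0] by (simp add: has_bochner_integral_iff)
        show "norm (h v - b v) \<le> exp (- (2 * \<mu> / sqrt 2)) * (K / \<mu>) * exp (- (\<mu> * v\<^sup>2 / 4))" for v
          unfolding h_def b_def K_def by (rule saddle_pointwise[OF \<mu>])
      qed
      also have "\<dots> = exp (- (2 * \<mu> / sqrt 2)) * (K / \<mu>) * (q / sqrt \<mu>)"
        using q(2)[OF \<mu>0] by (simp add: has_bochner_integral_iff)
      finally have "norm ((LINT v|lborel. h v) - (LINT v|lborel. b v)) \<le> K * q / \<mu> * (exp (- (2 * \<mu> / sqrt 2)) / sqrt \<mu>)"
        using hi bi by (simp add: has_bochner_integral_iff mult_ac)
      then show "integrable lborel (\<lambda>v::real. of_real (exp (a * v)) * exp (- (of_real (2 * \<mu> * cosh v) * wbar))) \<and>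
         norm ((LINT v|lborel. of_real (exp (a * v)) * exp (- (of_real (2 * \<mu> * cosh v) * wbar)))
            - exp (- (of_real (2 * \<mu>) * wbar)) * (of_real (g / sqrt \<mu>) * cis (pi / 8)))
         \<le> K * q / \<mu> * (exp (- (2 * \<mu> / sqrt 2)) / sqrt \<mu>)"
        using fi bi hI unfolding f_def[symmetric] has_bochner_integral_iff by (metis f_def[abs_def])
    qed
  qed
qed

text \<open>\<open>1 / (1 - e) = 1 + e / (1 - e)\<close>, where the factor \<open>e\<close> shifts the frequency by \<open>2 * pi\<close>.\<close>

lemma ap_fun_split:
  "ap_fun G \<alpha> \<theta> u = exp (- (\<i> * of_real (\<theta> * \<alpha>))) * (ray u * G (ray u) * exp (\<i> * of_real \<theta> * ray u)) + ap_fun G \<alpha> (\<theta> + 2 * pi) u"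
proof -
  define E where "E = exp (\<i> * of_real \<theta> * (ray u - of_real \<alpha>))"
  define e where "e = e2pi (ray u - of_real \<alpha>)"
  have ne: "1 - e \<noteq> 0" unfolding e_def by (rule norm_one_minus_e2pi_ray(2))
  have 1: "exp (\<i> * of_real (\<theta> + 2 * pi) * (ray u - of_real \<alpha>)) = E * e"
    by (simp add: E_def e_def e2pi_def mult_exp_exp algebra_simps)
  have 2: "exp (- (\<i> * of_real (\<theta> * \<alpha>))) * exp (\<i> * of_real \<theta> * ray u) = E"
    by (simp add: E_def mult_exp_exp algebra_simps)
  have "E / (1 - e) = E + E * e / (1 - e)" using ne by (simp add: field_simps)
  then have "ray u * G (ray u) * (E / (1 - e)) = ray u * G (ray u) * (E + E * e / (1 - e))" by simp
  then show ?thesis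
    unfolding ap_fun_def 1 e_def[symmetric] E_def[symmetric] 2[symmetric]
    by (simp add: 2 algebra_simps)
qed

section \<open>The summand at scale \<open>t\<close>: ray integrals, their size and their main
  term\<close>

lemma abel_plana_Fk:
  assumes "k \<ge> 1" "t > 0" "0 < \<alpha>" "\<alpha> \<le> 1"
  shows "\<exists>C. abel_plana (\<lambda>x. Fk k (of_real t * x)) C \<alpha>"
proof -
  have "(0::real) < real k * pi\<^sup>2 / 6" using assms by simp
  then obtain C where C: "C > 0" "\<And>x. x \<in> sector - {0} \<Longrightarrow> norm (Fk k x) * (1 + norm x) \<le>
     C * exp (- (0 / (sqrt 2 * norm x))) * min ((norm x)\<^sup>2) (1 / (norm x)\<^sup>2)"
    using norm_Fk_crude[OF assms(1), of 0] by blast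
  \<comment> \<open>The constant blows up as \<open>t\<close> tends to 0, harmlessly: the locale is
    applied for one fixed \<open>t\<close> at a time, and uniform bounds are derived
    separately.\<close>
  have "abel_plana (\<lambda>x. Fk k (of_real t * x)) (C * (t\<^sup>2 + 1 / t\<^sup>2)) \<alpha>"
  proof
    have "(Fk k \<circ> (\<lambda>x. of_real t * x)) holomorphic_on {x. Re x > 0}"
      by (rule holomorphic_on_compose_gen[OF _ holomorphic_Fk]) (use assms in \<open>auto intro!: holomorphic_intros\<close>)
    then show "(\<lambda>x. Fk k (of_real t * x)) holomorphic_on {x. Re x > 0}" by (simp add: o_def)
    show "Fk k (of_real t * cnj x) = cnj (Fk k (of_real t * x))" if "Re x > 0" for x
      using Fk_cnj[of "of_real t * x" k] that assms by simp
    show "Fk k (of_real t * x) \<noteq> 0" if "Re x > 0" for x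
      using Fk_eq[of "of_real t * x" k] that assms by simp
    fix x assume x: "x \<in> sector - {0}"
    define n where "n = norm x"
    have n: "n > 0" using x by (simp add: n_def)
    have tx: "of_real t * x \<in> sector - {0}" using x assms scaleR_sector[of x t] by auto
    have nt: "norm (of_real t * x) = t * n" using assms by (simp add: n_def norm_mult)
    have "norm (Fk k (of_real t * x)) * 1 \<le> norm (Fk k (of_real t * x)) * (1 + norm (of_real t * x))"
      by (intro mult_left_mono) auto
    also have "\<dots> \<le> C * min ((t * n)\<^sup>2) (1 / (t * n)\<^sup>2)" using C(2)[OF tx] unfolding nt by simp
    also have "\<dots> \<le> C * ((t\<^sup>2 + 1 / t\<^sup>2) * min (n\<^sup>2) (1 / n\<^sup>2))"
    proof (intro mult_left_mono)
      have "min ((t * n)\<^sup>2) (1 / (t * n)\<^sup>2) \<le> t\<^sup>2 * n\<^sup>2" "min ((t * n)\<^sup>2) (1 / (t * n)\<^sup>2) \<le> 1 / t\<^sup>2 * (1 / n\<^sup>2)"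
        by (auto simp: power_mult_distrib)
      moreover have "t\<^sup>2 * n\<^sup>2 \<le> (t\<^sup>2 + 1 / t\<^sup>2) * n\<^sup>2" "1 / t\<^sup>2 * (1 / n\<^sup>2) \<le> (t\<^sup>2 + 1 / t\<^sup>2) * (1 / n\<^sup>2)"
        by (intro mult_right_mono; simp)+
      ultimately show "min ((t * n)\<^sup>2) (1 / (t * n)\<^sup>2) \<le> (t\<^sup>2 + 1 / t\<^sup>2) * min (n\<^sup>2) (1 / n\<^sup>2)"
        by (cases "n\<^sup>2 \<le> 1 / n\<^sup>2") (auto simp: min_def intro: order_trans)
    qed (use C in auto)
    finally show "norm (Fk k (of_real t * x)) \<le> C * (t\<^sup>2 + 1 / t\<^sup>2) * min ((norm x)\<^sup>2) (1 / (norm x)\<^sup>2)"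
      by (simp add: n_def mult.assoc)
  qed (use assms in auto)
  then show ?thesis by blast
qed

definition ap_int :: "nat \<Rightarrow> real \<Rightarrow> real \<Rightarrow> real \<Rightarrow> complex" where
  "ap_int k t \<alpha> \<theta> = (LINT u|lborel. ap_fun (\<lambda>x. Fk k (of_real t * x)) \<alpha> \<theta> u)"

text \<open>What is left of \<open>ap_fun\<close> after replacing the denominator by 1 and factoring
  out the phase that carries \<open>\<alpha>\<close>; the same function thus governs numerators and
  denominators.\<close>

definition ray_fun :: "nat \<Rightarrow> real \<Rightarrow> real \<Rightarrow> real \<Rightarrow> complex" where
  "ray_fun k t \<theta> u = ray u * Fk k (of_real t * ray u) * exp (\<i> * of_real \<theta> * ray u)"

definition ray_int :: "nat \<Rightarrow> real \<Rightarrow> real \<Rightarrow> complex" where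
  "ray_int k t \<theta> = (LINT u|lborel. ray_fun k t \<theta> u)"

lemma ap_int_split:
  assumes "k \<ge> 1" "t > 0" "0 < \<alpha>" "\<alpha> \<le> 1" "\<theta> \<ge> 0"
  shows "integrable lborel (ray_fun k t \<theta>)"
    and "ap_int k t \<alpha> \<theta> = exp (- (\<i> * of_real (\<theta> * \<alpha>))) * ray_int k t \<theta> + ap_int k t \<alpha> (\<theta> + 2 * pi)"
proof -
  obtain C where "abel_plana (\<lambda>x. Fk k (of_real t * x)) C \<alpha>" using abel_plana_Fk[OF assms(1-4)] by blast
  then interpret abel_plana "\<lambda>x. Fk k (of_real t * x)" C \<alpha> .
  have i: "integrable lborel (ap_fun (\<lambda>x. Fk k (of_real t * x)) \<alpha> \<theta>)" "integrable lborel (ap_fun (\<lambda>x. Fk k (of_real t * x)) \<alpha> (\<theta> + 2 * pi))"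
    using assms by (auto intro!: integrable_ap_fun)
  define e where "e = exp (- (\<i> * of_real (\<theta> * \<alpha>)))"
  have s: "ap_fun (\<lambda>x. Fk k (of_real t * x)) \<alpha> \<theta> u = e * ray_fun k t \<theta> u + ap_fun (\<lambda>x. Fk k (of_real t * x)) \<alpha> (\<theta> + 2 * pi) u" for u
    unfolding ray_fun_def e_def by (rule ap_fun_split)
  have "ray_fun k t \<theta> = (\<lambda>u. 1 / e * (ap_fun (\<lambda>x. Fk k (of_real t * x)) \<alpha> \<theta> u - ap_fun (\<lambda>x. Fk k (of_real t * x)) \<alpha> (\<theta> + 2 * pi) u))"
    unfolding s by (rule ext) (simp add: e_def)
  then show J: "integrable lborel (ray_fun k t \<theta>)" using i by simp
  show "ap_int k t \<alpha> \<theta> = exp (- (\<i> * of_real (\<theta> * \<alpha>))) * ray_int k t \<theta> + ap_int k t \<alpha> (\<theta> + 2 * pi)"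
    unfolding ap_int_def ray_int_def e_def[symmetric] s[abs_def] using i J by simp
qed

lemma Fk_sums:
  assumes "k \<ge> 1" "t > 0" "0 < \<alpha>" "\<alpha> \<le> 1" "0 \<le> \<theta>" "\<theta> \<le> 2 * pi"
  shows "(\<lambda>m. exp (\<i> * of_real \<theta> * of_nat m) * Fk k (of_real (t * (real m + \<alpha>)))) sums (ap_int k t \<alpha> \<theta> + cnj (ap_int k t \<alpha> (2 * pi - \<theta>)))"
proof -
  obtain C where "abel_plana (\<lambda>x. Fk k (of_real t * x)) C \<alpha>" using abel_plana_Fk[OF assms(1-4)] by blast
  then interpret abel_plana "\<lambda>x. Fk k (of_real t * x)" C \<alpha> .
  show ?thesis using abel_plana_sums[OF assms(5,6)] unfolding ap_int_def by simp
qed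

text \<open>The inequality of arithmetic and geometric means for the two decay exponents gives the
  exponential order without locating the saddle. The remaining integral of
  \<open>exp (- \<bar>ln t + u\<bar>)\<close> does not depend on \<open>t\<close>, by
  translation.\<close>

lemma ap_int_bound:
  assumes "k \<ge> 1" "0 \<le> A'" "A' < real k * pi\<^sup>2 / 6"
  shows "\<exists>C>0. \<forall>t \<alpha> \<theta>. 0 < t \<and> t \<le> 1 \<and> 0 < \<alpha> \<and> \<alpha> \<le> 1 \<and> 0 \<le> \<theta> \<longrightarrow>
     norm (ap_int k t \<alpha> \<theta>) \<le> C / t * exp (- sqrt (2 * A' * \<theta> / t))"
proof -
  obtain C where C: "C > 0" "\<And>x. x \<in> sector - {0} \<Longrightarrow> norm (Fk k x) * (1 + norm x) \<le>
     C * exp (- (A' / (sqrt 2 * norm x))) * min ((norm x)\<^sup>2) (1 / (norm x)\<^sup>2)"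
    using norm_Fk_crude[OF assms] by blast
  define Q where "Q = (LINT u|lborel. exp (- \<bar>u :: real\<bar>))"
  have Q: "Q \<ge> 0" unfolding Q_def by (intro Bochner_Integration.integral_nonneg) auto
  have "norm (ap_int k t \<alpha> \<theta>) \<le> C * (Q + 1) / t * exp (- sqrt (2 * A' * \<theta> / t))"
    if h: "0 < t" "t \<le> 1" "0 < \<alpha>" "\<alpha> \<le> 1" "0 \<le> \<theta>" for t \<alpha> \<theta>
  proof -
    obtain C' where "abel_plana (\<lambda>x. Fk k (of_real t * x)) C' \<alpha>" using abel_plana_Fk[OF assms(1) h(1,3,4)] by blast
    then interpret abel_plana "\<lambda>x. Fk k (of_real t * x)" C' \<alpha> .
    define D where "D = C / t * exp (- sqrt (2 * A' * \<theta> / t))"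
    have D: "D \<ge> 0" using C h by (simp add: D_def)
    have ie: "integrable lborel (\<lambda>u::real. exp (- \<bar>ln t + u\<bar>))"
      using lborel_integrable_real_affine[OF integrable_exp_minus_abs, of 1 "ln t"] by simp
    have Ie: "(LINT u|lborel. exp (- \<bar>ln t + u\<bar>)) = Q"
      unfolding Q_def using lborel_integral_real_affine[of 1 "\<lambda>u. exp (- \<bar>u\<bar>) :: real" "ln t"] by simp
    have "norm (ap_int k t \<alpha> \<theta>) \<le> (LINT u|lborel. D * exp (- \<bar>ln t + u\<bar>))"
      unfolding ap_int_def
    proof (rule Bochner_Integration.integral_norm_bound_integral)
      show "integrable lborel (ap_fun (\<lambda>x. Fk k (of_real t * x)) \<alpha> \<theta>)" using h by (intro integrable_ap_fun)
      show "integrable lborel (\<lambda>u. D * exp (- \<bar>ln t + u\<bar>))" using ie by simp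
      fix u :: real
      define s where "s = t * exp u"
      have s: "s > 0" using h by (simp add: s_def)
      have sec: "of_real t * ray u \<in> sector - {0}" using ray_sector[of u] scaleR_sector[of "ray u" t] h by auto
      have ns: "norm (of_real t * ray u) = s" using h by (simp add: s_def norm_mult)
      have lns: "ln s = ln t + u" using h by (simp add: s_def ln_mult)
      have m: "min (s\<^sup>2) (1 / s\<^sup>2) \<le> exp (- \<bar>ln t + u\<bar>)"
      proof (cases "s \<le> 1")
        case True
        then have "\<bar>ln s\<bar> = - ln s" using s by simp
        then have "exp (- \<bar>ln t + u\<bar>) = s" using s by (simp add: lns[symmetric])
        moreover have "s\<^sup>2 \<le> s" using s True by (simp add: power2_eq_square mult_left_le)
        ultimately show ?thesis by linarith
      next
        case False
        then have "\<bar>ln s\<bar> = ln s" using s by simp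
        then have "exp (- \<bar>ln t + u\<bar>) = 1 / s" using s by (simp add: lns[symmetric] exp_minus inverse_eq_divide)
        moreover have "1 / s\<^sup>2 \<le> 1 / s" using s False by (intro divide_left_mono) (auto simp: power2_eq_square)
        ultimately show ?thesis by linarith
      qed
      have am: "sqrt (2 * A' * \<theta> / t) \<le> A' / (sqrt 2 * s) + \<theta> * exp u / sqrt 2"
      proof -
        define x y where "x = A' / (sqrt 2 * s)" and "y = \<theta> * exp u / sqrt 2"
        have xy: "x \<ge> 0" "y \<ge> 0" using s assms h by (auto simp: x_def y_def)
        have "4 * (x * y) = 2 * A' * \<theta> / t"
        proof -
          have "x * y = A' * (\<theta> * exp u) / ((sqrt 2 * sqrt 2) * s)"
            unfolding x_def y_def times_divide_times_eq by (simp only: mult_ac)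
          also have "\<dots> = A' * \<theta> / (2 * t)" using h by (simp add: s_def)
          finally show ?thesis by simp
        qed
        moreover have "4 * (x * y) \<le> (x + y)\<^sup>2" using zero_le_power2[of "x - y"] by (simp add: power2_eq_square algebra_simps)
        ultimately have "2 * A' * \<theta> / t \<le> (x + y)\<^sup>2" by simp
        then have "sqrt (2 * A' * \<theta> / t) \<le> x + y" using xy by (intro real_le_lsqrt) auto
        then show ?thesis by (simp add: x_def y_def)
      qed
      have "norm (ap_fun (\<lambda>x. Fk k (of_real t * x)) \<alpha> \<theta> u) \<le> (1 + exp u) * norm (Fk k (of_real t * ray u)) * exp (- (\<theta> * exp u / sqrt 2))"
        by (rule norm_ap_fun_le)
      \<comment> \<open>Since \<open>t <= 1\<close>, \<open>1 + exp u\<close> is at most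
        \<open>(1 + s) / t\<close>; the factor \<open>1 + s\<close> is the one built into the crude
        bound for \<open>Fk\<close>.\<close>
      also have "\<dots> \<le> 1 / t * (1 + s) * norm (Fk k (of_real t * ray u)) * exp (- (\<theta> * exp u / sqrt 2))"
        using h by (intro mult_right_mono) (auto simp: s_def field_simps)
      also have "\<dots> \<le> 1 / t * (C * exp (- (A' / (sqrt 2 * s))) * min (s\<^sup>2) (1 / s\<^sup>2)) * exp (- (\<theta> * exp u / sqrt 2))"
      proof -
        have "norm (Fk k (of_real t * ray u)) * (1 + s) \<le> C * exp (- (A' / (sqrt 2 * s))) * min (s\<^sup>2) (1 / s\<^sup>2)"
          using C(2)[OF sec] unfolding ns .
        then have "(1 / t * exp (- (\<theta> * exp u / sqrt 2))) * (norm (Fk k (of_real t * ray u)) * (1 + s))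
          \<le> (1 / t * exp (- (\<theta> * exp u / sqrt 2))) * (C * exp (- (A' / (sqrt 2 * s))) * min (s\<^sup>2) (1 / s\<^sup>2))"
          using h by (intro mult_left_mono) auto
        then show ?thesis by (simp only: mult_ac)
      qed
      also have "\<dots> = C / t * exp (- (A' / (sqrt 2 * s) + \<theta> * exp u / sqrt 2)) * min (s\<^sup>2) (1 / s\<^sup>2)"
        unfolding minus_add_distrib exp_add by simp
      also have "\<dots> \<le> C / t * exp (- sqrt (2 * A' * \<theta> / t)) * exp (- \<bar>ln t + u\<bar>)"
        using am m C h by (intro mult_mono mult_left_mono) auto
      finally show "norm (ap_fun (\<lambda>x. Fk k (of_real t * x)) \<alpha> \<theta> u) \<le> D * exp (- \<bar>ln t + u\<bar>)" by (simp add: D_def)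
    qed
    also have "\<dots> = D * Q" using Ie by simp
    also have "\<dots> \<le> D * (Q + 1)" using D by (intro mult_left_mono) auto
    finally show ?thesis by (simp add: D_def mult_ac)
  qed
  then show ?thesis using C Q by (intro exI[of _ "C * (Q + 1)"]) auto
qed

lemma ray_eq: "ray v = exp (of_real v + \<i> * of_real (pi / 4))"
  unfolding ray_def by (rule arg_cong[of _ _ exp]) (simp add: complex_eq_iff)

text \<open>The hypothesis says that \<open>s0\<close> is the radius where both exponents have
  weight \<open>\<mu>\<close>, so that \<open>exp v + exp (- v)\<close> combines to
  \<open>2 * cosh v\<close>. In \<open>1 - k / 2\<close> the 1 comes from the Jacobian and
  \<open>- k / 2\<close> from the power of \<open>x\<close>; it shows up both in the amplitude and
  in the phase.\<close>

lemma Gk_ray: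
  assumes s0: "s0 > 0" and \<mu>: "real k * pi\<^sup>2 / 6 = \<mu> * s0"
  shows "ray v * Gk k (of_real s0 * ray v) * exp (\<i> * of_real \<mu> * ray v) =
    of_real (exp (- (real k / 2 * ln s0))) * cis ((1 - real k / 2) * (pi / 4)) *
      (of_real (exp ((1 - real k / 2) * v)) * exp (- (of_real (2 * \<mu> * cosh v) * wbar)))"
proof -
  define z where "z = complex_of_real v + \<i> * of_real (pi / 4)"
  have ray: "ray v = exp z" by (simp only: ray_eq z_def)
  have Ln: "Ln (of_real s0 * ray v) = of_real (ln s0) + z"
  proof -
    have "of_real s0 * ray v = exp (of_real (ln s0) + z)"
      unfolding ray exp_add exp_of_real using s0 by simp
    moreover have "Ln (exp (of_real (ln s0) + z)) = of_real (ln s0) + z"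
    proof -
      have "Im (of_real (ln s0) + z) = pi / 4" by (simp add: z_def)
      then show ?thesis using pi_gt_zero by (intro Ln_exp) linarith+
    qed
    ultimately show ?thesis by simp
  qed
  have w: "exp (- z) = of_real (exp (- v)) * wbar"
  proof -
    have "- z = of_real (- v) + \<i> * of_real (- (pi / 4))" by (simp add: z_def)
    then show ?thesis by (simp only: exp_add exp_of_real wbar_def cis_conv_exp)
  qed
  have iw: "\<i> * exp z = - (of_real (exp v) * wbar)"
    unfolding z_def exp_add exp_of_real cis_conv_exp[symmetric]
    by (simp add: wbar_def complex_eq_iff cos_45 sin_45)
  have "of_real (real k * pi\<^sup>2 / 6) / (of_real s0 * ray v) = of_real \<mu> * exp (- z)"
    unfolding \<mu> ray exp_minus using s0 by (simp add: field_simps)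
  then have G: "Gk k (of_real s0 * ray v) = exp (- (of_nat k / 2 * (of_real (ln s0) + z)) - of_real \<mu> * (of_real (exp (- v)) * wbar))"
    unfolding Gk_def Ln w by simp
  have X: "exp (\<i> * of_real \<mu> * ray v) = exp (- (of_real \<mu> * (of_real (exp v) * wbar)))"
  proof -
    have "\<i> * of_real \<mu> * ray v = of_real \<mu> * (\<i> * exp z)" by (simp add: ray)
    then show ?thesis unfolding iw by simp
  qed
  have "ray v * Gk k (of_real s0 * ray v) * exp (\<i> * of_real \<mu> * ray v) =
     exp (z + (- (of_nat k / 2 * (of_real (ln s0) + z)) - of_real \<mu> * (of_real (exp (- v)) * wbar)) + - (of_real \<mu> * (of_real (exp v) * wbar)))"
    unfolding G X exp_add[of _ "- (of_real \<mu> * (of_real (exp v) * wbar))"] exp_add[of z] by (simp only: ray)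
  also have "z + (- (of_nat k / 2 * (of_real (ln s0) + z)) - of_real \<mu> * (of_real (exp (- v)) * wbar)) + - (of_real \<mu> * (of_real (exp v) * wbar))
    = (of_real (- (real k / 2 * ln s0)) + \<i> * of_real ((1 - real k / 2) * (pi / 4))) + (of_real ((1 - real k / 2) * v) + - (of_real (2 * \<mu> * cosh v) * wbar))"
    by (simp add: z_def cosh_def scaleR_conv_of_real algebra_simps)
  also have "exp \<dots> = of_real (exp (- (real k / 2 * ln s0))) * cis ((1 - real k / 2) * (pi / 4)) *
      (of_real (exp ((1 - real k / 2) * v)) * exp (- (of_real (2 * \<mu> * cosh v) * wbar)))"
    by (simp only: exp_add exp_of_real cis_conv_exp)
  finally show ?thesis .
qed

text \<open>The amplitude \<open>Am\<close> is left unspecified because it will cancel in quotients;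
  only its positivity, its exponential order and the phase beside it matter later.\<close>

lemma ray_int_asymp:
  assumes k: "k \<ge> 1" and \<theta>: "\<theta> > 0"
  shows "\<exists>Am t0 C c. 0 < t0 \<and> t0 \<le> 1 \<and> C > 0 \<and> c > (0::real) \<and>
     (\<forall>t. 0 < t \<and> t \<le> t0 \<longrightarrow>
        c * exp (- sqrt (2 * (real k * pi\<^sup>2 / 6) * \<theta> / t)) \<le> Am t \<and>
        norm (ray_int k t \<theta> - of_real (Am t) * cis (sqrt (2 * (real k * pi\<^sup>2 / 6) * \<theta> / t) - (real k - 3) * pi / 8)) \<le> C * sqrt t * Am t)"
proof -
  define A where "A = real k * pi\<^sup>2 / 6"
  have A: "A > 0" using k by (simp add: A_def)
  define a where "a = 1 - real k / 2"
  obtain \<kappa> CF where \<kappa>: "\<kappa> > 0" "CF > 0" and asy: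
    "\<forall>x\<in>sector - {0}. norm (Fk k x - of_real \<kappa> * Gk k x) \<le> CF * norm x * (1 + norm x) ^ k * norm (Gk k x)"
    using Fk_asymp by blast
  obtain g where g: "g > 0" and sad: "\<forall>a::real. \<exists>C>0. \<forall>\<mu>\<ge>1.
     integrable lborel (\<lambda>v::real. of_real (exp (a * v)) * exp (- (of_real (2 * \<mu> * cosh v) * wbar))) \<and>
     norm ((LINT v|lborel. of_real (exp (a * v)) * exp (- (of_real (2 * \<mu> * cosh v) * wbar)))
        - exp (- (of_real (2 * \<mu>) * wbar)) * (of_real (g / sqrt \<mu>) * cis (pi / 8)))
     \<le> C / \<mu> * (exp (- (2 * \<mu> / sqrt 2)) / sqrt \<mu>)"
    using saddle_integral by blast
  obtain Cs where Cs: "Cs > 0" "\<And>\<mu>. \<mu> \<ge> 1 \<Longrightarrow>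
     integrable lborel (\<lambda>v::real. of_real (exp (a * v)) * exp (- (of_real (2 * \<mu> * cosh v) * wbar)))"
     "\<And>\<mu>. \<mu> \<ge> 1 \<Longrightarrow> norm ((LINT v|lborel. of_real (exp (a * v)) * exp (- (of_real (2 * \<mu> * cosh v) * wbar)))
        - exp (- (of_real (2 * \<mu>) * wbar)) * (of_real (g / sqrt \<mu>) * cis (pi / 8)))
     \<le> Cs / \<mu> * (exp (- (2 * \<mu> / sqrt 2)) / sqrt \<mu>)"
    using sad by blast
  obtain q where q: "q > 0" "\<And>r. r > 0 \<Longrightarrow> has_bochner_integral lborel (\<lambda>v::real. exp (- (r * v\<^sup>2 / 4))) (q / sqrt r)"
    using gaussian_real_quarter by blast
  define p where "p = real k + 1 + \<bar>a\<bar>"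
  define Kr where "Kr = CF / \<kappa> * 2 ^ k * exp (2 * p\<^sup>2)"
  have Kr: "Kr > 0" using \<kappa> by (simp add: Kr_def)
  \<comment> \<open>The entries \<open>\<theta> / A\<close> and \<open>A * \<theta>\<close>
    guarantee \<open>s0 t <= 1\<close> and \<open>\<mu> t >= 1\<close>.\<close>
  define t0 where "t0 = min 1 (min (\<theta> / A) (A * \<theta>))"
  \<comment> \<open>Balancing \<open>A / (t * r)\<close> against \<open>\<theta> * r\<close> puts
    the saddle at modulus \<open>r = s0 t / t\<close>; both expressions equal \<open>\<mu> t\<close>
    there.\<close>
  define s0 where "s0 t = sqrt (A * t / \<theta>)" for t
  define \<mu> where "\<mu> t = sqrt (A * \<theta> / t)" for t
  define K1 where "K1 t = s0 t / t * \<kappa> * exp (- (real k / 2 * ln (s0 t)))" for t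
  define N where "N t = exp (- (2 * \<mu> t / sqrt 2)) / sqrt (\<mu> t)" for t
  define Am where "Am t = K1 t * g * N t" for t
  \<comment> \<open>The first summand is the saddle point error of relative size
    \<open>1 / \<mu> t\<close>, the second the error of replacing \<open>Fk\<close> by
    \<open>Gk\<close>, of relative size \<open>s0 t\<close>; both are multiples of
    \<open>sqrt t\<close>.\<close>
  define Ct where "Ct = Cs / (g * sqrt (A * \<theta>)) + Kr * q / g * sqrt (A / \<theta>)"
  have Ct: "Ct > 0" using Cs g A \<theta> Kr q unfolding Ct_def by (intro add_pos_pos mult_pos_pos divide_pos_pos) auto
  have main: "\<kappa> * g / \<theta> * exp (- sqrt (2 * A * \<theta> / t)) \<le> Am t \<and>
     norm (ray_int k t \<theta> - of_real (Am t) * cis (sqrt (2 * A * \<theta> / t) - (real k - 3) * pi / 8)) \<le> Ct * sqrt t * Am t"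
    if t: "0 < t" "t \<le> t0" for t
  proof -
    define s where "s = s0 t"
    define m where "m = \<mu> t"
    have t': "t \<le> 1" "t \<le> \<theta> / A" "t \<le> A * \<theta>" using t by (auto simp: t0_def)
    have s: "0 < s" "s \<le> 1"
    proof -
      show "0 < s" using A \<theta> t by (simp add: s_def s0_def)
      have "A * t / \<theta> \<le> 1" using t' A \<theta> by (simp add: field_simps)
      then show "s \<le> 1" by (simp add: s_def s0_def)
    qed
    have m: "m \<ge> 1" using t' t by (simp add: m_def \<mu>_def)
    then have m0: "m > 0" by simp
    have ms: "m * s = A"
    proof -
      have "m * s = sqrt ((A * \<theta> / t) * (A * t / \<theta>))" by (simp only: m_def \<mu>_def s_def s0_def real_sqrt_mult)
      also have "(A * \<theta> / t) * (A * t / \<theta>) = A\<^sup>2" using t \<theta> by (simp add: power2_eq_square)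
      finally show ?thesis using A by simp
    qed
    have st: "\<theta> * (s / t) = m"
    proof -
      have "(\<theta> * (s / t))\<^sup>2 = m\<^sup>2"
        using t \<theta> A by (simp add: s_def s0_def m_def \<mu>_def power_mult_distrib power_divide) (simp add: power2_eq_square)
      then show ?thesis using s t \<theta> m0 by (subst (asm) power2_eq_iff_nonneg) auto
    qed
    have two: "2 * m / sqrt 2 = sqrt (2 * A * \<theta> / t)"
    proof -
      have "2 * m / sqrt 2 = sqrt 2 * m" by (simp add: field_simps)
      also have "\<dots> = sqrt (2 * A * \<theta> / t)" by (simp add: m_def \<mu>_def mult.assoc flip: real_sqrt_mult)
      finally show ?thesis .
    qed
    have K1: "K1 t > 0" using s t \<kappa> by (simp add: K1_def s_def[symmetric])
    have N: "N t > 0" using m0 by (simp add: N_def m_def[symmetric])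
    have Am0: "Am t > 0" using K1 N g by (simp add: Am_def)
    define f where "f v = ray_fun k t \<theta> (ln (s / t) + v)" for v
    define mainf where "mainf v = of_real (exp (a * v)) * exp (- (of_real (2 * m * cosh v) * wbar))" for v
    define u where "u = cis (a * (pi / 4))"
    have rs: "ray (ln (s / t) + v) = of_real (s / t) * ray v" for v
    proof -
      have "ray (ln (s / t) + v) = exp (of_real (ln (s / t)) + (of_real v + \<i> * of_real (pi / 4)))"
        unfolding ray_eq by (simp add: add.assoc)
      also have "\<dots> = of_real (s / t) * ray v" unfolding exp_add[of "of_real (ln (s / t))"] exp_of_real ray_eq using s t by simp
      finally show ?thesis .
    qed
    have fv: "f v = of_real (s / t) * ray v * Fk k (of_real s * ray v) * exp (\<i> * of_real m * ray v)" for v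
    proof -
      have "of_real t * (of_real (s / t) * ray v) = of_real s * ray v" using t by simp
      moreover have "\<i> * of_real \<theta> * (of_real (s / t) * ray v) = \<i> * of_real m * ray v" unfolding st[symmetric] by simp
      ultimately show ?thesis unfolding f_def ray_fun_def rs by simp
    qed
    have Gm: "ray v * Gk k (of_real s * ray v) * exp (\<i> * of_real m * ray v) = of_real (exp (- (real k / 2 * ln s))) * u * mainf v" for v
      unfolding mainf_def u_def a_def by (rule Gk_ray) (use s ms in \<open>auto simp: A_def\<close>)
    have fd: "norm (f v - of_real (K1 t) * u * mainf v) \<le> K1 t * (s * Kr) * (exp (- (2 * m / sqrt 2)) * exp (- (m * v\<^sup>2 / 4)))" for v
    proof -
      define R where "R = Fk k (of_real s * ray v) - of_real \<kappa> * Gk k (of_real s * ray v)"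
      have sec: "of_real s * ray v \<in> sector - {0}" using ray_sector[of v] scaleR_sector[of "ray v" s] s by auto
      have n: "norm (of_real s * ray v) = s * exp v" using s by (simp add: norm_mult)
      have "f v - of_real (K1 t) * u * mainf v = of_real (s / t) * ray v * R * exp (\<i> * of_real m * ray v)"
      proof -
        have "of_real (K1 t) * u * mainf v = of_real (s / t * \<kappa>) * (ray v * Gk k (of_real s * ray v) * exp (\<i> * of_real m * ray v))"
          unfolding Gm K1_def s_def[symmetric] by simp
        then show ?thesis unfolding fv R_def by (simp add: algebra_simps)
      qed
      then have "norm (f v - of_real (K1 t) * u * mainf v) = s / t * norm (ray v * exp (\<i> * of_real m * ray v)) * norm R"
        using s t by (simp add: norm_mult norm_divide)
      also have "\<dots> \<le> s / t * norm (ray v * exp (\<i> * of_real m * ray v)) * (CF * (s * exp v) * (1 + s * exp v) ^ k * norm (Gk k (of_real s * ray v)))"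
        using asy sec s t unfolding R_def n[symmetric] by (intro mult_left_mono) auto
      also have "\<dots> = s / t * (CF * (s * exp v) * (1 + s * exp v) ^ k) * norm (ray v * Gk k (of_real s * ray v) * exp (\<i> * of_real m * ray v))"
        unfolding norm_mult by (simp only: mult_ac)
      also have "norm (ray v * Gk k (of_real s * ray v) * exp (\<i> * of_real m * ray v)) = exp (- (real k / 2 * ln s)) * (exp (a * v) * exp (- (2 * m * cosh v / sqrt 2)))"
        unfolding Gm mainf_def norm_mult norm_exp_wbar u_def by simp
      also have "s / t * (CF * (s * exp v) * (1 + s * exp v) ^ k) * (exp (- (real k / 2 * ln s)) * (exp (a * v) * exp (- (2 * m * cosh v / sqrt 2))))
          = K1 t * s * (CF / \<kappa>) * ((1 + s * exp v) ^ k * exp v * exp (a * v)) * exp (- (2 * m * cosh v / sqrt 2))"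
        using \<kappa> by (simp add: K1_def s_def[symmetric])
      also have "\<dots> \<le> K1 t * s * (CF / \<kappa>) * (2 ^ k * exp (p * \<bar>v\<bar>)) * exp (- (2 * m * cosh v / sqrt 2))"
      proof (intro mult_right_mono mult_left_mono)
        have "1 + s * exp v \<le> 2 * exp \<bar>v\<bar>"
        proof -
          have "s * exp v \<le> 1 * exp \<bar>v\<bar>" using s by (intro mult_mono) auto
          moreover have "1 \<le> exp \<bar>v\<bar>" by simp
          ultimately show ?thesis by linarith
        qed
        then have "(1 + s * exp v) ^ k \<le> (2 * exp \<bar>v\<bar>) ^ k" using s by (intro power_mono) (auto intro: add_nonneg_nonneg)
        moreover have "exp (a * v) \<le> exp (\<bar>a\<bar> * \<bar>v\<bar>)" by (simp flip: abs_mult)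
        moreover have "exp v \<le> exp \<bar>v\<bar>" by simp
        ultimately have "(1 + s * exp v) ^ k * exp v * exp (a * v) \<le> (2 * exp \<bar>v\<bar>) ^ k * exp \<bar>v\<bar> * exp (\<bar>a\<bar> * \<bar>v\<bar>)"
          using s by (intro mult_mono) auto
        also have "\<dots> = 2 ^ k * exp (p * \<bar>v\<bar>)"
          by (simp add: p_def power_mult_distrib exp_of_nat_mult[symmetric] distrib_right exp_add)
        finally show "(1 + s * exp v) ^ k * exp v * exp (a * v) \<le> 2 ^ k * exp (p * \<bar>v\<bar>)" .
      qed (use K1 s \<kappa> in auto)
      also have "\<dots> = K1 t * s * (CF / \<kappa>) * 2 ^ k * (exp (p * \<bar>v\<bar>) * exp (- (2 * m * cosh v / sqrt 2)))" by simp
      also have "\<dots> \<le> K1 t * s * (CF / \<kappa>) * 2 ^ k * (exp (- (2 * m / sqrt 2)) * (exp (2 * p\<^sup>2) * exp (- (m * v\<^sup>2 / 4))))"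
        using K1 s \<kappa> exp_cosh_gauss[OF m] by (intro mult_left_mono) auto
      also have "\<dots> = K1 t * (s * Kr) * (exp (- (2 * m / sqrt 2)) * exp (- (m * v\<^sup>2 / 4)))"
        by (simp add: Kr_def)
      finally show ?thesis .
    qed
    have fi: "integrable lborel f"
      unfolding f_def using lborel_integrable_real_affine[OF ap_int_split(1)[OF k t(1), of 1 \<theta>], of 1 "ln (s / t)"] \<theta> by simp
    have fI: "ray_int k t \<theta> = (LINT v|lborel. f v)"
      unfolding ray_int_def f_def by (rule lborel_integral_shift)
    have mi: "integrable lborel mainf" unfolding mainf_def[abs_def] by (rule Cs(2)[OF m])
    have "norm (LINT v|lborel. f v - of_real (K1 t) * u * mainf v) \<le> (LINT v|lborel. K1 t * (s * Kr) * (exp (- (2 * m / sqrt 2)) * exp (- (m * v\<^sup>2 / 4))))"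
    proof (rule Bochner_Integration.integral_norm_bound_integral[OF _ _ fd])
      show "integrable lborel (\<lambda>v. f v - of_real (K1 t) * u * mainf v)" using fi mi by simp
      show "integrable lborel (\<lambda>v. K1 t * (s * Kr) * (exp (- (2 * m / sqrt 2)) * exp (- (m * v\<^sup>2 / 4))))"
        using q(2)[OF m0] by (simp add: has_bochner_integral_iff)
    qed
    also have "\<dots> = K1 t * (s * Kr) * (exp (- (2 * m / sqrt 2)) * (q / sqrt m))"
      using q(2)[OF m0] by (simp add: has_bochner_integral_iff)
    also have "\<dots> = s * (Kr * q / g) * Am t" using g by (simp add: Am_def N_def m_def[symmetric])
    finally have e1: "norm (ray_int k t \<theta> - of_real (K1 t) * u * (LINT v|lborel. mainf v)) \<le> s * (Kr * q / g) * Am t"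
      using fi mi by (simp add: fI)
    define B where "B = exp (- (of_real (2 * m) * wbar)) * (of_real (g / sqrt m) * cis (pi / 8))"
    have "norm ((LINT v|lborel. mainf v) - B) \<le> Cs / m * N t"
      using Cs(3)[OF m] by (simp add: mainf_def[abs_def] B_def N_def m_def[symmetric])
    then have "K1 t * norm ((LINT v|lborel. mainf v) - B) \<le> K1 t * (Cs / m * N t)" using K1 by (intro mult_left_mono) auto
    also have "\<dots> = Cs / (g * m) * Am t" using g by (simp add: Am_def)
    also have "K1 t * norm ((LINT v|lborel. mainf v) - B) = norm (of_real (K1 t) * u * (LINT v|lborel. mainf v) - of_real (K1 t) * u * B)"
    proof -
      have "norm (of_real (K1 t) * u * ((LINT v|lborel. mainf v) - B)) = K1 t * norm ((LINT v|lborel. mainf v) - B)"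
        using K1 by (simp add: norm_mult u_def)
      then show ?thesis by (simp add: right_diff_distrib)
    qed
    finally have e2: "norm (of_real (K1 t) * u * (LINT v|lborel. mainf v) - of_real (K1 t) * u * B) \<le> Cs / (g * m) * Am t" .
    have ph: "of_real (K1 t) * u * B = of_real (Am t) * cis (sqrt (2 * A * \<theta> / t) - (real k - 3) * pi / 8)"
    proof -
      have "B = of_real (g * N t) * (cis (2 * m / sqrt 2) * cis (pi / 8))"
        unfolding B_def exp_wbar N_def m_def[symmetric] by simp
      then have "of_real (K1 t) * u * B = of_real (Am t) * (u * (cis (2 * m / sqrt 2) * cis (pi / 8)))" by (simp add: Am_def)
      \<comment> \<open>Here \<open>(1 - k / 2) * pi / 4 + pi / 8\<close> becomes
        \<open>- (k - 3) * pi / 8\<close>.\<close>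
      also have "u * (cis (2 * m / sqrt 2) * cis (pi / 8)) = cis (sqrt (2 * A * \<theta> / t) - (real k - 3) * pi / 8)"
        unfolding two u_def cis_mult by (rule arg_cong[of _ _ cis]) (simp add: a_def field_simps)
      finally show ?thesis .
    qed
    have "norm (ray_int k t \<theta> - of_real (Am t) * cis (sqrt (2 * A * \<theta> / t) - (real k - 3) * pi / 8)) \<le> s * (Kr * q / g) * Am t + Cs / (g * m) * Am t"
      unfolding ph[symmetric] using norm_triangle_mono[OF e1 e2] by simp
    also have "\<dots> = Ct * sqrt t * Am t"
    proof -
      have "s = sqrt (A / \<theta>) * sqrt t" by (simp add: s_def s0_def flip: real_sqrt_mult)
      moreover have "1 / m = sqrt t / sqrt (A * \<theta>)" by (simp add: m_def \<mu>_def real_sqrt_divide)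
      then have "Cs / (g * m) = Cs / (g * sqrt (A * \<theta>)) * sqrt t"
        by (metis (no_types, opaque_lifting) divide_divide_eq_left mult.commute mult.right_neutral times_divide_eq_right times_divide_eq_left)
      ultimately show ?thesis by (simp add: Ct_def algebra_simps)
    qed
    finally have 1: "norm (ray_int k t \<theta> - of_real (Am t) * cis (sqrt (2 * A * \<theta> / t) - (real k - 3) * pi / 8)) \<le> Ct * sqrt t * Am t" .
    \<comment> \<open>The powers of \<open>t\<close> are discarded or cancel: the power
      \<open>- k / 2\<close> of \<open>s <= 1\<close> is at least 1, \<open>sqrt m <= m\<close>, and
      \<open>s / t = m / \<theta>\<close>.\<close>
    have "\<kappa> * g / \<theta> * exp (- sqrt (2 * A * \<theta> / t)) \<le> Am t"
    proof -
      have "exp (- (real k / 2 * ln s)) \<ge> 1" using s by (simp add: mult_nonneg_nonpos)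
      then have "s / t * \<kappa> * 1 \<le> K1 t" unfolding K1_def s_def[symmetric] using s t \<kappa> by (intro mult_left_mono) auto
      moreover have "sqrt m \<le> m" using m by (intro real_le_lsqrt) (auto simp: power2_eq_square)
      then have "exp (- (2 * m / sqrt 2)) / m \<le> N t" unfolding N_def m_def[symmetric] using m by (intro divide_left_mono) auto
      ultimately have "(s / t * \<kappa>) * g * (exp (- (2 * m / sqrt 2)) / m) \<le> Am t"
        unfolding Am_def using s t \<kappa> g m K1 by (intro mult_mono) auto
      also have "(s / t * \<kappa>) * g * (exp (- (2 * m / sqrt 2)) / m) = \<kappa> * g / \<theta> * exp (- (2 * m / sqrt 2))"
      proof -
        have "s / t = m / \<theta>" using st \<theta> by (simp add: field_simps)
        then show ?thesis using m0 by simp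
      qed
      finally show ?thesis unfolding two .
    qed
    then show ?thesis using 1 by blast
  qed
  have t0: "0 < t0" "t0 \<le> 1" using A \<theta> by (auto simp: t0_def)
  have c: "\<kappa> * g / \<theta> > 0" using \<kappa> g \<theta> by simp
  show ?thesis
    unfolding A_def[symmetric]
  proof (rule exI[of _ Am], rule exI[of _ t0], rule exI[of _ Ct], rule exI[of _ "\<kappa> * g / \<theta>"],
      rule conjI[OF t0(1)], rule conjI[OF t0(2)], rule conjI[OF Ct], rule conjI[OF c], intro allI impI)
    fix t assume "0 < t \<and> t \<le> t0"
    then show "\<kappa> * g / \<theta> * exp (- sqrt (2 * A * \<theta> / t)) \<le> Am t \<and>
      norm (ray_int k t \<theta> - of_real (Am t) * cis (sqrt (2 * A * \<theta> / t) - (real k - 3) * pi / 8)) \<le> Ct * sqrt t * Am t"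
      using main by simp
  qed
qed

section \<open>Twisted sums and their quotients\<close>

text \<open>For \<open>0 <= \<theta> <= 2 * pi\<close> this is the value of the twisted series;
  written through integrals, its symmetry under \<open>\<theta>\<close> to
  \<open>2 * pi - \<theta>\<close> is immediate.\<close>

definition twist_sum :: "nat \<Rightarrow> real \<Rightarrow> real \<Rightarrow> real \<Rightarrow> complex" where
  "twist_sum k t \<alpha> \<theta> = ap_int k t \<alpha> \<theta> + cnj (ap_int k t \<alpha> (2 * pi - \<theta>))"

lemma twist_sum_reflect: "twist_sum k t \<alpha> (2 * pi - \<theta>) = cnj (twist_sum k t \<alpha> \<theta>)"
  by (simp add: twist_sum_def)

text \<open>Decay exponent and oscillating phase of the ray integral in one, as \<open>wbar\<close>
  has equal real and imaginary parts up to sign.\<close>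

abbreviation lam :: "nat \<Rightarrow> real \<Rightarrow> real \<Rightarrow> real" where
  "lam k \<theta> t \<equiv> sqrt (2 * (real k * pi\<^sup>2 / 6) * \<theta> / t)"

text \<open>Half of the gap \<open>y - x\<close> absorbs the factor \<open>1 / t\<close>; the other
  half is the exponential saving that remains.\<close>

lemma exp_gap:
  fixes x y K :: real
  assumes "x < y" "K > 0"
  shows "\<exists>C>0. \<exists>c>0. \<forall>t. 0 < t \<longrightarrow> K / t * exp (- (y / sqrt t)) \<le> C * exp (- (c / sqrt t)) * exp (- (x / sqrt t))"
proof -
  define \<eta> where "\<eta> = (y - x) / 2"
  have \<eta>: "\<eta> > 0" using assms by (simp add: \<eta>_def)
  have y: "y = x + 2 * \<eta>" by (simp add: \<eta>_def field_simps)
  have "K / t * exp (- (y / sqrt t)) \<le> K * (2 / \<eta>\<^sup>2) * exp (- (\<eta> / sqrt t)) * exp (- (x / sqrt t))" if t: "t > 0" for t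
  proof -
    have "1 / t = (1 / sqrt t) ^ 2" using t by (simp add: power_divide)
    also have "\<dots> \<le> fact 2 / \<eta> ^ 2 * exp (\<eta> * (1 / sqrt t))" by (rule power_le_exp_scaled) (use t \<eta> in auto)
    finally have "1 / t \<le> 2 / \<eta>\<^sup>2 * exp (\<eta> / sqrt t)" by simp
    then have "K * (1 / t) * exp (- (y / sqrt t)) \<le> K * (2 / \<eta>\<^sup>2 * exp (\<eta> / sqrt t)) * exp (- (y / sqrt t))"
      using assms by (intro mult_right_mono mult_left_mono) auto
    also have "\<dots> = K * (2 / \<eta>\<^sup>2) * (exp (\<eta> / sqrt t) * exp (- (y / sqrt t)))" by simp
    also have "exp (\<eta> / sqrt t) * exp (- (y / sqrt t)) = exp (- (\<eta> / sqrt t)) * exp (- (x / sqrt t))"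
      unfolding mult_exp_exp by (rule arg_cong[of _ _ exp]) (simp add: y add_divide_distrib)
    finally show ?thesis by (simp add: mult.assoc)
  qed
  then show ?thesis using assms \<eta> by (intro exI[of _ "K * (2 / \<eta>\<^sup>2)"] conjI exI[of _ \<eta>]) auto
qed

text \<open>\<open>A'\<close> is chosen so that \<open>A' * \<theta>'\<close> is the midpoint of
  \<open>A * \<theta>\<close> and \<open>A * \<theta>'\<close>: the crude bound is admissible as
  \<open>A' < A\<close>, and frequency \<open>\<theta>'\<close> at this reduced rate still decays
  faster than \<open>\<theta>\<close> at the full rate.\<close>

lemma ap_int_small:
  assumes k: "k \<ge> 1" and \<theta>: "0 \<le> \<theta>" "\<theta> < \<theta>'"
  shows "\<exists>C>0. \<exists>c>0. \<forall>t \<alpha> \<theta>''. 0 < t \<and> t \<le> 1 \<and> 0 < \<alpha> \<and> \<alpha> \<le> 1 \<and> \<theta>' \<le> \<theta>'' \<longrightarrow>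
    norm (ap_int k t \<alpha> \<theta>'') \<le> C * exp (- (c / sqrt t)) * exp (- lam k \<theta> t)"
proof -
  define A where "A = real k * pi\<^sup>2 / 6"
  have A: "A > 0" using k by (simp add: A_def)
  define A' where "A' = A * (\<theta> + \<theta>') / (2 * \<theta>')"
  have "A' < A"
  proof -
    have "A * (\<theta> + \<theta>') < A * (2 * \<theta>')" using A \<theta> by (intro mult_strict_left_mono) auto
    then show ?thesis using \<theta> by (simp add: A'_def divide_less_eq)
  qed
  moreover have "A' \<ge> 0" using A \<theta> by (simp add: A'_def)
  ultimately obtain C where C: "C > 0" "\<And>t \<alpha> \<theta>. 0 < t \<Longrightarrow> t \<le> 1 \<Longrightarrow> 0 < \<alpha> \<Longrightarrow> \<alpha> \<le> 1 \<Longrightarrow> 0 \<le> \<theta> \<Longrightarrow>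
     norm (ap_int k t \<alpha> \<theta>) \<le> C / t * exp (- sqrt (2 * A' * \<theta> / t))"
    using ap_int_bound[OF k, of A'] unfolding A_def by metis
  have "sqrt (2 * A * \<theta>) < sqrt (2 * A' * \<theta>')"
  proof -
    have "2 * A' * \<theta>' = A * (\<theta> + \<theta>')" using \<theta> by (simp add: A'_def)
    moreover have "A * (2 * \<theta>) < A * (\<theta> + \<theta>')" using A \<theta> by (intro mult_strict_left_mono) auto
    ultimately show ?thesis by simp
  qed
  from exp_gap[OF this C(1)] obtain D c where Dc: "D > 0" "c > 0"
    "\<And>t. 0 < t \<Longrightarrow> C / t * exp (- (sqrt (2 * A' * \<theta>') / sqrt t)) \<le> D * exp (- (c / sqrt t)) * exp (- (sqrt (2 * A * \<theta>) / sqrt t))"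
    by blast
  have "norm (ap_int k t \<alpha> \<theta>'') \<le> D * exp (- (c / sqrt t)) * exp (- lam k \<theta> t)"
    if h: "0 < t" "t \<le> 1" "0 < \<alpha>" "\<alpha> \<le> 1" "\<theta>' \<le> \<theta>''" for t \<alpha> \<theta>''
  proof -
    have "norm (ap_int k t \<alpha> \<theta>'') \<le> C / t * exp (- sqrt (2 * A' * \<theta>'' / t))" using h \<theta> by (intro C(2)) auto
    also have "\<dots> \<le> C / t * exp (- (sqrt (2 * A' * \<theta>') / sqrt t))"
    proof -
      have "2 * A' * \<theta>' / t \<le> 2 * A' * \<theta>'' / t" using h \<open>A' \<ge> 0\<close> by (intro divide_right_mono mult_left_mono) auto
      then have "sqrt (2 * A' * \<theta>') / sqrt t \<le> sqrt (2 * A' * \<theta>'' / t)" by (simp flip: real_sqrt_divide)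
      then show ?thesis using C h by (intro mult_left_mono) auto
    qed
    also have "\<dots> \<le> D * exp (- (c / sqrt t)) * exp (- (sqrt (2 * A * \<theta>) / sqrt t))" using h by (intro Dc(3))
    also have "sqrt (2 * A * \<theta>) / sqrt t = lam k \<theta> t" by (simp only: A_def real_sqrt_divide)
    finally show ?thesis .
  qed
  then show ?thesis using Dc(1,2) by blast
qed

lemma exp_neg_inverse_sqrt_tendsto: "c > 0 \<Longrightarrow> ((\<lambda>t. exp (- (c / sqrt t))) \<longlongrightarrow> 0) (at_right 0)"
  by real_asymp

lemma eventually_at_right_le: "b > 0 \<Longrightarrow> eventually (\<lambda>t. 0 < t \<and> t \<le> b) (at_right (0::real))"
  unfolding eventually_at_right_field by (intro exI[of _ b]) auto

text \<open>The discarded integrals have frequencies \<open>2 * pi + \<theta>\<close> and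
  \<open>2 * pi - \<theta>\<close>, and \<open>\<theta> < pi\<close> places both at a fixed distance
  above \<open>\<theta>\<close>.\<close>

lemma twist_sum_diff:
  assumes k: "k \<ge> 1" and \<theta>: "0 \<le> \<theta>" "\<theta> < pi" and \<alpha>: "0 < \<alpha>" "\<alpha> \<le> 1"
  shows "\<exists>C>0. \<exists>c>0. \<forall>t. 0 < t \<and> t \<le> 1 \<longrightarrow>
    norm (twist_sum k t \<alpha> \<theta> - exp (- (\<i> * of_real (\<theta> * \<alpha>))) * ray_int k t \<theta>) \<le> C * exp (- (c / sqrt t)) * exp (- lam k \<theta> t)"
proof -
  obtain C c where C: "C > 0" "c > 0" "\<And>t \<alpha> \<theta>''. 0 < t \<Longrightarrow> t \<le> 1 \<Longrightarrow> 0 < \<alpha> \<Longrightarrow> \<alpha> \<le> 1 \<Longrightarrow> 2 * pi - \<theta> \<le> \<theta>'' \<Longrightarrow>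
    norm (ap_int k t \<alpha> \<theta>'') \<le> C * exp (- (c / sqrt t)) * exp (- lam k \<theta> t)"
    using ap_int_small[OF k \<theta>(1), of "2 * pi - \<theta>"] \<theta> by auto
  have "norm (twist_sum k t \<alpha> \<theta> - exp (- (\<i> * of_real (\<theta> * \<alpha>))) * ray_int k t \<theta>) \<le> 2 * C * exp (- (c / sqrt t)) * exp (- lam k \<theta> t)"
    if t: "0 < t" "t \<le> 1" for t
  proof -
    have "twist_sum k t \<alpha> \<theta> - exp (- (\<i> * of_real (\<theta> * \<alpha>))) * ray_int k t \<theta> = ap_int k t \<alpha> (\<theta> + 2 * pi) + cnj (ap_int k t \<alpha> (2 * pi - \<theta>))"
      using ap_int_split(2)[OF k t(1) \<alpha> \<theta>(1)] by (simp add: twist_sum_def)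
    also have "norm \<dots> \<le> norm (ap_int k t \<alpha> (\<theta> + 2 * pi)) + norm (ap_int k t \<alpha> (2 * pi - \<theta>))"
      using norm_triangle_ineq[of "ap_int k t \<alpha> (\<theta> + 2 * pi)" "cnj (ap_int k t \<alpha> (2 * pi - \<theta>))"] by simp
    also have "\<dots> \<le> C * exp (- (c / sqrt t)) * exp (- lam k \<theta> t) + C * exp (- (c / sqrt t)) * exp (- lam k \<theta> t)"
      using t \<alpha> \<theta> by (intro add_mono C(3)) auto
    finally show ?thesis by simp
  qed
  then show ?thesis using C(1,2) by (intro exI[of _ "2 * C"] conjI exI[of _ c]) auto
qed

text \<open>At frequency zero there is no oscillation: all terms are positive, and one of them is evaluated in \<open>{1..2}\<close>.\<close>

lemma twist_sum_lower_zero: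
  assumes k: "k \<ge> 1"
  shows "\<exists>c>0. \<forall>t. 0 < t \<and> t \<le> 1 \<longrightarrow> c \<le> norm (twist_sum k t 1 0)"
proof -
  have pos: "Re (Fk k (of_real x)) > 0" "Im (Fk k (of_real x)) = 0" if "x > 0" for x
    using Fk_real_pos[OF that, of k] by auto
  have "continuous_on {1..2} (\<lambda>x. Re (Fk k (of_real x)))"
    by (intro continuous_intros continuous_on_compose2[OF holomorphic_on_imp_continuous_on[OF holomorphic_Fk]]) auto
  then obtain x0 where x0: "x0 \<in> {1..2::real}" "\<And>x. x \<in> {1..2} \<Longrightarrow> Re (Fk k (of_real x0)) \<le> Re (Fk k (of_real x))"
    using continuous_attains_inf[of "{1..2::real}" "\<lambda>x. Re (Fk k (of_real x))"] by auto
  define c where "c = Re (Fk k (of_real x0))"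
  have c: "c > 0" using pos(1)[of x0] x0 by (simp add: c_def)
  have "c \<le> norm (twist_sum k t 1 0)" if t: "0 < t" "t \<le> 1" for t
  proof -
    have s: "(\<lambda>m. Re (Fk k (of_real (t * (real m + 1))))) sums Re (twist_sum k t 1 0)"
      using sums_Re[OF Fk_sums[OF k t(1), of 1 0]] by (simp add: twist_sum_def)
    define n where "n = nat \<lceil>1 / t\<rceil>"
    have n: "real n \<ge> 1 / t" "real n < 1 / t + 1"
      using t by (auto simp: n_def of_nat_ceiling) linarith
    have "1 / t > 0" using t by simp
    then have "real n > 0" using n(1) by linarith
    then have n1: "n \<ge> 1" by simp
    have tn: "t * real n \<in> {1..2}"
    proof -
      have "t * real n \<ge> t * (1 / t)" using n t by (intro mult_left_mono) auto
      moreover have "t * real n \<le> t * (1 / t + 1)" using n t by (intro mult_left_mono) auto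
      ultimately show ?thesis using t by (simp add: distrib_left)
    qed
    \<comment> \<open>With shift 1 the term of index \<open>n - 1\<close> is the one evaluated at
      \<open>t * n\<close>.\<close>
    have "c \<le> Re (Fk k (of_real (t * (real (n - 1) + 1))))"
      using x0(2)[OF tn] n1 by (simp add: c_def of_nat_diff)
    also have "\<dots> = (\<Sum>m\<in>{n - 1}. Re (Fk k (of_real (t * (real m + 1)))))" by simp
    also have "\<dots> \<le> (\<Sum>m. Re (Fk k (of_real (t * (real m + 1)))))"
    proof (rule sum_le_suminf[OF sums_summable[OF s]])
      show "0 \<le> Re (Fk k (of_real (t * (real m + 1))))" for m
        using pos(1)[of "t * (real m + 1)"] t by simp
    qed simp
    also have "\<dots> = Re (twist_sum k t 1 0)" using s by (simp add: sums_iff)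
    also have "\<dots> \<le> norm (twist_sum k t 1 0)" by (rule complex_Re_le_cmod)
    finally show ?thesis .
  qed
  then show ?thesis using c by blast
qed

text \<open>For \<open>\<theta> > 0\<close> the ray integral keeps half of its amplitude once
  \<open>C * sqrt t < 1 / 2\<close>, and the other integrals are exponentially smaller. At
  \<open>\<theta> = 0\<close> the exponent vanishes and positivity replaces the saddle.\<close>

lemma twist_sum_lower:
  assumes k: "k \<ge> 1" and \<theta>: "0 \<le> \<theta>" "\<theta> < pi"
  shows "\<exists>c>0. eventually (\<lambda>t. c * exp (- lam k \<theta> t) \<le> norm (twist_sum k t 1 \<theta>)) (at_right 0)"
proof (cases "\<theta> = 0")
  case True
  obtain c where c: "c > 0" "\<And>t. 0 < t \<Longrightarrow> t \<le> 1 \<Longrightarrow> c \<le> norm (twist_sum k t 1 0)"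
    using twist_sum_lower_zero[OF k] by blast
  have "eventually (\<lambda>t. c * exp (- lam k \<theta> t) \<le> norm (twist_sum k t 1 \<theta>)) (at_right 0)"
    using eventually_at_right_le[OF zero_less_one] by (rule eventually_mono) (use c True in auto)
  then show ?thesis using c(1) by blast
next
  case False
  then have \<theta>0: "\<theta> > 0" using \<theta> by simp
  obtain Am t0 C c where I: "0 < t0" "t0 \<le> 1" "C > 0" "c > (0::real)"
     "\<And>t. 0 < t \<Longrightarrow> t \<le> t0 \<Longrightarrow> c * exp (- lam k \<theta> t) \<le> Am t"
     "\<And>t. 0 < t \<Longrightarrow> t \<le> t0 \<Longrightarrow> norm (ray_int k t \<theta> - of_real (Am t) * cis (lam k \<theta> t - (real k - 3) * pi / 8)) \<le> C * sqrt t * Am t"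
    using ray_int_asymp[OF k \<theta>0] by metis
  obtain D e where D: "D > 0" "e > 0" "\<And>t. 0 < t \<Longrightarrow> t \<le> 1 \<Longrightarrow>
    norm (twist_sum k t 1 \<theta> - exp (- (\<i> * of_real (\<theta> * 1))) * ray_int k t \<theta>) \<le> D * exp (- (e / sqrt t)) * exp (- lam k \<theta> t)"
    using twist_sum_diff[OF k \<theta>, of 1] by auto
  have "eventually (\<lambda>t. D * exp (- (e / sqrt t)) < c / 4) (at_right 0)"
    using tendsto_mult_right_zero[OF exp_neg_inverse_sqrt_tendsto[OF D(2)], of D] I(4) by (intro order_tendstoD(2)) auto
  moreover have "eventually (\<lambda>t. C * sqrt t < 1 / 2) (at_right 0)"
  proof -
    have "((\<lambda>t. C * sqrt t) \<longlongrightarrow> C * sqrt 0) (at_right 0)" by (intro tendsto_intros)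
    then show ?thesis by (intro order_tendstoD(2)) auto
  qed
  moreover note eventually_at_right_le[OF I(1)]
  ultimately have "eventually (\<lambda>t. c / 4 * exp (- lam k \<theta> t) \<le> norm (twist_sum k t 1 \<theta>)) (at_right 0)"
  proof eventually_elim
    case (elim t)
    define L where "L = exp (- lam k \<theta> t)"
    have L: "L > 0" by (simp add: L_def)
    have t: "0 < t" "t \<le> t0" "t \<le> 1" using elim I by auto
    have Am1: "c * L \<le> Am t" using I(5)[OF t(1,2)] unfolding L_def .
    then have "Am t > 0" using mult_pos_pos[OF I(4) L] by linarith
    note Am = Am1 this
    have "norm (of_real (Am t) * cis (lam k \<theta> t - (real k - 3) * pi / 8)) - norm (ray_int k t \<theta>)
       \<le> C * sqrt t * Am t"
      using I(6)[OF t(1,2)] norm_triangle_ineq2[of "of_real (Am t) * cis (lam k \<theta> t - (real k - 3) * pi / 8)" "ray_int k t \<theta>"]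
      by (simp add: norm_minus_commute)
    moreover have "norm (of_real (Am t) * cis (lam k \<theta> t - (real k - 3) * pi / 8)) = Am t"
      using Am by (simp add: norm_mult)
    moreover have "C * sqrt t * Am t \<le> 1 / 2 * Am t" using elim Am by (intro mult_right_mono) auto
    ultimately have i: "norm (ray_int k t \<theta>) \<ge> c / 2 * L" using Am by linarith
    have "norm (exp (- (\<i> * of_real (\<theta> * 1))) * ray_int k t \<theta>) = norm (ray_int k t \<theta>)" by (simp add: norm_mult)
    moreover have "norm (exp (- (\<i> * of_real (\<theta> * 1))) * ray_int k t \<theta>) - norm (twist_sum k t 1 \<theta>) \<le> D * exp (- (e / sqrt t)) * L"
      using D(3)[OF t(1,3)] norm_triangle_ineq2[of "exp (- (\<i> * of_real (\<theta> * 1))) * ray_int k t \<theta>" "twist_sum k t 1 \<theta>"]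
      by (simp add: norm_minus_commute L_def)
    moreover have "D * exp (- (e / sqrt t)) * L \<le> c / 4 * L" using elim L by (intro mult_right_mono) auto
    ultimately have "norm (twist_sum k t 1 \<theta>) \<ge> c / 2 * L - c / 4 * L" using i by linarith
    then show ?case by (simp add: L_def)
  qed
  then show ?thesis using I(4) by (intro exI[of _ "c / 4"]) auto
qed

text \<open>Numerator and denominator are known phases times the same ray integral, so it cancels
  exactly in \<open>e2 - cis (\<theta> * (1 - \<alpha>)) * e1\<close>. That is why the error is
  exponentially small although the ray integral itself is known only up to a relative error of order
  \<open>sqrt t\<close>.\<close>

lemma ratio_generic:
  assumes k: "k \<ge> 1" and \<theta>: "0 \<le> \<theta>" "\<theta> < pi" and \<alpha>: "0 < \<alpha>" "\<alpha> \<le> 1"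
  shows "\<exists>C>0. \<exists>c>0. eventually (\<lambda>t. twist_sum k t 1 \<theta> \<noteq> 0 \<and>
    norm (twist_sum k t \<alpha> \<theta> / twist_sum k t 1 \<theta> - cis (\<theta> * (1 - \<alpha>))) \<le> C * exp (- (c / sqrt t))) (at_right 0)"
proof -
  obtain c where c: "c > 0" "eventually (\<lambda>t. c * exp (- lam k \<theta> t) \<le> norm (twist_sum k t 1 \<theta>)) (at_right 0)"
    using twist_sum_lower[OF k \<theta>] by blast
  obtain C1 c1 where 1: "C1 > 0" "c1 > 0" "\<And>t. 0 < t \<Longrightarrow> t \<le> 1 \<Longrightarrow>
    norm (twist_sum k t 1 \<theta> - exp (- (\<i> * of_real (\<theta> * 1))) * ray_int k t \<theta>) \<le> C1 * exp (- (c1 / sqrt t)) * exp (- lam k \<theta> t)"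
    using twist_sum_diff[OF k \<theta>, of 1] by auto
  obtain C2 c2 where 2: "C2 > 0" "c2 > 0" "\<And>t. 0 < t \<Longrightarrow> t \<le> 1 \<Longrightarrow>
    norm (twist_sum k t \<alpha> \<theta> - exp (- (\<i> * of_real (\<theta> * \<alpha>))) * ray_int k t \<theta>) \<le> C2 * exp (- (c2 / sqrt t)) * exp (- lam k \<theta> t)"
    using twist_sum_diff[OF k \<theta> \<alpha>] by auto
  define c3 where "c3 = min c1 c2"
  have c3: "c3 > 0" using 1 2 by (simp add: c3_def)
  have "eventually (\<lambda>t. twist_sum k t 1 \<theta> \<noteq> 0 \<and>
    norm (twist_sum k t \<alpha> \<theta> / twist_sum k t 1 \<theta> - cis (\<theta> * (1 - \<alpha>))) \<le> (C1 + C2) / c * exp (- (c3 / sqrt t))) (at_right 0)"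
    using c(2) eventually_at_right_le[OF zero_less_one]
  proof eventually_elim
    case (elim t)
    then have t: "0 < t" "t \<le> 1" by auto
    define L where "L = exp (- lam k \<theta> t)"
    define E where "E = exp (- (c3 / sqrt t))"
    have L: "L > 0" by (simp add: L_def)
    have D: "c * L \<le> norm (twist_sum k t 1 \<theta>)" using elim by (simp add: L_def)
    then have D0: "norm (twist_sum k t 1 \<theta>) > 0" using c L by (smt (verit) mult_pos_pos)
    define e1 where "e1 = twist_sum k t 1 \<theta> - exp (- (\<i> * of_real (\<theta> * 1))) * ray_int k t \<theta>"
    define e2 where "e2 = twist_sum k t \<alpha> \<theta> - exp (- (\<i> * of_real (\<theta> * \<alpha>))) * ray_int k t \<theta>"
    have ex: "exp (- (c1 / sqrt t)) \<le> E" "exp (- (c2 / sqrt t)) \<le> E"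
      using t by (auto simp: E_def c3_def intro!: divide_right_mono)
    have e1: "norm e1 \<le> C1 * E * L"
      using 1(3)[OF t] mult_right_mono[OF mult_left_mono[OF ex(1), of C1], of L] 1 L unfolding e1_def L_def[symmetric] by linarith
    have e2: "norm e2 \<le> C2 * E * L"
      using 2(3)[OF t] mult_right_mono[OF mult_left_mono[OF ex(2), of C2], of L] 2 L unfolding e2_def L_def[symmetric] by linarith
    have cis: "cis (\<theta> * (1 - \<alpha>)) * exp (- (\<i> * of_real (\<theta> * 1))) = exp (- (\<i> * of_real (\<theta> * \<alpha>)))"
      unfolding cis_conv_exp mult_exp_exp by (rule arg_cong[of _ _ exp]) (simp add: algebra_simps)
    have "twist_sum k t \<alpha> \<theta> / twist_sum k t 1 \<theta> - cis (\<theta> * (1 - \<alpha>)) = (twist_sum k t \<alpha> \<theta> - cis (\<theta> * (1 - \<alpha>)) * twist_sum k t 1 \<theta>) / twist_sum k t 1 \<theta>"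
      using D0 by (simp add: diff_divide_distrib)
    also have "twist_sum k t \<alpha> \<theta> - cis (\<theta> * (1 - \<alpha>)) * twist_sum k t 1 \<theta> = e2 - cis (\<theta> * (1 - \<alpha>)) * e1"
      unfolding e1_def e2_def cis[symmetric] by (simp add: algebra_simps)
    finally have "norm (twist_sum k t \<alpha> \<theta> / twist_sum k t 1 \<theta> - cis (\<theta> * (1 - \<alpha>))) = norm (e2 - cis (\<theta> * (1 - \<alpha>)) * e1) / norm (twist_sum k t 1 \<theta>)"
      by (simp add: norm_divide)
    also have "\<dots> \<le> ((C1 + C2) * E * L) / (c * L)"
    proof (rule frac_le)
      have "norm (e2 - cis (\<theta> * (1 - \<alpha>)) * e1) \<le> norm e2 + norm e1"
        using norm_triangle_ineq4[of e2 "cis (\<theta> * (1 - \<alpha>)) * e1"] by (simp add: norm_mult)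
      then show "norm (e2 - cis (\<theta> * (1 - \<alpha>)) * e1) \<le> (C1 + C2) * E * L"
        using e1 e2 by (simp add: distrib_right)
    qed (use c L D 1 2 in \<open>auto simp: E_def\<close>)
    also have "\<dots> = (C1 + C2) / c * E" using L by simp
    finally show ?case using D0 by (auto simp: E_def)
  qed
  then show ?thesis using 1 2 c c3 by (intro exI[of _ "(C1 + C2) / c"] conjI exI[of _ c3]) auto
qed

text \<open>At \<open>\<theta> = pi\<close> and \<open>A = k * pi^2 / 6\<close> the radicand
  \<open>2 * A * \<theta> / t\<close> is \<open>pi^3 * k / (3 * t)\<close>.\<close>

lemma Theta_eq: "t > 0 \<Longrightarrow> lam k pi t - (real k - 3) * pi / 8 = Theta k t - phi k"
proof -
  assume t: "t > 0"
  have "pi powr (3 / 2) = sqrt (pi ^ 3)"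
    by (simp add: powr_half_sqrt[symmetric] powr_powr flip: powr_numeral)
  then have "Theta k t = sqrt (pi ^ 3 * (real k / (3 * t)))" unfolding Theta_def real_sqrt_mult by simp
  also have "pi ^ 3 * (real k / (3 * t)) = 2 * (real k * pi\<^sup>2 / 6) * pi / t"
    by (simp add: power2_eq_square power3_eq_cube)
  finally show ?thesis by (simp add: phi_def)
qed

text \<open>At \<open>pi\<close> the two integrals are complex conjugate, so the sum is twice a real
  part. The amplitude is quantified before \<open>\<alpha>\<close> because it has to cancel between
  numerator and denominator.\<close>

lemma twist_sum_pi:
  assumes k: "k \<ge> 1"
  shows "\<exists>C>0. \<exists>t0>0. \<forall>t. 0 < t \<and> t \<le> t0 \<longrightarrow> (\<exists>A>0. \<forall>\<alpha>. 0 < \<alpha> \<and> \<alpha> \<le> 1 \<longrightarrow>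
     (\<exists>e. \<bar>e\<bar> \<le> C * sqrt t \<and> twist_sum k t \<alpha> pi = of_real (A * (cos (Theta k t - phi k - pi * \<alpha>) + e))))"
proof -
  obtain Am t0 C c where I: "0 < t0" "t0 \<le> 1" "C > 0" "c > (0::real)"
     "\<And>t. 0 < t \<Longrightarrow> t \<le> t0 \<Longrightarrow> c * exp (- lam k pi t) \<le> Am t"
     "\<And>t. 0 < t \<Longrightarrow> t \<le> t0 \<Longrightarrow> norm (ray_int k t pi - of_real (Am t) * cis (lam k pi t - (real k - 3) * pi / 8)) \<le> C * sqrt t * Am t"
    using ray_int_asymp[OF k pi_gt_zero] by metis
  obtain D e where D: "D > 0" "e > 0" "\<And>t \<alpha> \<theta>''. 0 < t \<Longrightarrow> t \<le> 1 \<Longrightarrow> 0 < \<alpha> \<Longrightarrow> \<alpha> \<le> 1 \<Longrightarrow> 3 * pi \<le> \<theta>'' \<Longrightarrow>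
    norm (ap_int k t \<alpha> \<theta>'') \<le> D * exp (- (e / sqrt t)) * exp (- lam k pi t)"
    using ap_int_small[OF k, of pi "3 * pi"] by auto
  \<comment> \<open>The second summand converts the integral of frequency \<open>3 * pi\<close>:
    \<open>exp (- (e / sqrt t)) <= sqrt t / e\<close>, while \<open>1 / c\<close> compares
    \<open>exp (- lam k pi t)\<close> with \<open>Am t\<close>.\<close>
  define C' where "C' = C + D / c * (1 / e)"
  have "\<exists>A>0. \<forall>\<alpha>. 0 < \<alpha> \<and> \<alpha> \<le> 1 \<longrightarrow>
     (\<exists>e. \<bar>e\<bar> \<le> C' * sqrt t \<and> twist_sum k t \<alpha> pi = of_real (A * (cos (Theta k t - phi k - pi * \<alpha>) + e)))" if t: "0 < t" "t \<le> t0" for t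
  proof (rule exI[of _ "2 * Am t"], intro conjI allI impI)
    define L where "L = exp (- lam k pi t)"
    have L: "L > 0" by (simp add: L_def)
    have AmL: "c * L \<le> Am t" using I(5)[OF t] by (simp add: L_def)
    then have Am: "Am t > 0" using mult_pos_pos[OF I(4) L] by linarith
    then show "2 * Am t > 0" by simp
    fix \<alpha> :: real assume "0 < \<alpha> \<and> \<alpha> \<le> 1"
    then have \<alpha>: "0 < \<alpha>" "\<alpha> \<le> 1" by auto
    define \<psi> where "\<psi> = Theta k t - phi k"
    define R where "R = ray_int k t pi - of_real (Am t) * cis \<psi>"
    define w where "w = exp (- (\<i> * of_real (pi * \<alpha>))) * R + ap_int k t \<alpha> (3 * pi)"
    have R: "norm R \<le> C * sqrt t * Am t"
      using I(6)[OF t] Theta_eq[OF t(1), of k] by (simp add: R_def \<psi>_def)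
    have "ap_int k t \<alpha> pi = exp (- (\<i> * of_real (pi * \<alpha>))) * (of_real (Am t) * cis \<psi> + R) + ap_int k t \<alpha> (3 * pi)"
      using ap_int_split(2)[OF k t(1) \<alpha>, of pi] by (simp add: R_def)
    also have "\<dots> = of_real (Am t) * (exp (- (\<i> * of_real (pi * \<alpha>))) * cis \<psi>) + w"
      by (simp add: w_def algebra_simps)
    also have "exp (- (\<i> * of_real (pi * \<alpha>))) * cis \<psi> = cis (\<psi> - pi * \<alpha>)"
      unfolding cis_conv_exp mult_exp_exp by (rule arg_cong[of _ _ exp]) (simp add: algebra_simps)
    finally have P: "ap_int k t \<alpha> pi = of_real (Am t) * cis (\<psi> - pi * \<alpha>) + w" .
    have "norm w \<le> norm R + norm (ap_int k t \<alpha> (3 * pi))"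
      unfolding w_def using norm_triangle_ineq[of "exp (- (\<i> * of_real (pi * \<alpha>))) * R" "ap_int k t \<alpha> (3 * pi)"] by (simp add: norm_mult)
    also have "norm (ap_int k t \<alpha> (3 * pi)) \<le> D / c * (1 / e) * sqrt t * Am t"
    proof -
      have "norm (ap_int k t \<alpha> (3 * pi)) \<le> D * exp (- (e / sqrt t)) * L"
        unfolding L_def using t I \<alpha> by (intro D(3)) auto
      also have "\<dots> \<le> D * (sqrt t / e) * L"
      proof (intro mult_right_mono mult_left_mono)
        have "e / sqrt t \<le> exp (e / sqrt t)" using exp_ge_add_one_self[of "e / sqrt t"] by linarith
        then have "1 / exp (e / sqrt t) \<le> 1 / (e / sqrt t)" using D t by (intro divide_left_mono) auto
        then show "exp (- (e / sqrt t)) \<le> sqrt t / e" by (simp add: exp_minus inverse_eq_divide)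
      qed (use D L in auto)
      also have "\<dots> \<le> D * (sqrt t / e) * (Am t / c)"
        using D t AmL I(4) by (intro mult_left_mono) (auto simp: field_simps)
      finally show ?thesis by (simp add: mult_ac)
    qed
    also have "norm R + D / c * (1 / e) * sqrt t * Am t \<le> C' * sqrt t * Am t"
      using R by (simp add: C'_def distrib_right)
    finally have w: "norm w \<le> C' * sqrt t * Am t" by simp
    have "twist_sum k t \<alpha> pi = of_real (2 * Re (ap_int k t \<alpha> pi))"
      by (simp add: twist_sum_def complex_add_cnj)
    also have "Re (ap_int k t \<alpha> pi) = Am t * cos (\<psi> - pi * \<alpha>) + Re w" unfolding P by simp
    finally have "twist_sum k t \<alpha> pi = of_real (2 * Am t * (cos (\<psi> - pi * \<alpha>) + Re w / Am t))"
      using Am by (simp add: field_simps)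
    moreover have "\<bar>Re w / Am t\<bar> \<le> C' * sqrt t"
    proof -
      have "\<bar>Re w\<bar> \<le> C' * sqrt t * Am t" using abs_Re_le_cmod[of w] w by linarith
      then have "\<bar>Re w\<bar> / Am t \<le> C' * sqrt t" using Am by (subst pos_divide_le_eq) auto
      then show ?thesis using Am unfolding abs_divide by simp
    qed
    ultimately show "\<exists>e. \<bar>e\<bar> \<le> C' * sqrt t \<and> twist_sum k t \<alpha> pi = of_real (2 * Am t * (cos (Theta k t - phi k - pi * \<alpha>) + e))"
      unfolding \<psi>_def by blast
  qed
  moreover have "C' > 0" using I D by (auto simp: C'_def intro!: add_pos_pos mult_pos_pos)
  ultimately show ?thesis using I(1) by blast
qed

text \<open>The denominator has phase shifted by pi, hence main part \<open>- cos \<psi>\<close>,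
  and the addition theorem for \<open>cos (\<psi> - pi * \<alpha>)\<close> gives the tangent.
  Comparing the perturbed with the unperturbed quotient divides by both denominators, each of order
  at least \<open>\<delta>\<close>, hence \<open>\<delta>\<close> squared.\<close>

lemma ratio_pi:
  assumes k: "k \<ge> 1" and \<alpha>: "0 < \<alpha>" "\<alpha> \<le> 1"
  shows "\<exists>C>0. \<exists>c>0. \<forall>\<delta> t. 0 < \<delta> \<and> \<delta> \<le> 1 \<and> 0 < t \<and> \<bar>cos (Theta k t - phi k)\<bar> \<ge> \<delta> \<and> sqrt t \<le> c * \<delta> \<longrightarrow>
     twist_sum k t 1 pi \<noteq> 0 \<and>
     norm (twist_sum k t \<alpha> pi / twist_sum k t 1 pi - of_real (- (cos (pi * \<alpha>) + sin (pi * \<alpha>) * tan (Theta k t - phi k)))) \<le> C * (sqrt t / \<delta>\<^sup>2)"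
proof -
  obtain C t0 where C: "C > 0" "t0 > 0" "\<And>t. 0 < t \<Longrightarrow> t \<le> t0 \<Longrightarrow> (\<exists>A>0. \<forall>\<alpha>. 0 < \<alpha> \<and> \<alpha> \<le> 1 \<longrightarrow>
     (\<exists>e. \<bar>e\<bar> \<le> C * sqrt t \<and> twist_sum k t \<alpha> pi = of_real (A * (cos (Theta k t - phi k - pi * \<alpha>) + e))))"
    using twist_sum_pi[OF k] by metis
  \<comment> \<open>As \<open>\<delta> <= 1\<close>, the first entry keeps \<open>t\<close> below
    \<open>t0\<close>; the second makes the error \<open>C * sqrt t\<close> at most
    \<open>\<delta> / 2\<close>, half of the cosine's lower bound.\<close>
  define c where "c = min (sqrt t0) (1 / (2 * C))"
  have c: "c > 0" using C by (simp add: c_def)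
  have "twist_sum k t 1 pi \<noteq> 0 \<and>
     norm (twist_sum k t \<alpha> pi / twist_sum k t 1 pi - of_real (- (cos (pi * \<alpha>) + sin (pi * \<alpha>) * tan (Theta k t - phi k)))) \<le> 4 * C * (sqrt t / \<delta>\<^sup>2)"
    if h: "0 < \<delta>" "\<delta> \<le> 1" "0 < t" "\<bar>cos (Theta k t - phi k)\<bar> \<ge> \<delta>" "sqrt t \<le> c * \<delta>" for \<delta> t
  proof -
    define \<psi> where "\<psi> = Theta k t - phi k"
    define x where "x = cos (\<psi> - pi * \<alpha>)"
    define y where "y = cos \<psi>"
    have y: "\<bar>y\<bar> \<ge> \<delta>" using h by (simp add: y_def \<psi>_def)
    then have y0: "y \<noteq> 0" using h by auto
    have "c * \<delta> \<le> sqrt t0 * 1" using h c by (intro mult_mono) (auto simp: c_def)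
    then have "sqrt t \<le> sqrt t0" using h by linarith
    then have "t \<le> t0" by simp
    then obtain A where A: "A > 0" "\<And>\<alpha>. 0 < \<alpha> \<Longrightarrow> \<alpha> \<le> 1 \<Longrightarrow>
     (\<exists>e. \<bar>e\<bar> \<le> C * sqrt t \<and> twist_sum k t \<alpha> pi = of_real (A * (cos (\<psi> - pi * \<alpha>) + e)))"
      using C(3)[OF h(3)] unfolding \<psi>_def by blast
    obtain e1 where e1: "\<bar>e1\<bar> \<le> C * sqrt t" "twist_sum k t \<alpha> pi = of_real (A * (x + e1))"
      using A(2)[OF \<alpha>] unfolding x_def by blast
    obtain e2 where e2: "\<bar>e2\<bar> \<le> C * sqrt t" "twist_sum k t 1 pi = of_real (A * (- y + e2))"
      using A(2)[of 1] unfolding y_def by auto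
    have "C * sqrt t \<le> C * (1 / (2 * C) * \<delta>)"
    proof -
      have "c * \<delta> \<le> 1 / (2 * C) * \<delta>" using h by (intro mult_right_mono) (auto simp: c_def)
      then show ?thesis using C h by (intro mult_left_mono) auto
    qed
    then have half: "C * sqrt t \<le> \<delta> / 2" using C by simp
    have den: "\<bar>- y + e2\<bar> \<ge> \<delta> / 2" using y e2(1) half by linarith
    then have den0: "- y + e2 \<noteq> 0" using h by auto
    have tgt: "- (cos (pi * \<alpha>) + sin (pi * \<alpha>) * tan \<psi>) = - (x / y)"
      using y0 unfolding x_def y_def cos_diff tan_def by (simp add: field_simps)
    have "(x + e1) / (- y + e2) - (- (x / y)) = (e1 * y + x * e2) / ((- y + e2) * y)"
      using y0 den0 by (simp add: field_simps)
    then have "\<bar>(x + e1) / (- y + e2) - (- (x / y))\<bar> = \<bar>e1 * y + x * e2\<bar> / (\<bar>- y + e2\<bar> * \<bar>y\<bar>)"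
      by (simp add: abs_mult)
    also have "\<dots> \<le> (2 * (C * sqrt t)) / (\<delta> / 2 * \<delta>)"
    proof (rule frac_le)
      have "\<bar>e1 * y\<bar> \<le> C * sqrt t * 1" unfolding abs_mult using e1 by (intro mult_mono) (auto simp: y_def)
      moreover have "\<bar>x * e2\<bar> \<le> 1 * (C * sqrt t)" unfolding abs_mult using e2 by (intro mult_mono) (auto simp: x_def)
      ultimately show "\<bar>e1 * y + x * e2\<bar> \<le> 2 * (C * sqrt t)" using abs_triangle_ineq[of "e1 * y" "x * e2"] by linarith
      show "\<delta> / 2 * \<delta> \<le> \<bar>- y + e2\<bar> * \<bar>y\<bar>" using den y h by (intro mult_mono) auto
    qed (use C h in auto)
    also have "\<dots> = 4 * C * (sqrt t / \<delta>\<^sup>2)" by (simp add: power2_eq_square)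
    finally have b: "\<bar>(x + e1) / (- y + e2) - (- (x / y))\<bar> \<le> 4 * C * (sqrt t / \<delta>\<^sup>2)" .
    have "twist_sum k t \<alpha> pi / twist_sum k t 1 pi = of_real ((x + e1) / (- y + e2))"
    proof -
      have "twist_sum k t \<alpha> pi / twist_sum k t 1 pi = of_real ((A * (x + e1)) / (A * (- y + e2)))"
        unfolding e1(2) e2(2) by (rule of_real_divide[symmetric])
      also have "(A * (x + e1)) / (A * (- y + e2)) = (x + e1) / (- y + e2)" using A(1) by simp
      finally show ?thesis .
    qed
    then have "norm (twist_sum k t \<alpha> pi / twist_sum k t 1 pi - of_real (- (cos (pi * \<alpha>) + sin (pi * \<alpha>) * tan \<psi>))) \<le> 4 * C * (sqrt t / \<delta>\<^sup>2)"
      using b unfolding tgt by (simp only: of_real_diff[symmetric] norm_of_real)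
    moreover have "twist_sum k t 1 pi \<noteq> 0" unfolding e2(2) using A(1) den0 by simp
    ultimately show ?thesis unfolding \<psi>_def by blast
  qed
  then show ?thesis using C(1) c by (intro exI[of _ "4 * C"] conjI exI[of _ c]) auto
qed

section \<open>Roots of unity\<close>

lemma dirichlet_kernel: "sin (y / 2) * (1 + 2 * (\<Sum>i = 1..n. cos (real i * y))) = sin ((real n + 1 / 2) * y)"
proof (induction n)
  case (Suc n)
  have p: "(real (Suc n) + 1 / 2) * y = real (Suc n) * y + y / 2" "(real n + 1 / 2) * y = real (Suc n) * y - y / 2"
    by (simp_all add: algebra_simps)
  have "sin (y / 2) * (1 + 2 * (\<Sum>i = 1..Suc n. cos (real i * y))) = sin ((real n + 1 / 2) * y) + 2 * sin (y / 2) * cos (real (Suc n) * y)"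
    using Suc.IH by (simp add: algebra_simps del: of_nat_Suc)
  also have "\<dots> = sin ((real (Suc n) + 1 / 2) * y)"
    unfolding p sin_add sin_diff by simp
  finally show ?case .
qed simp

text \<open>The angle of a \<open>d\<close>-th root of unity, normalised to \<open>(- pi, pi]\<close>.\<close>

definition root_ang :: "nat \<Rightarrow> nat \<Rightarrow> real" where
  "root_ang d j = (if 2 * j \<le> d then 2 * pi * real j / real d else 2 * pi * real j / real d - 2 * pi)"

text \<open>Without the index \<open>d / 2\<close> the others are 0 and pairs \<open>i\<close>,
  \<open>d - i\<close> with opposite angles, which combine to cosines. The factor \<open>b\<close>
  need not be an integer, so the choice of angle modulo \<open>2 * pi\<close> matters.\<close>

lemma sum_cis_root_ang:
  assumes d: "d > 0" and y: "y = 2 * pi * b / real d"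
  shows "(\<Sum>j | j < d \<and> 2 * j \<noteq> d. cis (b * root_ang d j)) = of_real (1 + 2 * (\<Sum>i = 1..(d - 1) div 2. cos (real i * y)))"
proof -
  define n where "n = (d - 1) div 2"
  have S: "{j. j < d \<and> 2 * j \<noteq> d} = {0..n} \<union> (\<lambda>i. d - i) ` {1..n}"
  proof (intro set_eqI iffI)
    fix j assume j: "j \<in> {j. j < d \<and> 2 * j \<noteq> d}"
    show "j \<in> {0..n} \<union> (\<lambda>i. d - i) ` {1..n}"
    proof (cases "2 * j < d")
      case True
      then show ?thesis by (auto simp: n_def)
    next
      case False
      then have "d - j \<in> {1..n}" "j = d - (d - j)" using j by (auto simp: n_def)
      then show ?thesis by blast
    qed
  next
    fix j assume "j \<in> {0..n} \<union> (\<lambda>i. d - i) ` {1..n}"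
    then show "j \<in> {j. j < d \<and> 2 * j \<noteq> d}" using d by (auto simp: n_def)
  qed
  have disj: "{0..n} \<inter> (\<lambda>i. d - i) ` {1..n} = {}" using d by (auto simp: n_def)
  have inj: "inj_on (\<lambda>i. d - i) {1..n}" using d by (auto simp: inj_on_def n_def)
  have a1: "b * root_ang d i = real i * y" if "i \<le> n" for i
    using that d y by (auto simp: root_ang_def n_def)
  have a2: "b * root_ang d (d - i) = - (real i * y)" if "1 \<le> i" "i \<le> n" for i
  proof -
    have "\<not> 2 * (d - i) \<le> d" using that d by (auto simp: n_def)
    moreover have "real (d - i) = real d - real i" using that by (intro of_nat_diff) (auto simp: n_def)
    ultimately show ?thesis using d y by (simp add: root_ang_def field_simps)
  qed
  have "(\<Sum>j | j < d \<and> 2 * j \<noteq> d. cis (b * root_ang d j)) = (\<Sum>j = 0..n. cis (b * root_ang d j)) + (\<Sum>j\<in>(\<lambda>i. d - i) ` {1..n}. cis (b * root_ang d j))"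
    unfolding S by (rule sum.union_disjoint) (use disj in auto)
  also have "(\<Sum>j\<in>(\<lambda>i. d - i) ` {1..n}. cis (b * root_ang d j)) = (\<Sum>i = 1..n. cis (- (real i * y)))"
    by (subst sum.reindex[OF inj]) (auto intro!: sum.cong simp: a2)
  also have "(\<Sum>j = 0..n. cis (b * root_ang d j)) = (\<Sum>i = 0..n. cis (real i * y))"
    by (intro sum.cong) (auto simp: a1)
  also have "\<dots> = 1 + (\<Sum>i = 1..n. cis (real i * y))"
    by (simp add: sum.atLeast_Suc_atMost)
  also have "1 + (\<Sum>i = 1..n. cis (real i * y)) + (\<Sum>i = 1..n. cis (- (real i * y))) = 1 + (\<Sum>i = 1..n. cis (real i * y) + cis (- (real i * y)))"
    by (simp add: sum.distrib)
  also have "\<dots> = 1 + (\<Sum>i = 1..n. of_real (2 * cos (real i * y)))"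
    by (intro arg_cong2[of _ _ _ _ "(+)"] sum.cong) (auto simp: complex_eq_iff)
  also have "\<dots> = of_real (1 + 2 * (\<Sum>i = 1..n. cos (real i * y)))"
    by (simp add: sum_distrib_left)
  finally show ?thesis by (simp add: n_def)
qed

text \<open>The Dirichlet kernel at \<open>2 * x\<close>: \<open>n + 1 / 2\<close> is
  \<open>d / 2\<close> for odd and \<open>(d - 1) / 2\<close> for even \<open>d\<close>, so its sine
  is taken at \<open>pi * b\<close> or at \<open>pi * b - x\<close>. The surplus
  \<open>cos (pi / a)\<close> in the even case is later cancelled by the root - 1.\<close>

lemma sum_cis_value:
  fixes a d :: nat
  assumes "a \<ge> 2" "d \<ge> 2"
  defines "x \<equiv> pi * (real a - 1) / (real a * real d)"
  shows "sin x > 0"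
    and "(\<Sum>j | j < d \<and> 2 * j \<noteq> d. cis (root_ang d j * (1 - 1 / real a))) =
      of_real (if odd d then sin (pi / real a) / sin x else sin (pi / real a) * cot x + cos (pi / real a))"
proof -
  define b where "b = 1 - 1 / real a"
  have b: "0 < b" "b < 1" using assms by (auto simp: b_def)
  have x: "x = pi * b / real d" using assms by (simp add: x_def b_def field_simps)
  have "0 < x" "x < pi"
  proof -
    show "0 < x" using b assms by (simp add: x)
    have "pi * b / real d < pi * 1 / 1" using b assms by (intro frac_less2 mult_pos_pos) auto
    then show "x < pi" by (simp add: x)
  qed
  then show sx: "sin x > 0" by (intro sin_gt_zero)
  define n where "n = (d - 1) div 2"
  define V where "V = 1 + 2 * (\<Sum>i = 1..n. cos (real i * (2 * x)))"
  have V: "(\<Sum>j | j < d \<and> 2 * j \<noteq> d. cis (b * root_ang d j)) = of_real V"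
    unfolding V_def n_def
  proof (rule sum_cis_root_ang)
    show "d > 0" using assms(2) by simp
    show "2 * x = 2 * pi * b / real d" unfolding x by simp
  qed
  have dk: "sin x * V = sin ((real n + 1 / 2) * (2 * x))"
    using dirichlet_kernel[of "2 * x" n] by (simp add: V_def)
  have sb: "sin (pi * b) = sin (pi / real a)" "cos (pi * b) = - cos (pi / real a)"
  proof -
    have "pi * b = pi - pi / real a" by (simp add: b_def algebra_simps)
    then show "sin (pi * b) = sin (pi / real a)" "cos (pi * b) = - cos (pi / real a)" by (simp_all add: cos_diff)
  qed
  have dx: "real d * x = pi * b" unfolding x using assms(2) by simp
  have "V = (if odd d then sin (pi / real a) / sin x else sin (pi / real a) * cot x + cos (pi / real a))"
  proof (cases "odd d")
    case True
    then have "real d = 2 * real n + 1" by (auto simp: n_def elim!: oddE)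
    then have "(real n + 1 / 2) * (2 * x) = real d * x" by (simp add: algebra_simps)
    then have "sin x * V = sin (pi / real a)" using dk by (simp add: dx sb)
    then show ?thesis using True sx by (simp add: field_simps)
  next
    case False
    then obtain e where e: "d = 2 * e" by auto
    have "real d = 2 * real n + 2" using assms(2) e by (cases e) (auto simp: n_def)
    then have "(real n + 1 / 2) * (2 * x) = pi * b - x" unfolding dx[symmetric] by (simp add: algebra_simps)
    then have "sin x * V = sin (pi / real a) * cos x + cos (pi / real a) * sin x" using dk by (simp add: sin_diff sb)
    then show ?thesis using False sx by (simp add: cot_def field_simps)
  qed
  then show "(\<Sum>j | j < d \<and> 2 * j \<noteq> d. cis (root_ang d j * (1 - 1 / real a))) =
      of_real (if odd d then sin (pi / real a) / sin x else sin (pi / real a) * cot x + cos (pi / real a))"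
    using V by (simp add: b_def mult.commute)
qed

section \<open>Holomorphy of the series and regularity of \<open>W\<close>\<close>

lemma holomorphic_Fk_series:
  fixes e :: "nat \<Rightarrow> nat" and z :: complex
  assumes e: "\<And>m. e m > m" and z: "norm z = 1"
  shows "(\<lambda>x. \<Sum>m. z ^ m * Fk k (of_nat (e m) * x)) holomorphic_on {x. Re x > 0}"
proof (rule holomorphic_uniform_sequence[OF open_halfspace_Re_gt, where f = "\<lambda>n x. \<Sum>m<n. z ^ m * Fk k (of_nat (e m) * x)"])
  show "(\<lambda>x. \<Sum>m<n. z ^ m * Fk k (of_nat (e m) * x)) holomorphic_on {x. Re x > 0}" for n
  proof (intro holomorphic_intros)
    fix m
    have "e m > 0" using e[of m] by simp
    have "(Fk k \<circ> (\<lambda>x. of_nat (e m) * x)) holomorphic_on {x. Re x > 0}"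
      by (rule holomorphic_on_compose_gen[OF _ holomorphic_Fk]) (use \<open>e m > 0\<close> in \<open>auto intro!: holomorphic_intros\<close>)
    then show "(\<lambda>x. Fk k (of_nat (e m) * x)) holomorphic_on {x. Re x > 0}" by (simp add: o_def)
  qed
  fix x :: complex assume "x \<in> {x. Re x > 0}"
  then have x: "Re x > 0" by simp
  define \<rho> where "\<rho> = Re x / 2"
  have \<rho>: "\<rho> > 0" using x by (simp add: \<rho>_def)
  have re: "Re y \<ge> \<rho>" if "y \<in> cball x \<rho>" for y
    using that abs_Re_le_cmod[of "x - y"] by (simp add: dist_norm \<rho>_def)
  show "\<exists>r>0. cball x r \<subseteq> {x. Re x > 0} \<and>
     uniform_limit (cball x r) (\<lambda>n x. \<Sum>m<n. z ^ m * Fk k (of_nat (e m) * x)) (\<lambda>x. \<Sum>m. z ^ m * Fk k (of_nat (e m) * x)) sequentially"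
  proof (intro exI[of _ \<rho>] conjI)
    show "cball x \<rho> \<subseteq> {x. Re x > 0}" using re \<rho> by force
    show "uniform_limit (cball x \<rho>) (\<lambda>n x. \<Sum>m<n. z ^ m * Fk k (of_nat (e m) * x)) (\<lambda>x. \<Sum>m. z ^ m * Fk k (of_nat (e m) * x)) sequentially"
    proof (rule Weierstrass_m_test)
      define B where "B = exp (real k * (pi\<^sup>2 / (6 * \<rho>)))"
      show "norm (z ^ m * Fk k (of_nat (e m) * y)) \<le> B * exp (- \<rho>) ^ m" if y: "y \<in> cball x \<rho>" for m y
      proof -
        \<comment> \<open>The hypothesis \<open>e m > m\<close> serves twice:
          \<open>e m >= 1\<close> keeps the argument away from the tip, \<open>e m >= m\<close>
          yields a geometric majorant.\<close>
        have em: "real (e m) \<ge> 1" "real (e m) \<ge> real m" using e[of m] by auto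
        have r: "Re (of_nat (e m) * y) \<ge> \<rho>" "Re (of_nat (e m) * y) \<ge> real m * \<rho>"
        proof -
          show "Re (of_nat (e m) * y) \<ge> real m * \<rho>" using re[OF y] em \<rho> by (simp add: mult_mono)
          have "1 * \<rho> \<le> real (e m) * Re y" using re[OF y] em \<rho> by (intro mult_mono) auto
          then show "Re (of_nat (e m) * y) \<ge> \<rho>" by simp
        qed
        have "norm (z ^ m * Fk k (of_nat (e m) * y)) = norm (Fk k (of_nat (e m) * y))"
          by (simp add: norm_mult norm_power z)
        also have "\<dots> \<le> exp (- Re (of_nat (e m) * y) + real k * (pi\<^sup>2 / (6 * Re (of_nat (e m) * y))))"
          using r \<rho> by (intro norm_Fk_le) linarith
        also have "\<dots> \<le> exp (- (real m * \<rho>) + real k * (pi\<^sup>2 / (6 * \<rho>)))"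
        proof -
          have "pi\<^sup>2 / (6 * Re (of_nat (e m) * y)) \<le> pi\<^sup>2 / (6 * \<rho>)" using r(1) \<rho> by (intro frac_le) auto
          then have "real k * (pi\<^sup>2 / (6 * Re (of_nat (e m) * y))) \<le> real k * (pi\<^sup>2 / (6 * \<rho>))" by (intro mult_left_mono) auto
          then show ?thesis using r(2) unfolding exp_le_cancel_iff by linarith
        qed
        also have "\<dots> = B * exp (- \<rho>) ^ m"
          by (simp add: B_def exp_of_nat_mult[symmetric] mult_exp_exp)
        finally show ?thesis .
      qed
      show "summable (\<lambda>m. B * exp (- \<rho>) ^ m)" using \<rho> by (intro summable_mult summable_geometric) auto
    qed
  qed (use \<rho> in auto)
qed

lemma W_num_exp: "W_num a k z (exp (- x)) = (\<Sum>m. z ^ m * Fk k (of_nat (a * m + 1) * x))"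
  unfolding W_num_def Fk_def by (intro arg_cong[of _ _ suminf] ext) (simp only: exp_of_nat_mult[symmetric] mult_minus_right mult.assoc)

lemma W_den_exp: "W_den a k z (exp (- x)) = (\<Sum>m. z ^ m * Fk k (of_nat (a * (m + 1)) * x))"
  unfolding W_den_def Fk_def by (intro arg_cong[of _ _ suminf] ext) (simp only: exp_of_nat_mult[symmetric] mult_minus_right mult.assoc)

text \<open>Where no denominator vanishes, the pointwise formula is analytic, so repairing
  singularities changes nothing at that point and no pole can occur.\<close>

lemma W_regular:
  fixes t :: real
  assumes a: "a \<ge> 2" and d: "d \<ge> 2" and t: "t > 0"
    and nz: "\<And>z. z ^ d = 1 \<Longrightarrow> W_den a k z (exp (- of_real (t / real a))) \<noteq> 0"
  defines "q0 \<equiv> of_real (exp (- t / real a)) :: complex"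
  shows "\<not> is_pole (\<lambda>q. W a d q k) q0"
    and "W a d q0 k = 1 / of_nat d * (\<Sum>z | z ^ d = 1. W_num a k z q0 / W_den a k z q0)"
proof -
  define f where "f q = 1 / of_nat d * (\<Sum>z | z ^ d = 1. W_num a k z q / W_den a k z q)" for q
  \<comment> \<open>On the right half of the unit disc \<open>- Ln q\<close> is holomorphic with
    positive real part, which transports holomorphy from \<open>x\<close> back to
    \<open>q\<close>.\<close>
  define U where "U = ball 0 1 \<inter> {q::complex. Re q > 0}"
  have U: "open U" unfolding U_def by (intro open_Int open_ball open_halfspace_Re_gt)
  have q0: "q0 = exp (- of_real (t / real a))" by (simp add: q0_def exp_of_real[symmetric])
  have q0U: "q0 \<in> U" using t a by (auto simp: U_def q0_def)
  have nU: "q \<noteq> 0" "Re (- Ln q) > 0" "exp (- (- Ln q)) = q" if "q \<in> U" for q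
  proof -
    show q: "q \<noteq> 0" using that by (auto simp: U_def)
    then have "ln (norm q) < 0" using that by (simp add: U_def)
    then show "Re (- Ln q) > 0" using q by simp
    show "exp (- (- Ln q)) = q" using q by simp
  qed
  have hL: "(\<lambda>q. - Ln q) holomorphic_on U"
    by (intro holomorphic_intros) (auto simp: U_def complex_nonpos_Reals_iff)
  have nz1: "norm z = 1" if "z ^ d = 1" for z :: complex
    using that d by (metis norm_power norm_one power_eq_1_iff norm_ge_zero power_eq_imp_eq_norm less_le_trans zero_less_numeral power_one)
  have hn: "W_num a k z holomorphic_on U" if "z ^ d = 1" for z
  proof -
    have "(\<lambda>x. \<Sum>m. z ^ m * Fk k (of_nat (a * m + 1) * x)) holomorphic_on {x. Re x > 0}"
      using a by (intro holomorphic_Fk_series nz1 that) (auto simp: less_Suc_eq_le)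
    then have "((\<lambda>x. \<Sum>m. z ^ m * Fk k (of_nat (a * m + 1) * x)) \<circ> (\<lambda>q. - Ln q)) holomorphic_on U"
      by (rule holomorphic_on_compose_gen[OF hL]) (use nU in auto)
    then show ?thesis by (rule holomorphic_transform) (use nU(3) W_num_exp in \<open>metis o_apply\<close>)
  qed
  have hd: "W_den a k z holomorphic_on U" if "z ^ d = 1" for z
  proof -
    have "(\<lambda>x. \<Sum>m. z ^ m * Fk k (of_nat (a * (m + 1)) * x)) holomorphic_on {x. Re x > 0}"
    proof (intro holomorphic_Fk_series nz1 that)
      show "a * (m + 1) > m" for m using a mult_le_mono1[of 1 a "m + 1"] by simp
    qed
    then have "((\<lambda>x. \<Sum>m. z ^ m * Fk k (of_nat (a * (m + 1)) * x)) \<circ> (\<lambda>q. - Ln q)) holomorphic_on U"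
      by (rule holomorphic_on_compose_gen[OF hL]) (use nU in auto)
    then show ?thesis by (rule holomorphic_transform) (use nU(3) W_den_exp in \<open>metis o_apply\<close>)
  qed
  have an: "f analytic_on {q0}"
  proof -
    have "W_num a k z analytic_on {q0}" "W_den a k z analytic_on {q0}" if "z ^ d = 1" for z
      using hn[OF that] hd[OF that] U q0U analytic_at by blast+
    then show ?thesis unfolding f_def
      by (intro analytic_intros) (use nz q0 in auto)
  qed
  have W: "(\<lambda>q. W a d q k) = remove_sings f" by (rule ext) (simp add: W_def f_def[abs_def])
  show "\<not> is_pole (\<lambda>q. W a d q k) q0"
    unfolding W
    using analytic_at_imp_no_pole analytic_at_cong[OF eventually_remove_sings_eq_nhds[OF an] refl] an by blast
  have "W a d q0 k = remove_sings f q0" using fun_cong[OF W] by simp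
  then show "W a d q0 k = 1 / of_nat d * (\<Sum>z | z ^ d = 1. W_num a k z q0 / W_den a k z q0)"
    using an by (simp add: f_def)
qed

section \<open>The asymptotic formulas\<close>

lemma W_num_den_twist_sum:
  assumes k: "k \<ge> 1" and a: "a \<ge> 2" and t: "t > 0" and \<theta>: "0 \<le> \<theta>" "\<theta> \<le> 2 * pi"
  shows "W_num a k (cis \<theta>) (exp (- of_real (t / real a))) = twist_sum k t (1 / real a) \<theta>"
    and "W_den a k (cis \<theta>) (exp (- of_real (t / real a))) = twist_sum k t 1 \<theta>"
proof -
  have c: "cis \<theta> ^ m = exp (\<i> * of_real \<theta> * of_nat m)" for m
    by (simp add: cis_conv_exp exp_of_nat_mult[symmetric] mult_ac)
  have "of_nat (a * m + 1) * complex_of_real (t / real a) = of_real (t * (real m + 1 / real a))" for m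
  proof -
    have "real (a * m + 1) * (t / real a) = t * (real m + 1 / real a)" using a by (simp add: field_simps)
    then show ?thesis by (metis of_real_mult of_real_of_nat_eq)
  qed
  then have "W_num a k (cis \<theta>) (exp (- of_real (t / real a))) = (\<Sum>m. exp (\<i> * of_real \<theta> * of_nat m) * Fk k (of_real (t * (real m + 1 / real a))))"
    unfolding W_num_exp c by (simp only:)
  also have "\<dots> = twist_sum k t (1 / real a) \<theta>"
    unfolding twist_sum_def using Fk_sums[OF k t, of "1 / real a" \<theta>] a \<theta> by (simp add: sums_iff)
  finally show "W_num a k (cis \<theta>) (exp (- of_real (t / real a))) = twist_sum k t (1 / real a) \<theta>" .
  have "of_nat (a * (m + 1)) * complex_of_real (t / real a) = of_real (t * (real m + 1))" for m
  proof -
    have "real (a * (m + 1)) * (t / real a) = t * (real m + 1)" using a by (simp add: field_simps)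
    then show ?thesis by (metis of_real_mult of_real_of_nat_eq)
  qed
  then have "W_den a k (cis \<theta>) (exp (- of_real (t / real a))) = (\<Sum>m. exp (\<i> * of_real \<theta> * of_nat m) * Fk k (of_real (t * (real m + 1))))"
    unfolding W_den_exp c by (simp only:)
  also have "\<dots> = twist_sum k t 1 \<theta>"
    unfolding twist_sum_def using Fk_sums[OF k t, of 1 \<theta>] \<theta> by (simp add: sums_iff)
  finally show "W_den a k (cis \<theta>) (exp (- of_real (t / real a))) = twist_sum k t 1 \<theta>" .
qed

text \<open>The representative between 0 and \<open>2 * pi\<close>, as the summation formula
  requires; \<open>root_ang\<close> is the one in which the limit is expressed.\<close>

definition root_arg :: "nat \<Rightarrow> nat \<Rightarrow> real" where "root_arg d j = 2 * pi * real j / real d"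

lemma root_arg_bounds: "j < d \<Longrightarrow> 0 \<le> root_arg d j \<and> root_arg d j \<le> 2 * pi"
  by (simp add: root_arg_def divide_le_eq mult_left_mono)

lemma W_eq_sum:
  assumes k: "k \<ge> 1" and a: "a \<ge> 2" and d: "d \<ge> 2" and t: "t > 0"
    and nz: "\<And>j. j < d \<Longrightarrow> twist_sum k t 1 (root_arg d j) \<noteq> 0"
  shows "\<not> is_pole (\<lambda>q. W a d q k) (of_real (exp (- t / real a)))"
    and "W a d (of_real (exp (- t / real a))) k = 1 / of_nat d * (\<Sum>j<d. twist_sum k t (1 / real a) (root_arg d j) / twist_sum k t 1 (root_arg d j))"
proof -
  have bij: "bij_betw (\<lambda>j. cis (root_arg d j)) {..<d} {z. z ^ d = 1}"
    unfolding root_arg_def by (rule Complex.bij_betw_roots_unity) (use d in simp)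
  have q0: "of_real (exp (- t / real a)) = (exp (- of_real (t / real a)) :: complex)"
    by (simp add: exp_of_real[symmetric])
  note nd = W_num_den_twist_sum[OF k a t]
  have nzz: "W_den a k z (exp (- of_real (t / real a))) \<noteq> 0" if "z ^ d = 1" for z
  proof -
    have "z \<in> (\<lambda>j. cis (root_arg d j)) ` {..<d}" using bij_betw_imp_surj_on[OF bij] that by simp
    then obtain j where "j < d" "z = cis (root_arg d j)" by auto
    then show ?thesis using nd(2)[of "root_arg d j"] root_arg_bounds[of j d] nz[of j] by simp
  qed
  show "\<not> is_pole (\<lambda>q. W a d q k) (of_real (exp (- t / real a)))"
    by (rule W_regular(1)[OF a d t nzz])
  have "W a d (of_real (exp (- t / real a))) k = 1 / of_nat d * (\<Sum>z | z ^ d = 1. W_num a k z (exp (- of_real (t / real a))) / W_den a k z (exp (- of_real (t / real a))))"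
    using W_regular(2)[OF a d t nzz] unfolding q0 .
  also have "(\<Sum>z | z ^ d = 1. W_num a k z (exp (- of_real (t / real a))) / W_den a k z (exp (- of_real (t / real a))))
    = (\<Sum>j<d. W_num a k (cis (root_arg d j)) (exp (- of_real (t / real a))) / W_den a k (cis (root_arg d j)) (exp (- of_real (t / real a))))"
    by (rule sum.reindex_bij_betw[OF bij, symmetric])
  also have "\<dots> = (\<Sum>j<d. twist_sum k t (1 / real a) (root_arg d j) / twist_sum k t 1 (root_arg d j))"
    by (intro sum.cong) (use nd root_arg_bounds in auto)
  finally show "W a d (of_real (exp (- t / real a))) k = 1 / of_nat d * (\<Sum>j<d. twist_sum k t (1 / real a) (root_arg d j) / twist_sum k t 1 (root_arg d j))" .
qed

text \<open>Roots in the lower half-plane are reduced by conjugation to a frequency below pi, which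
  turns the limiting phase into its negative.\<close>

lemma ratio_root:
  assumes k: "k \<ge> 1" and a: "a \<ge> 2" and j: "j < d" "2 * j \<noteq> d"
  shows "\<exists>C>0. \<exists>c>0. eventually (\<lambda>t. twist_sum k t 1 (root_arg d j) \<noteq> 0 \<and>
    norm (twist_sum k t (1 / real a) (root_arg d j) / twist_sum k t 1 (root_arg d j) - cis (root_ang d j * (1 - 1 / real a))) \<le> C * exp (- (c / sqrt t))) (at_right 0)"
proof (cases "2 * j < d")
  case True
  have "root_arg d j < pi"
  proof -
    have "2 * real j < real d" using True by linarith
    then have "pi * (2 * real j) < pi * real d" by (intro mult_strict_left_mono) auto
    then show ?thesis using j by (simp add: root_arg_def divide_less_eq mult_ac)
  qed
  moreover have "root_ang d j = root_arg d j" using True by (simp add: root_ang_def root_arg_def)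
  ultimately show ?thesis using ratio_generic[OF k, of "root_arg d j" "1 / real a"] root_arg_bounds[OF j(1)] a by auto
next
  case False
  define \<theta> where "\<theta> = 2 * pi - root_arg d j"
  have \<theta>: "0 \<le> \<theta>" "\<theta> < pi"
  proof -
    show "0 \<le> \<theta>" using root_arg_bounds[OF j(1)] by (simp add: \<theta>_def)
    have "2 * real j > real d" using False j by linarith
    then have "pi * (2 * real j) > pi * real d" by (intro mult_strict_left_mono) auto
    then have "root_arg d j > pi" using j by (simp add: root_arg_def less_divide_eq mult_ac)
    then show "\<theta> < pi" by (simp add: \<theta>_def)
  qed
  have r: "root_arg d j = 2 * pi - \<theta>" by (simp add: \<theta>_def)
  have an: "root_ang d j = - \<theta>" using False j by (simp add: root_ang_def \<theta>_def root_arg_def)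
  obtain C c where C: "C > 0" "c > 0" "eventually (\<lambda>t. twist_sum k t 1 \<theta> \<noteq> 0 \<and>
    norm (twist_sum k t (1 / real a) \<theta> / twist_sum k t 1 \<theta> - cis (\<theta> * (1 - 1 / real a))) \<le> C * exp (- (c / sqrt t))) (at_right 0)"
    using ratio_generic[OF k \<theta>, of "1 / real a"] a by auto
  have "cnj w / cnj z - cis (- \<theta> * y) = cnj (w / z - cis (\<theta> * y))" for w z y
    by (simp add: cis_cnj)
  then have "norm (cnj w / cnj z - cis (- \<theta> * y)) = norm (w / z - cis (\<theta> * y))" for w z y
    by (metis complex_mod_cnj)
  then show ?thesis using C unfolding r an twist_sum_reflect complex_cnj_zero_iff by auto
qed

definition main_part :: "nat \<Rightarrow> nat \<Rightarrow> nat \<Rightarrow> real \<Rightarrow> complex" where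
  "main_part a d k t = (\<Sum>j | j < d \<and> 2 * j \<noteq> d. twist_sum k t (1 / real a) (root_arg d j) / twist_sum k t 1 (root_arg d j))"

lemma main_part_asymp:
  assumes k: "k \<ge> 1" and a: "a \<ge> 2"
  shows "\<exists>C>0. \<exists>c>0. eventually (\<lambda>t. (\<forall>j. j < d \<and> 2 * j \<noteq> d \<longrightarrow> twist_sum k t 1 (root_arg d j) \<noteq> 0) \<and>
    norm (main_part a d k t - (\<Sum>j | j < d \<and> 2 * j \<noteq> d. cis (root_ang d j * (1 - 1 / real a)))) \<le> C * exp (- (c / sqrt t))) (at_right 0)"
proof -
  define J where "J = {j. j < d \<and> 2 * j \<noteq> d}"
  have J: "finite J" by (simp add: J_def)
  define Q where "Q j C c \<longleftrightarrow> eventually (\<lambda>t. twist_sum k t 1 (root_arg d j) \<noteq> 0 \<and>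
    norm (twist_sum k t (1 / real a) (root_arg d j) / twist_sum k t 1 (root_arg d j) - cis (root_ang d j * (1 - 1 / real a))) \<le> C * exp (- (c / sqrt t))) (at_right 0)" for j C c
  have "\<forall>j\<in>J. \<exists>C c. C > 0 \<and> c > 0 \<and> Q j C c"
  proof
    fix j assume "j \<in> J"
    then have "j < d" "2 * j \<noteq> d" by (auto simp: J_def)
    from ratio_root[OF k a this] show "\<exists>C c. C > 0 \<and> c > 0 \<and> Q j C c"
      unfolding Q_def by blast
  qed
  then obtain C c where CQ: "\<forall>j\<in>J. C j > 0 \<and> c j > 0 \<and> Q j (C j) (c j)" by metis
  then have C: "\<And>j. j \<in> J \<Longrightarrow> C j > (0::real)" "\<And>j. j \<in> J \<Longrightarrow> c j > (0::real)"
    "\<And>j. j \<in> J \<Longrightarrow> Q j (C j) (c j)" by auto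
  \<comment> \<open>The inserted 1 makes the set nonempty for every \<open>d\<close>.\<close>
  define c0 where "c0 = Min (insert 1 (c ` J))"
  have c0: "c0 > 0" "\<And>j. j \<in> J \<Longrightarrow> c0 \<le> c j" using J C(2) by (auto simp: c0_def)
  define C0 where "C0 = 1 + sum C J"
  have sC: "sum C J \<ge> 0" using C(1) by (intro sum_nonneg) (simp add: less_imp_le)
  have "eventually (\<lambda>t. \<forall>j\<in>J. twist_sum k t 1 (root_arg d j) \<noteq> 0 \<and>
    norm (twist_sum k t (1 / real a) (root_arg d j) / twist_sum k t 1 (root_arg d j) - cis (root_ang d j * (1 - 1 / real a))) \<le> C j * exp (- (c j / sqrt t))) (at_right 0)"
    using J C(3)[unfolded Q_def] by (intro eventually_ball_finite) auto
  then have "eventually (\<lambda>t. (\<forall>j. j < d \<and> 2 * j \<noteq> d \<longrightarrow> twist_sum k t 1 (root_arg d j) \<noteq> 0) \<and>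
    norm (main_part a d k t - (\<Sum>j | j < d \<and> 2 * j \<noteq> d. cis (root_ang d j * (1 - 1 / real a)))) \<le> C0 * exp (- (c0 / sqrt t))) (at_right 0)"
    using eventually_at_right_le[OF zero_less_one]
  proof eventually_elim
    case (elim t)
    have "norm (main_part a d k t - (\<Sum>j\<in>J. cis (root_ang d j * (1 - 1 / real a))))
       = norm (\<Sum>j\<in>J. twist_sum k t (1 / real a) (root_arg d j) / twist_sum k t 1 (root_arg d j) - cis (root_ang d j * (1 - 1 / real a)))"
      by (simp add: main_part_def J_def sum_subtractf)
    also have "\<dots> \<le> (\<Sum>j\<in>J. norm (twist_sum k t (1 / real a) (root_arg d j) / twist_sum k t 1 (root_arg d j) - cis (root_ang d j * (1 - 1 / real a))))"
      by (rule norm_sum)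
    also have "\<dots> \<le> (\<Sum>j\<in>J. C j * exp (- (c0 / sqrt t)))"
    proof (rule sum_mono)
      fix j assume j: "j \<in> J"
      have "c0 / sqrt t \<le> c j / sqrt t" using c0(2)[OF j] elim by (intro divide_right_mono) auto
      then have "C j * exp (- (c j / sqrt t)) \<le> C j * exp (- (c0 / sqrt t))" using C(1)[OF j] by (intro mult_left_mono) auto
      then show "norm (twist_sum k t (1 / real a) (root_arg d j) / twist_sum k t 1 (root_arg d j) - cis (root_ang d j * (1 - 1 / real a))) \<le> C j * exp (- (c0 / sqrt t))"
        using elim j by force
    qed
    also have "\<dots> = sum C J * exp (- (c0 / sqrt t))" by (simp add: sum_distrib_right)
    also have "\<dots> \<le> C0 * exp (- (c0 / sqrt t))" by (intro mult_right_mono) (auto simp: C0_def)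
    finally show ?case using elim by (auto simp: J_def)
  qed
  then show ?thesis using sC c0(1) by (intro exI[of _ C0] conjI exI[of _ c0]) (auto simp: C0_def)
qed

theorem theorem4p5:
  fixes a d k :: nat
  assumes "a \<ge> 2" and "d \<ge> 2" and "k \<ge> 1"
  shows
    "(odd d \<longrightarrow>
       (\<exists>c>0.
          (\<forall>\<^sub>F t in at_right 0. \<not> is_pole (\<lambda>q. W a d q k) (of_real (exp (- t / real a)))) \<and>
          (\<lambda>t. W a d (of_real (exp (- t / real a))) k
                 - of_real (sin (pi / real a) /
                     (real d * sin (pi * (real a - 1) / (real a * real d)))))
            \<in> O[at_right 0](\<lambda>t. of_real (exp (- c / sqrt t))))) \<and>
     (even d \<longrightarrow>
       (\<exists>c>0. \<exists>C. \<forall>\<delta> t.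
          0 < \<delta> \<and> \<delta> \<le> 1 \<and> 0 < t \<and> \<bar>cos (Theta k t - phi k)\<bar> \<ge> \<delta> \<and> sqrt t \<le> c * \<delta> \<longrightarrow>
          \<not> is_pole (\<lambda>q. W a d q k) (of_real (exp (- t / real a))) \<and>
          norm (W a d (of_real (exp (- t / real a))) k
                 - of_real (sin (pi / real a) / real d *
                     (cot (pi * (real a - 1) / (real a * real d)) - tan (Theta k t - phi k))))
            \<le> C * (sqrt t / \<delta>\<^sup>2)))"
proof -
  define x where "x = pi * (real a - 1) / (real a * real d)"
  have sx: "sin x > 0" unfolding x_def by (rule sum_cis_value(1)[OF assms(1,2)])
  have sv: "(\<Sum>j | j < d \<and> 2 * j \<noteq> d. cis (root_ang d j * (1 - 1 / real a))) =
      of_real (if odd d then sin (pi / real a) / sin x else sin (pi / real a) * cot x + cos (pi / real a))"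
    unfolding x_def by (rule sum_cis_value(2)[OF assms(1,2)])
  have d0: "real d > 0" using assms(2) by simp
  obtain C c where C: "C > 0" "c > 0" and ev: "eventually (\<lambda>t. (\<forall>j. j < d \<and> 2 * j \<noteq> d \<longrightarrow> twist_sum k t 1 (root_arg d j) \<noteq> 0) \<and>
    norm (main_part a d k t - (\<Sum>j | j < d \<and> 2 * j \<noteq> d. cis (root_ang d j * (1 - 1 / real a)))) \<le> C * exp (- (c / sqrt t))) (at_right 0)"
    using main_part_asymp[OF assms(3,1)] by blast
  show ?thesis
  proof (rule conjI; rule impI)
    assume odd: "odd d"
    \<comment> \<open>For odd \<open>d\<close> the number - 1 is not a root of unity of order
      dividing \<open>d\<close>, so every term has an exponentially small error.\<close>
    have J: "{j. j < d \<and> 2 * j \<noteq> d} = {..<d}" using odd by auto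
    have S: "(\<Sum>j | j < d \<and> 2 * j \<noteq> d. cis (root_ang d j * (1 - 1 / real a))) = of_real (sin (pi / real a) / sin x)"
      using sv odd by simp
    have ev': "eventually (\<lambda>t. \<not> is_pole (\<lambda>q. W a d q k) (of_real (exp (- t / real a))) \<and>
       norm (W a d (of_real (exp (- t / real a))) k - of_real (sin (pi / real a) / (real d * sin x))) \<le> C * norm (of_real (exp (- c / sqrt t)) :: complex)) (at_right 0)"
      using ev eventually_at_right_le[OF zero_less_one]
    proof eventually_elim
      case (elim t)
      have t: "t > 0" using elim by simp
      have nz: "\<And>j. j < d \<Longrightarrow> twist_sum k t 1 (root_arg d j) \<noteq> 0" using elim odd by auto
      note W = W_eq_sum[OF assms(3,1,2) t nz]
      have "W a d (of_real (exp (- t / real a))) k - of_real (sin (pi / real a) / (real d * sin x))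
         = 1 / of_nat d * (main_part a d k t - (\<Sum>j | j < d \<and> 2 * j \<noteq> d. cis (root_ang d j * (1 - 1 / real a))))"
      proof -
        have "W a d (of_real (exp (- t / real a))) k = 1 / of_nat d * main_part a d k t"
          unfolding main_part_def J by (rule W(2))
        then show ?thesis unfolding S by (simp add: right_diff_distrib)
      qed
      then have "norm (W a d (of_real (exp (- t / real a))) k - of_real (sin (pi / real a) / (real d * sin x)))
         = 1 / real d * norm (main_part a d k t - (\<Sum>j | j < d \<and> 2 * j \<noteq> d. cis (root_ang d j * (1 - 1 / real a))))"
        by (simp add: norm_mult norm_divide)
      also have "\<dots> \<le> 1 * (C * exp (- (c / sqrt t)))"
        using elim assms(2) by (intro mult_mono) auto
      finally show ?case using W(1) by simp
    qed
    show "\<exists>c>0.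
          (\<forall>\<^sub>F t in at_right 0. \<not> is_pole (\<lambda>q. W a d q k) (of_real (exp (- t / real a)))) \<and>
          (\<lambda>t. W a d (of_real (exp (- t / real a))) k
                 - of_real (sin (pi / real a) /
                     (real d * sin (pi * (real a - 1) / (real a * real d)))))
            \<in> O[at_right 0](\<lambda>t. of_real (exp (- c / sqrt t)))"
      unfolding x_def[symmetric]
    proof (intro exI[of _ c] conjI C(2))
      show "\<forall>\<^sub>F t in at_right 0. \<not> is_pole (\<lambda>q. W a d q k) (of_real (exp (- t / real a)))"
        using ev' by eventually_elim simp
      show "(\<lambda>t. W a d (of_real (exp (- t / real a))) k - of_real (sin (pi / real a) / (real d * sin x)))
            \<in> O[at_right 0](\<lambda>t. of_real (exp (- c / sqrt t)))"
        by (rule bigoI[of _ C]) (use ev' in \<open>eventually_elim, simp\<close>)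
    qed
  next
    assume even: "even d"
    then obtain e where e: "d = 2 * e" by auto
    have e0: "e > 0" using assms(2) e by simp
    have rte: "root_arg d e = pi" using e e0 by (simp add: root_arg_def)
    have J: "{..<d} = insert e {j. j < d \<and> 2 * j \<noteq> d}" "e \<notin> {j. j < d \<and> 2 * j \<noteq> d}" using e e0 by auto
    have S: "(\<Sum>j | j < d \<and> 2 * j \<noteq> d. cis (root_ang d j * (1 - 1 / real a))) = of_real (sin (pi / real a) * cot x + cos (pi / real a))"
      using sv even by simp
    \<comment> \<open>Regroups the error: \<open>co\<close>, the cosine of \<open>pi / a\<close>,
      occurs with opposite signs in the even Dirichlet value and in the limit at the root - 1, and
      only cotangent and tangent survive.\<close>
    have gen: "1 / of_nat d * (r + m) - of_real (s / real d * (u - T)) =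
        1 / of_nat d * ((m - of_real (s * u + co)) + (r - of_real (- (co + s * T))))" for r m :: complex and s u T co
    proof -
      have "of_real (s / real d * (u - T)) = 1 / (of_nat d :: complex) * of_real (s * (u - T))" by simp
      then have "1 / of_nat d * (r + m) - of_real (s / real d * (u - T)) = 1 / of_nat d * (r + m - of_real (s * (u - T)))"
        by (simp only: right_diff_distrib)
      also have "r + m - of_real (s * (u - T)) = (m - of_real (s * u + co)) + (r - of_real (- (co + s * T)))"
        by (simp add: algebra_simps)
      finally show ?thesis .
    qed
    have "0 < 1 / real a" "1 / real a \<le> 1" using assms(1) by auto
    from ratio_pi[OF assms(3) this] obtain C1 c1 where R: "C1 > 0" "c1 > 0"
      "\<And>\<delta> t. 0 < \<delta> \<Longrightarrow> \<delta> \<le> 1 \<Longrightarrow> 0 < t \<Longrightarrow> \<bar>cos (Theta k t - phi k)\<bar> \<ge> \<delta> \<Longrightarrow> sqrt t \<le> c1 * \<delta> \<Longrightarrow>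
       twist_sum k t 1 pi \<noteq> 0 \<and>
       norm (twist_sum k t (1 / real a) pi / twist_sum k t 1 pi - of_real (- (cos (pi / real a) + sin (pi / real a) * tan (Theta k t - phi k)))) \<le> C1 * (sqrt t / \<delta>\<^sup>2)"
      by auto
    obtain t1 where t1: "t1 > 0" "\<And>t. 0 < t \<Longrightarrow> t < t1 \<Longrightarrow> (\<forall>j. j < d \<and> 2 * j \<noteq> d \<longrightarrow> twist_sum k t 1 (root_arg d j) \<noteq> 0) \<and>
      norm (main_part a d k t - (\<Sum>j | j < d \<and> 2 * j \<noteq> d. cis (root_ang d j * (1 - 1 / real a)))) \<le> C * exp (- (c / sqrt t))"
      using ev unfolding eventually_at_right_field by blast
    \<comment> \<open>Half of \<open>t1\<close>, because the eventual estimates hold for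
      \<open>t\<close> strictly below \<open>t1\<close>.\<close>
    define c2 where "c2 = min c1 (sqrt (t1 / 2))"
    have c2: "c2 > 0" using R(2) t1(1) by (simp add: c2_def)
    define C2 where "C2 = C / c + C1"
    have main: "\<not> is_pole (\<lambda>q. W a d q k) (of_real (exp (- t / real a))) \<and>
          norm (W a d (of_real (exp (- t / real a))) k
                 - of_real (sin (pi / real a) / real d * (cot x - tan (Theta k t - phi k))))
            \<le> C2 * (sqrt t / \<delta>\<^sup>2)"
      if h: "0 < \<delta>" "\<delta> \<le> 1" "0 < t" "\<bar>cos (Theta k t - phi k)\<bar> \<ge> \<delta>" "sqrt t \<le> c2 * \<delta>" for \<delta> t
    proof -
      define T where "T = tan (Theta k t - phi k)"
      have "c2 * \<delta> \<le> sqrt (t1 / 2) * 1" using h c2 by (intro mult_mono) (auto simp: c2_def)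
      then have "sqrt t \<le> sqrt (t1 / 2)" using h by linarith
      then have "t < t1" using t1(1) by simp
      note E = t1(2)[OF h(3) this]
      have "c2 * \<delta> \<le> c1 * \<delta>" using h by (intro mult_right_mono) (auto simp: c2_def)
      then have "sqrt t \<le> c1 * \<delta>" using h by linarith
      note P = R(3)[OF h(1-4) this, folded T_def]
      have nz: "twist_sum k t 1 (root_arg d j) \<noteq> 0" if "j < d" for j
        using E P that rte e by (cases "j = e") auto
      note W = W_eq_sum[OF assms(3,1,2) h(3) nz]
      define r where "r = twist_sum k t (1 / real a) pi / twist_sum k t 1 pi"
      have R: "(\<Sum>j<d. twist_sum k t (1 / real a) (root_arg d j) / twist_sum k t 1 (root_arg d j)) = r + main_part a d k t"
        unfolding J(1) using J(2) by (simp add: rte r_def main_part_def)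
      have Weq: "W a d (of_real (exp (- t / real a))) k = 1 / of_nat d * (r + main_part a d k t)"
        unfolding R[symmetric] by (rule W(2))
      have "W a d (of_real (exp (- t / real a))) k - of_real (sin (pi / real a) / real d * (cot x - T))
        = 1 / of_nat d * ((main_part a d k t - (\<Sum>j | j < d \<and> 2 * j \<noteq> d. cis (root_ang d j * (1 - 1 / real a))))
            + (r - of_real (- (cos (pi / real a) + sin (pi / real a) * T))))"
        unfolding Weq S by (rule gen)
      then have "norm (W a d (of_real (exp (- t / real a))) k - of_real (sin (pi / real a) / real d * (cot x - T)))
        = 1 / real d * norm ((main_part a d k t - (\<Sum>j | j < d \<and> 2 * j \<noteq> d. cis (root_ang d j * (1 - 1 / real a))))
            + (r - of_real (- (cos (pi / real a) + sin (pi / real a) * T))))"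
        by (simp only: norm_mult norm_divide norm_one norm_of_nat)
      also have "\<dots> \<le> 1 * (C * exp (- (c / sqrt t)) + C1 * (sqrt t / \<delta>\<^sup>2))"
      proof (rule mult_mono)
        show "1 / real d \<le> 1" using assms(2) by simp
        show "norm ((main_part a d k t - (\<Sum>j | j < d \<and> 2 * j \<noteq> d. cis (root_ang d j * (1 - 1 / real a))))
            + (r - of_real (- (cos (pi / real a) + sin (pi / real a) * T)))) \<le> C * exp (- (c / sqrt t)) + C1 * (sqrt t / \<delta>\<^sup>2)"
          using E P unfolding r_def by (intro norm_triangle_mono) auto
      qed auto
      \<comment> \<open>The exponentially small part is traded for \<open>sqrt t / c\<close>, and
        \<open>\<delta> <= 1\<close> allows the division by \<open>\<delta>\<close> squared.\<close>
      also have "C * exp (- (c / sqrt t)) \<le> C / c * (sqrt t / \<delta>\<^sup>2)"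
      proof -
        have "c / sqrt t \<le> exp (c / sqrt t)" using exp_ge_add_one_self[of "c / sqrt t"] by linarith
        then have "1 / exp (c / sqrt t) \<le> 1 / (c / sqrt t)" using C h by (intro divide_left_mono) auto
        then have "exp (- (c / sqrt t)) \<le> sqrt t / c" by (simp add: exp_minus inverse_eq_divide)
        also have "\<dots> \<le> (sqrt t / \<delta>\<^sup>2) / c"
        proof -
          have "\<delta>\<^sup>2 \<le> 1" using h by (simp add: power_le_one)
          then have "sqrt t / 1 \<le> sqrt t / \<delta>\<^sup>2" using h by (intro divide_left_mono) auto
          then show ?thesis using C by (intro divide_right_mono) auto
        qed
        finally have "C * exp (- (c / sqrt t)) \<le> C * ((sqrt t / \<delta>\<^sup>2) / c)" using C by (intro mult_left_mono) auto
        then show ?thesis by (simp add: mult.commute)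
      qed
      finally have F: "norm (W a d (of_real (exp (- t / real a))) k - of_real (sin (pi / real a) / real d * (cot x - T)))
        \<le> 1 * (C / c * (sqrt t / \<delta>\<^sup>2) + C1 * (sqrt t / \<delta>\<^sup>2))"
        by simp
      have "1 * (C / c * (sqrt t / \<delta>\<^sup>2) + C1 * (sqrt t / \<delta>\<^sup>2)) = C2 * (sqrt t / \<delta>\<^sup>2)"
        unfolding C2_def distrib_right by simp
      with F have "norm (W a d (of_real (exp (- t / real a))) k - of_real (sin (pi / real a) / real d * (cot x - T))) \<le> C2 * (sqrt t / \<delta>\<^sup>2)"
        by (simp only:)
      moreover have "\<not> is_pole (\<lambda>q. W a d q k) (of_real (exp (- t / real a)))" by (rule W(1))
      ultimately show ?thesis unfolding T_def by blast
    qed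
    show "\<exists>c>0. \<exists>C. \<forall>\<delta> t.
          0 < \<delta> \<and> \<delta> \<le> 1 \<and> 0 < t \<and> \<bar>cos (Theta k t - phi k)\<bar> \<ge> \<delta> \<and> sqrt t \<le> c * \<delta> \<longrightarrow>
          \<not> is_pole (\<lambda>q. W a d q k) (of_real (exp (- t / real a))) \<and>
          norm (W a d (of_real (exp (- t / real a))) k
                 - of_real (sin (pi / real a) / real d *
                     (cot (pi * (real a - 1) / (real a * real d)) - tan (Theta k t - phi k))))
            \<le> C * (sqrt t / \<delta>\<^sup>2)"
      unfolding x_def[symmetric]
      by (rule exI[of _ c2], rule conjI[OF c2], rule exI[of _ C2]) (use main in blast)
  qed
qed

end
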